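(* Let $M$ be a matroid of rank $d+1$ on $E$, let $i\in E$ be a coloop of $M$ such that $\{i\}$ is a flat. Let $S_i=\{F_1,\ldots,F_k\}$ and the fan $\Delta_k$ be as in the context, and let $\operatorname{Vol}_{M\setminus i}(x_G)_{G\in\mathcal{L}^{nt}(M\setminus i)}$ be the mixed volume of $M\setminus i$. Suppose real numbers $b_{\overline G}$ satisfy $\partial_i-\partial_{E\setminus i}=\sum_{G\in\mathcal{L}^{nt}(M\setminus i)}b_{\overline G}\partial_{\overline G}$ in $\operatorname{CH}(\Delta_k)$. Then \[\operatorname{Vol}_{\Delta_k}=\int\operatorname{Vol}_{M\setminus i}(x_{\overline G}+b_{\overline G}x_i)\,dx_i+\int\operatorname{Vol}_{M\setminus i}(x_{\overline G}-b_{\overline G}x_{E\setminus i})\,dx_{E\setminus i},\] where $\int g\,dx$ denotes the antiderivative of the polynomial $g$ in $x$ with zero constant term.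
   Context: Matroid notation: $\mathcal{L}(M)$ is the lattice of flats, $\mathcal{L}^{nt}(M)=\mathcal{L}(M)\setminus\{\emptyset,E\}$. The deletion $M\setminus i$ has flats $F\setminus i$, $F\in\mathcal{L}(M)$; $i$ is a coloop if $M\setminus i$ has smaller rank than $M$ (then $\{i\}$ and $E\setminus i$ are flats of $M$). For a flat $G$ of $M\setminus i$, $\overline G$ is its closure in $M$. The set $S_i$ consists of all $F\subseteq E$ with $F$ and $F\cup i$ distinct nontrivial flats of $M$, ordered $F_1,\ldots,F_k$ refining inclusion. The fan $\Delta_k$: rays are the equivalence classes of $\mathcal{L}^{nt}(M)$ under identifying $F_l$ with $F_l\cup i$ for $l=1,\ldots,k$ (other classes singletons), cones are images of chains of $\mathcal{L}^{nt}(M)$, embedded in $\mathbb{R}^E/\mathbb{R}e_E$ with class $\{F_l,F_l\cup i\}\mapsto e_{F_l}$ and $\{F\}\mapsto e_F$ ($e_F=\sum_{a\in F}e_a$). Its rays are $\{i\}$, $\{E\setminus i\}$, and, for each $G\in\mathcal{L}^{nt}(M\setminus i)$, the class containing $\overline G$; correspondingly $\operatorname{Vol}_{\Delta_k}$ has variables $x_i,x_{E\setminus i},x_{\overline G}$. For such a fan (abstract simplicial fan with ray vectors, independent on each cone): $\operatorname{CH}(\Delta)$ is the Stanley–Reisner ring $\mathbb{R}[\partial_\rho]/(\text{square-free monomials of rays not in a common cone})$ modulo the linear forms $\sum_\rho\ell(v_\rho)\partial_\rho$ for global linear functions $\ell$; the mixed volume (weight $1$ on maximal cones) is the unique homogeneous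 degree $d$ (here $d$ is the dimension of the fan) polynomial $V$ with $f(\partial/\partial x_\rho)V=\phi(\text{class of }f)$ for all degree $d$ polynomials $f$, $\phi$ the linear functional on degree $d$ with $\phi(\partial_\sigma)=1$ for every maximal cone $\sigma$. The mixed volume of a matroid is that of its Bergman fan (rays $e_F$ for nontrivial flats $F$, cones = chains) with weight $1$. *)

theory Defs
  imports Complex_Main "HOL-Library.Poly_Mapping" "HOL-Library.Indicator_Function"
    "HOL-Algebra.QuotRing"
begin

section \<open>Matroids\<close>

record 'a matroid =
  ground :: "'a set"
  indep :: "'a set set"

definition is_matroid :: "'a matroid \<Rightarrow> bool" where
  "is_matroid M \<longleftrightarrow>
     finite (ground M) \<and>
     (\<forall>X\<in>indep M. X \<subseteq> ground M) \<and>
     {} \<in> indep M \<and>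
     (\<forall>X\<in>indep M. \<forall>Y. Y \<subseteq> X \<longrightarrow> Y \<in> indep M) \<and>
     (\<forall>X\<in>indep M. \<forall>Y\<in>indep M. card X < card Y \<longrightarrow> (\<exists>y\<in>Y - X. insert y X \<in> indep M))"

definition rank_in :: "'a matroid \<Rightarrow> 'a set \<Rightarrow> nat" where
  "rank_in M X = Max (card ` {I \<in> indep M. I \<subseteq> X})"

definition mrank :: "'a matroid \<Rightarrow> nat" where
  "mrank M = rank_in M (ground M)"

definition mclosure :: "'a matroid \<Rightarrow> 'a set \<Rightarrow> 'a set" where
  "mclosure M X = {e \<in> ground M. rank_in M (insert e X) = rank_in M X}"

definition flats :: "'a matroid \<Rightarrow> 'a set set" where
  "flats M = {F. F \<subseteq> ground M \<and> mclosure M F = F}"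

definition nontrivial_flats :: "'a matroid \<Rightarrow> 'a set set" where
  "nontrivial_flats M = flats M - {{}, ground M}"

definition deletion :: "'a matroid \<Rightarrow> 'a \<Rightarrow> 'a matroid" where
  "deletion M i = \<lparr>ground = ground M - {i}, indep = {X \<in> indep M. i \<notin> X}\<rparr>"

definition coloop :: "'a matroid \<Rightarrow> 'a \<Rightarrow> bool" where
  "coloop M i \<longleftrightarrow> i \<in> ground M \<and> mrank (deletion M i) < mrank M"

definition S_set :: "'a matroid \<Rightarrow> 'a \<Rightarrow> 'a set set" where
  "S_set M i = {F. F \<in> nontrivial_flats M \<and> insert i F \<in> nontrivial_flats M \<and> F \<noteq> insert i F}"

section \<open>Polynomials\<close>

text \<open>Polynomials with real coefficients in commuting variables of type 'v: a monomial is a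
  finitely supported exponent function, multiplication is convolution.\<close>

type_synonym 'v mpoly = "('v \<Rightarrow>\<^sub>0 nat) \<Rightarrow>\<^sub>0 real"

definition pvar :: "'v \<Rightarrow> 'v mpoly" where
  "pvar v = Poly_Mapping.single (Poly_Mapping.single v 1) 1"

definition pconst :: "real \<Rightarrow> 'v mpoly" where
  "pconst c = Poly_Mapping.single 0 c"

definition pvars :: "'v mpoly \<Rightarrow> 'v set" where
  "pvars p = (\<Union>m\<in>Poly_Mapping.keys p. Poly_Mapping.keys m)"

definition mdegree :: "('v \<Rightarrow>\<^sub>0 nat) \<Rightarrow> nat" where
  "mdegree m = (\<Sum>v\<in>Poly_Mapping.keys m. Poly_Mapping.lookup m v)"

definition homogeneous :: "nat \<Rightarrow> 'v mpoly \<Rightarrow> bool" where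
  "homogeneous n p \<longleftrightarrow> (\<forall>m\<in>Poly_Mapping.keys p. mdegree m = n)"

definition partial :: "'v \<Rightarrow> 'v mpoly \<Rightarrow> 'v mpoly" where
  "partial v p = (\<Sum>m\<in>Poly_Mapping.keys p.
     Poly_Mapping.single (m - Poly_Mapping.single v 1)
       (real (Poly_Mapping.lookup m v) * Poly_Mapping.lookup p m))"

definition antideriv :: "'v \<Rightarrow> 'v mpoly \<Rightarrow> 'v mpoly" where
  "antideriv v p = (\<Sum>m\<in>Poly_Mapping.keys p.
     Poly_Mapping.single (m + Poly_Mapping.single v 1)
       (Poly_Mapping.lookup p m / real (Poly_Mapping.lookup m v + 1)))"

definition psubst :: "('v \<Rightarrow> 'w mpoly) \<Rightarrow> 'v mpoly \<Rightarrow> 'w mpoly" where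
  "psubst s p = (\<Sum>m\<in>Poly_Mapping.keys p. pconst (Poly_Mapping.lookup p m) *
     (\<Prod>v\<in>Poly_Mapping.keys m. s v ^ Poly_Mapping.lookup m v))"

text \<open>A monomial acts by iterated partial derivatives. These commute, so the value of the fold
  does not depend on the order.\<close>

definition mono_diff :: "('v \<Rightarrow>\<^sub>0 nat) \<Rightarrow> 'v mpoly \<Rightarrow> 'v mpoly" where
  "mono_diff m V =
     Finite_Set.fold (\<lambda>v. partial v ^^ Poly_Mapping.lookup m v) V (Poly_Mapping.keys m)"

definition pdiff :: "'v mpoly \<Rightarrow> 'v mpoly \<Rightarrow> 'v mpoly" where
  "pdiff f V = (\<Sum>m\<in>Poly_Mapping.keys f. pconst (Poly_Mapping.lookup f m) * mono_diff m V)"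

definition mpoly_ring :: "'v set \<Rightarrow> 'v mpoly ring" where
  "mpoly_ring X = \<lparr>carrier = {p. pvars p \<subseteq> X}, mult = (*), one = 1, zero = 0, add = (+)\<rparr>"

section \<open>Fans and their Chow rings\<close>

text \<open>An abstract fan in the real vector space of functions on E modulo the line spanned by the
  all-ones vector of E, where E is the field \<open>ambient\<close>. A cone is given by its set of rays, and
  a vector of the quotient by a representative: a function that vanishes outside E.\<close>

record ('v, 'a) fan =
  ambient :: "'a set"
  rays :: "'v set"
  cones :: "'v set set"
  ray_vec :: "'v \<Rightarrow> 'a \<Rightarrow> real"

definition linear_functions :: "'a set \<Rightarrow> (('a \<Rightarrow> real) \<Rightarrow> real) set" where
  "linear_functions E = {l.
     (\<forall>u v. (\<forall>a. a \<notin> E \<longrightarrow> u a = 0 \<and> v a = 0) \<longrightarrow> l (\<lambda>a. u a + v a) = l u + l v) \<and>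
     (\<forall>c u. (\<forall>a. a \<notin> E \<longrightarrow> u a = 0) \<longrightarrow> l (\<lambda>a. c * u a) = c * l u) \<and>
     l (indicator E) = 0}"

definition fan_dim :: "('v, 'a) fan \<Rightarrow> nat" where
  "fan_dim D = Max (card ` cones D)"

definition maximal_cones :: "('v, 'a) fan \<Rightarrow> 'v set set" where
  "maximal_cones D = {\<sigma> \<in> cones D. \<forall>\<tau>\<in>cones D. \<sigma> \<subseteq> \<tau> \<longrightarrow> \<tau> = \<sigma>}"

definition sr_generators :: "('v, 'a) fan \<Rightarrow> 'v mpoly set" where
  "sr_generators D = {\<Prod>\<rho>\<in>N. pvar \<rho> | N. finite N \<and> N \<subseteq> rays D \<and> \<not> (\<exists>\<sigma>\<in>cones D. N \<subseteq> \<sigma>)}"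

definition linear_generators :: "('v, 'a) fan \<Rightarrow> 'v mpoly set" where
  "linear_generators D =
     {\<Sum>\<rho>\<in>rays D. pconst (l (ray_vec D \<rho>)) * pvar \<rho> | l. l \<in> linear_functions (ambient D)}"

definition chow_ideal :: "('v, 'a) fan \<Rightarrow> 'v mpoly set" where
  "chow_ideal D = genideal (mpoly_ring (rays D)) (sr_generators D \<union> linear_generators D)"

definition CH :: "('v, 'a) fan \<Rightarrow> 'v mpoly set ring" where
  "CH D = mpoly_ring (rays D) Quot chow_ideal D"

definition chow_class :: "('v, 'a) fan \<Rightarrow> 'v mpoly \<Rightarrow> 'v mpoly set" where
  "chow_class D f = chow_ideal D +>\<^bsub>mpoly_ring (rays D)\<^esub> f"

definition forms :: "('v, 'a) fan \<Rightarrow> nat \<Rightarrow> 'v mpoly set" where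
  "forms D n = {f \<in> carrier (mpoly_ring (rays D)). homogeneous n f}"

text \<open>Only the values of \<open>\<phi>\<close> on the graded piece of degree \<open>fan_dim D\<close> are constrained.\<close>

definition is_degree_map :: "('v, 'a) fan \<Rightarrow> ('v mpoly set \<Rightarrow> real) \<Rightarrow> bool" where
  "is_degree_map D \<phi> \<longleftrightarrow>
     (\<forall>x\<in>chow_class D ` forms D (fan_dim D). \<forall>y\<in>chow_class D ` forms D (fan_dim D).
        \<phi> (x \<oplus>\<^bsub>CH D\<^esub> y) = \<phi> x + \<phi> y) \<and>
     (\<forall>c. \<forall>x\<in>chow_class D ` forms D (fan_dim D).
        \<phi> (chow_class D (pconst c) \<otimes>\<^bsub>CH D\<^esub> x) = c * \<phi> x) \<and>
     (\<forall>\<sigma>\<in>maximal_cones D. \<phi> (chow_class D (\<Prod>\<rho>\<in>\<sigma>. pvar \<rho>)) = 1)"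

definition mixed_volume :: "('v, 'a) fan \<Rightarrow> 'v mpoly" where
  "mixed_volume D = (THE V. V \<in> forms D (fan_dim D) \<and>
     (\<exists>\<phi>. is_degree_map D \<phi> \<and>
        (\<forall>f\<in>forms D (fan_dim D). pdiff f V = pconst (\<phi> (chow_class D f)))))"

section \<open>The fans of a matroid\<close>

definition bergman_fan :: "'a matroid \<Rightarrow> ('a set, 'a) fan" where
  "bergman_fan M = \<lparr>ambient = ground M, rays = nontrivial_flats M,
     cones = {C. subset.chain (nontrivial_flats M) C}, ray_vec = (\<lambda>F. indicator F)\<rparr>"

definition matroid_volume :: "'a matroid \<Rightarrow> 'a set mpoly" where
  "matroid_volume M = mixed_volume (bergman_fan M)"

text \<open>Here \<open>Fs 1, \<dots>, Fs k\<close> are the first \<open>k\<close> elements of \<open>S_set M i\<close>, and the relation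
  identifies \<open>Fs l\<close> with \<open>insert i (Fs l)\<close>.\<close>

definition ident_rel :: "'a matroid \<Rightarrow> 'a \<Rightarrow> (nat \<Rightarrow> 'a set) \<Rightarrow> nat \<Rightarrow> ('a set \<times> 'a set) set" where
  "ident_rel M i Fs k = {(A, B). A \<in> nontrivial_flats M \<and> B \<in> nontrivial_flats M \<and>
     (A = B \<or> (\<exists>l\<in>{1..k}. {A, B} = {Fs l, insert i (Fs l)}))}"

definition ray_class :: "'a matroid \<Rightarrow> 'a \<Rightarrow> (nat \<Rightarrow> 'a set) \<Rightarrow> nat \<Rightarrow> 'a set \<Rightarrow> 'a set set" where
  "ray_class M i Fs k A = ident_rel M i Fs k `` {A}"

text \<open>The intersection of the class \<open>{Fs l, insert i (Fs l)}\<close> is \<open>Fs l\<close>, that of \<open>{A}\<close> is \<open>A\<close>.\<close>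

definition delta_fan :: "'a matroid \<Rightarrow> 'a \<Rightarrow> (nat \<Rightarrow> 'a set) \<Rightarrow> nat \<Rightarrow> ('a set set, 'a) fan" where
  "delta_fan M i Fs k = \<lparr>ambient = ground M,
     rays = nontrivial_flats M // ident_rel M i Fs k,
     cones = {ray_class M i Fs k ` C | C. subset.chain (nontrivial_flats M) C},
     ray_vec = (\<lambda>\<rho>. indicator (\<Inter>\<rho>))\<rparr>"

end

theory Submission
  imports Defs
begin

text \<open>Since \<open>{i}\<close> is a flat, \<open>M\<close> has no loops, so every flat of \<open>M\<close> is \<open>G\<close> or \<open>G \<union> {i}\<close> for a flat
  \<open>G\<close> of \<open>N\<close>, the deletion of \<open>i\<close>. Hence \<open>S_i\<close> consists of all nontrivial flats of \<open>N\<close>, and the fan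
  is the suspension of the Bergman fan of \<open>N\<close> by the two rays \<open>i\<close> and \<open>E - i\<close>.

  On a pure simplicial fan, square-free monomials of cones span the top degree of the Chow ring, so
  the mixed volume is the only form of top degree that is annihilated by the relations of the Chow
  ring and on which every maximal cone acts as 1. Let \<open>V\<close> be the right-hand side and \<open>W\<close> the volume of
  \<open>N\<close>. The derivatives of \<open>V\<close> along \<open>i\<close> and \<open>E - i\<close> are the substituted volumes
  \<open>W(x + b x_i)\<close> and \<open>W(x - b x_{E-i})\<close>, which gives the monomial relations and the maximal cones. By
  the fundamental theorem of calculus the derivative of \<open>V\<close> along \<open>b\<close> is the difference of the two, which is
  the linear relation given by hypothesis; modulo it, all linear relations come from \<open>N\<close>.

  The volume of \<open>N\<close> itself exists because of the description of Backman, Eur and Simpson: in the nef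
  variables \<open>h_F\<close>, where \<open>h_F\<close> is minus the sum of \<open>x_G\<close> over all flats \<open>G\<close> containing \<open>F\<close>, the
  degree map is the indicator function of the dragon Hall--Rado condition.\<close>

section \<open>Exponents\<close>

text \<open>\<open>mixed_volume\<close> is a definite description, so nothing is known about the
  volume of N until some polynomial is shown to satisfy its defining property. Existence is usually
  read off the balancing condition of the fan. Here a number is prescribed for every top-degree
  monomial in the nef variables instead, so that the relations of the Chow ring become inequalities
  between ranks. The price is that flat variables are alternating sums of nef ones, and the
  vanishing of x_F x_G for incomparable F, G has to be extracted from a relation that mixes many
  such products.

  On the side of the suspension, the hypothesis is an equality of classes and not a linear function.
  As every ray is itself a cone, the ideal has no elements of degree one except the linear
  generators, and the hypothesis yields a functional with value 1 at e_i. Subtracting a multiple of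
  it makes any functional vanish at e_i, hence descend to E - i. That both antiderivatives have zero
  constant term matters: along b, each of them produces the substituted volume together with an
  unwanted W(x), and these two copies cancel.\<close>

abbreviation "lookup \<equiv> Poly_Mapping.lookup"
abbreviation "keys \<equiv> Poly_Mapping.keys"
abbreviation "single \<equiv> Poly_Mapping.single"

lemma poly_mapping_add_induct [case_names single add]:
  fixes p :: "'a \<Rightarrow>\<^sub>0 'b::ab_group_add"
  assumes single: "\<And>m c. P (single m c)" and add: "\<And>p q. P p \<Longrightarrow> P q \<Longrightarrow> P (p + q)"
  shows "P p"
proof -
  have "P (\<Sum>m\<in>A. single m (lookup p m))" if "finite A" for A
    using that
  proof induction
    case empty
    \<comment> \<open>\<open>single m 0\<close> is the zero polynomial for every \<open>m\<close>,
      so any exponent serves for the base case.\<close>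
    then show ?case using single[of undefined 0] by simp
  qed (simp add: add single)
  moreover have "(\<Sum>m\<in>keys p. single m (lookup p m)) = p"
    by (rule poly_mapping_eqI) (simp add: lookup_sum lookup_single when_def in_keys_iff)
  ultimately show ?thesis
    using finite_keys[of p] by metis
qed

text \<open>Subtraction of exponents truncates at 0. Splitting off one \<open>v\<close> as a
  summand, when there is one, replaces subtraction by cancellation in the computations with
  derivatives.\<close>

lemma exponent_cases:
  fixes m :: "'v \<Rightarrow>\<^sub>0 nat"
  obtains "lookup m v = 0" | n where "m = n + single v 1"
proof (cases "lookup m v = 0")
  case False
  then have "m = (m - single v 1) + single v 1"
    by (intro poly_mapping_eqI) (auto simp: lookup_add lookup_minus lookup_single when_def)
  then show ?thesis using that by blast
qed (use that in blast)

lemma exponent_induct [case_names zero add]: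
  fixes m :: "'v \<Rightarrow>\<^sub>0 nat"
  assumes "P 0" and "\<And>m v. P m \<Longrightarrow> P (m + single v 1)"
  shows "P m"
proof (induction "\<Sum>v\<in>keys m. lookup m v" arbitrary: m)
  case 0
  then have "keys m = {}" by (metis finite_keys sum_eq_0_iff in_keys_iff equals0I)
  then show ?case using assms(1) by simp
next
  case (Suc k)
  then obtain v where v: "v \<in> keys m" by fastforce
  then obtain n where n: "m = n + single v 1"
    by (metis exponent_cases in_keys_iff)
  have fin: "finite (keys m \<union> keys n)" by simp
  have "(\<Sum>w\<in>keys m. lookup m w) = (\<Sum>w\<in>keys m \<union> keys n. lookup m w)"
    by (rule sum.mono_neutral_left) (auto simp: in_keys_iff)
  also have "\<dots> = (\<Sum>w\<in>keys m \<union> keys n. lookup n w) + 1"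
    using v by (simp add: n lookup_add sum.distrib lookup_single when_def)
  also have "(\<Sum>w\<in>keys m \<union> keys n. lookup n w) = (\<Sum>w\<in>keys n. lookup n w)"
    by (rule sum.mono_neutral_right) (auto simp: in_keys_iff)
  finally have "P n" using Suc by simp
  then show ?case using assms(2) n by blast
qed

lemma mdegree_superset: "finite A \<Longrightarrow> keys m \<subseteq> A \<Longrightarrow> mdegree m = (\<Sum>v\<in>A. lookup m v)"
  unfolding mdegree_def by (rule sum.mono_neutral_left) (auto simp: in_keys_iff)

lemma mdegree_zero [simp]: "mdegree 0 = 0"
  by (simp add: mdegree_def)

lemma mdegree_single [simp]: "mdegree (single v k) = k"
  by (simp add: mdegree_def)

lemma keys_add_nat: "keys (m + n) = keys m \<union> keys (n :: 'v \<Rightarrow>\<^sub>0 nat)"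
  by (auto simp: in_keys_iff lookup_add)

lemma mdegree_add [simp]: "mdegree (m + n) = mdegree m + mdegree n"
proof -
  have *: "finite (keys m \<union> keys n)" by simp
  show ?thesis
    unfolding mdegree_superset[OF *, of m, simplified] mdegree_superset[OF *, of n, simplified]
    by (subst mdegree_superset[OF *]) (auto simp: keys_add_nat lookup_add sum.distrib)
qed

lemma mdegree_eq_0_iff [simp]: "mdegree m = 0 \<longleftrightarrow> m = 0"
proof
  assume "mdegree m = 0"
  then have "keys m = {}" by (metis mdegree_def finite_keys sum_eq_0_iff in_keys_iff equals0I)
  then show "m = 0" by simp
qed simp

text \<open>Every exponent of degree n+1 arises from one of degree n by adding a variable of
  \<open>X\<close>. The finiteness gives meaning to the sum that defines \<open>Q\<close>.\<close>

lemma finite_bounded_degree: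
  assumes "finite X"
  shows "finite {m. keys m \<subseteq> X \<and> mdegree m = n}"
proof (induction n)
  case 0
  then show ?case by (rule finite_subset[of _ "{0}"]) auto
next
  case (Suc n)
  have "{m. keys m \<subseteq> X \<and> mdegree m = Suc n}
        \<subseteq> (\<Union>v\<in>X. (\<lambda>m. m + single v 1) ` {m. keys m \<subseteq> X \<and> mdegree m = n})"
  proof
    fix m assume m: "m \<in> {m. keys m \<subseteq> X \<and> mdegree m = Suc n}"
    then have "keys m \<noteq> {}" by auto
    then obtain v where v: "v \<in> keys m" by blast
    then obtain k where k: "m = k + single v 1" by (metis exponent_cases in_keys_iff)
    have "v \<in> X" "keys k \<subseteq> X" "mdegree k = n"
      using m v k by (auto simp: keys_add_nat)
    then show "m \<in> (\<Union>v\<in>X. (\<lambda>m. m + single v 1) ` {m. keys m \<subseteq> X \<and> mdegree m = n})"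
      using k by auto
  qed
  then show ?case by (rule finite_subset) (use assms Suc in auto)
qed

section \<open>Polynomials and substitution\<close>

lemma pconst_add: "pconst (a + b) = pconst a + pconst b"
  by (simp add: pconst_def single_add)

lemma pconst_mult: "pconst (a * b) = pconst a * pconst b"
  by (simp add: pconst_def mult_single)

lemma pconst_uminus: "pconst (- a) = - pconst a"
  by (simp add: pconst_def single_uminus)

lemma pconst_sum: "pconst (sum f A) = (\<Sum>x\<in>A. pconst (f x))"
  by (induction A rule: infinite_finite_induct) (auto simp: pconst_add, auto simp: pconst_def)

lemma pconst_0 [simp]: "pconst 0 = 0"
  by (simp add: pconst_def)

lemma pconst_1 [simp]: "pconst 1 = 1"
  by (simp add: pconst_def)

lemma pconst_eq_iff [simp]: "pconst a = pconst b \<longleftrightarrow> a = b"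
  by (metis pconst_def lookup_single_eq)

lemma lookup_pconst_mult [simp]: "lookup (pconst c * p) m = c * lookup p m"
proof (induction p rule: poly_mapping_add_induct)
  case (single n a)
  then show ?case by (simp add: pconst_def mult_single lookup_single when_def)
qed (simp add: distrib_left lookup_add)

lemma lookup_pconst: "lookup (pconst c) m = (if m = 0 then c else 0)"
  by (simp add: pconst_def lookup_single when_def)

lemma lookup_pvar: "lookup (pvar v) m = (if m = single v 1 then 1 else 0)"
  by (auto simp: pvar_def lookup_single when_def)

lemma single_eq_pconst_mult: "single m c = pconst c * single m 1"
  by (simp add: pconst_def mult_single)

lemma single_exponent_add: "single (m + single v 1) c = single m c * pvar v"
  by (simp add: pvar_def mult_single)

lemma prod_pvar: "finite A \<Longrightarrow> (\<Prod>v\<in>A. pvar v) = single (\<Sum>v\<in>A. single v 1) 1"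
  by (induction A rule: finite_induct) (auto simp: pvar_def mult_single)

text \<open>Constants and the variables of \<open>S\<close> generate the polynomials in
  \<open>S\<close> as an algebra, so properties stable under sums and products, such as the chain
  rule, are checked on generators only.\<close>

lemma mpoly_induct [consumes 1, case_names const var add mult]:
  assumes "pvars p \<subseteq> S"
    and const: "\<And>c. P (pconst c)" and var: "\<And>v. v \<in> S \<Longrightarrow> P (pvar v)"
    and add: "\<And>p q. P p \<Longrightarrow> P q \<Longrightarrow> P (p + q)"
    and mult: "\<And>p q. P p \<Longrightarrow> P q \<Longrightarrow> P (p * q)"
  shows "P p"
proof -
  have mono: "keys m \<subseteq> S \<Longrightarrow> P (single m 1)" for m
  proof (induction m rule: exponent_induct)
    case zero
    then show ?case using const[of 1] by simp
  next
    case (add m v)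
    then show ?case
      unfolding single_exponent_add by (intro mult var) (auto simp: keys_add_nat)
  qed
  have "P (\<Sum>m\<in>A. single m (lookup p m))" if "finite A" "A \<subseteq> keys p" for A
    using that
  proof induction
    case empty
    then show ?case using const[of 0] by simp
  next
    case (insert m A)
    then have "keys m \<subseteq> S" using assms(1) by (auto simp: pvars_def)
    then have "P (single m (lookup p m))"
      by (subst single_eq_pconst_mult) (intro mult const mono)
    then show ?case using insert add by auto
  qed
  moreover have "(\<Sum>m\<in>keys p. single m (lookup p m)) = p"
    by (rule poly_mapping_eqI) (simp add: lookup_sum lookup_single when_def in_keys_iff)
  ultimately show ?thesis
    using finite_keys[of p] by (metis order_refl)
qed

lemma pvars_subset_iff: "pvars p \<subseteq> S \<longleftrightarrow> (\<forall>m. lookup p m \<noteq> 0 \<longrightarrow> keys m \<subseteq> S)"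
  unfolding pvars_def UN_subset_iff Ball_def in_keys_iff by (rule refl)

lemma pvars_pconst [simp]: "pvars (pconst c) = {}"
  by (auto simp: pvars_def pconst_def)

lemma pvars_zero [simp]: "pvars 0 = {}" and pvars_one [simp]: "pvars 1 = {}"
  by (auto simp: pvars_def)

lemma pvars_pvar [simp]: "pvars (pvar v) = {v}"
  by (auto simp: pvars_def pvar_def)

lemma pvars_add: "pvars p \<subseteq> S \<Longrightarrow> pvars q \<subseteq> S \<Longrightarrow> pvars (p + q) \<subseteq> S"
  unfolding pvars_def using keys_add[of p q] by blast

lemma pvars_uminus [simp]: "pvars (- p) = pvars p"
  by (auto simp: pvars_def in_keys_iff)

lemma pvars_diff: "pvars p \<subseteq> S \<Longrightarrow> pvars q \<subseteq> S \<Longrightarrow> pvars (p - q) \<subseteq> S"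
  using pvars_add[of p S "- q"] by simp

lemma pvars_mult: "pvars p \<subseteq> S \<Longrightarrow> pvars q \<subseteq> S \<Longrightarrow> pvars (p * q) \<subseteq> S"
proof -
  assume *: "pvars p \<subseteq> S" "pvars q \<subseteq> S"
  have "keys m \<subseteq> S" if m: "m \<in> keys (p * q)" for m
  proof -
    obtain a b where ab: "m = a + b" "a \<in> keys p" "b \<in> keys q"
      using keys_mult[of p q] m by blast
    then have "keys a \<subseteq> S" "keys b \<subseteq> S" using * by (auto simp: pvars_def)
    then show ?thesis by (simp add: ab keys_add_nat)
  qed
  then show ?thesis by (auto simp: pvars_def)
qed

lemma pvars_sum: "(\<And>x. x \<in> A \<Longrightarrow> pvars (f x) \<subseteq> S) \<Longrightarrow> pvars (sum f A) \<subseteq> S"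
  by (induction A rule: infinite_finite_induct) (simp_all add: pvars_add)

lemma pvars_prod: "(\<And>x. x \<in> A \<Longrightarrow> pvars (f x) \<subseteq> S) \<Longrightarrow> pvars (prod f A) \<subseteq> S"
  by (induction A rule: infinite_finite_induct) (simp_all add: pvars_mult)

lemma psubst_superset:
  assumes "finite A" "keys p \<subseteq> A"
  shows "psubst s p = (\<Sum>m\<in>A. pconst (lookup p m) * (\<Prod>v\<in>keys m. s v ^ lookup m v))"
  unfolding psubst_def using assms
  by (intro sum.mono_neutral_left) (auto simp: in_keys_iff)

lemma psubst_add: "psubst s (p + q) = psubst s p + psubst s q"
proof -
  have fin: "finite (keys p \<union> keys q)" by simp
  show ?thesis
    using keys_add[of p q] fin
    by (simp add: psubst_superset[OF fin] lookup_add pconst_add distrib_right sum.distrib)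
qed

lemma psubst_single: "psubst s (single m c) = pconst c * (\<Prod>v\<in>keys m. s v ^ lookup m v)"
  by (simp add: psubst_def)

lemma psubst_pconst [simp]: "psubst s (pconst c) = pconst c"
  unfolding pconst_def by (subst psubst_single) (simp add: pconst_def)

lemma psubst_zero [simp]: "psubst s 0 = 0" and psubst_one [simp]: "psubst s 1 = 1"
  using psubst_pconst[of s 0] psubst_pconst[of s 1] by (simp_all)

lemma psubst_pvar [simp]: "psubst s (pvar v) = s v"
  unfolding pvar_def by (subst psubst_single) simp

lemma psubst_mult: "psubst s (p * q) = psubst s p * psubst s q"
proof (induction p rule: poly_mapping_add_induct)
  case (single m c)
  show ?case
  proof (induction q rule: poly_mapping_add_induct)
    case (single n b)
    \<comment> \<open>The supports of the two exponents differ; all products are extended to the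
      common support, where the added exponents are 0.\<close>
    have *: "(\<Prod>v\<in>keys k. s v ^ lookup k v) = (\<Prod>v\<in>keys m \<union> keys n. s v ^ lookup k v)"
      if "keys k \<subseteq> keys m \<union> keys n" for k
      using that by (intro prod.mono_neutral_left) (auto simp: in_keys_iff)
    show ?case
      by (simp add: mult_single psubst_single keys_add_nat *[of m] *[of n] lookup_add power_add
          prod.distrib pconst_mult)
  qed (simp add: distrib_left psubst_add)
qed (simp add: distrib_right psubst_add)

lemma psubst_sum: "psubst s (sum f A) = (\<Sum>x\<in>A. psubst s (f x))"
  by (induction A rule: infinite_finite_induct) (auto simp: psubst_add)

lemma psubst_cong:
  assumes "\<And>v. v \<in> pvars p \<Longrightarrow> s v = t v"
  shows "psubst s p = psubst t p"
proof -
  have "pvars p \<subseteq> pvars p" by simp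
  then have "psubst s p = psubst t p \<and> True"
    by (induction p rule: mpoly_induct) (auto simp: psubst_add psubst_mult assms)
  then show ?thesis by simp
qed

lemma psubst_psubst: "psubst s (psubst t p) = psubst (\<lambda>v. psubst s (t v)) p"
proof -
  have "pvars p \<subseteq> UNIV" by simp
  then show ?thesis
    by (induction p rule: mpoly_induct) (auto simp: psubst_add psubst_mult)
qed

lemma pvars_psubst:
  assumes "\<And>v. v \<in> pvars p \<Longrightarrow> pvars (s v) \<subseteq> S"
  shows "pvars (psubst s p) \<subseteq> S"
proof -
  have "pvars p \<subseteq> pvars p" by simp
  then show ?thesis
    by (induction p rule: mpoly_induct) (simp_all add: psubst_add psubst_mult assms pvars_add pvars_mult)
qed

section \<open>Differentiation\<close>

text \<open>Linearity, commutation of partial derivatives and the interplay with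
  \<open>antideriv\<close> are all read off from this formula and
  \<open>lookup_antideriv\<close>.\<close>

lemma lookup_partial: "lookup (partial v p) n = real (lookup n v + 1) * lookup p (n + single v 1)"
proof -
  have *: "(real (lookup m v) * lookup p m when m - single v 1 = n)
     = (if m = n + single v 1 then real (lookup n v + 1) * lookup p m else 0)" for m
    by (rule exponent_cases[of m v]) (auto simp: when_def lookup_add)
  show ?thesis
    unfolding partial_def lookup_sum lookup_single * by (auto simp: in_keys_iff)
qed

lemma lookup_antideriv:
  "lookup (antideriv v p) n = (if lookup n v = 0 then 0 else lookup p (n - single v 1) / real (lookup n v))"
proof (rule exponent_cases[of n v])
  assume "lookup n v = 0"
  moreover have "m + single v 1 \<noteq> n" if "lookup n v = 0" for m
    using that by (metis add_is_0 lookup_add lookup_single_eq zero_neq_one)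
  ultimately show ?thesis
    by (simp add: antideriv_def lookup_sum lookup_single when_def)
next
  fix k assume n: "n = k + single v 1"
  show ?thesis
    unfolding antideriv_def lookup_sum lookup_single n
    by (auto simp: when_def in_keys_iff lookup_add)
qed

lemma partial_add: "partial v (p + q) = partial v p + partial v q"
  by (rule poly_mapping_eqI) (simp add: lookup_partial lookup_add algebra_simps)

lemma partial_zero [simp]: "partial v 0 = 0"
  by (rule poly_mapping_eqI) (simp add: lookup_partial)

lemma partial_pconst_mult: "partial v (pconst c * p) = pconst c * partial v p"
  by (rule poly_mapping_eqI) (simp add: lookup_partial)

lemma partial_sum: "partial v (sum f A) = (\<Sum>x\<in>A. partial v (f x))"
  by (induction A rule: infinite_finite_induct) (auto simp: partial_add)

lemma partial_commute: "partial v (partial w p) = partial w (partial v p)"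
  by (rule poly_mapping_eqI)
    (auto simp: lookup_partial lookup_add lookup_single when_def add.commute add.left_commute)

lemma single_add_eq_0_iff: "n + single v 1 = (0 :: 'v \<Rightarrow>\<^sub>0 nat) \<longleftrightarrow> False"
  by (metis add_is_0 lookup_add lookup_single_eq lookup_zero zero_neq_one)

lemma partial_pconst [simp]: "partial v (pconst c) = 0"
  by (rule poly_mapping_eqI) (simp add: lookup_partial lookup_pconst single_add_eq_0_iff[simplified])

lemma partial_single: "partial v (single m c) = single (m - single v 1) (real (lookup m v) * c)"
  by (cases "c = 0") (auto simp: partial_def)

lemma partial_pvar: "partial v (pvar w) = (if v = w then 1 else 0)"
  by (auto simp: pvar_def partial_single lookup_single when_def)

lemma partial_mult: "partial v (p * q) = partial v p * q + p * partial v q"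
proof (induction p rule: poly_mapping_add_induct)
  case (single m c)
  show ?case
  proof (induction q rule: poly_mapping_add_induct)
    case (single n b)
    show ?case
    proof (rule exponent_cases[of m v]; rule exponent_cases[of n v])
      fix k assume "lookup m v = 0" "n = k + single v 1"
      then show ?thesis
        by (simp add: mult_single partial_single lookup_add algebra_simps flip: add.assoc)
    next
      fix k assume "lookup n v = 0" "m = k + single v 1"
      then show ?thesis
        by (simp add: mult_single partial_single lookup_add algebra_simps add.commute[of "single v _"] flip: add.assoc)
    next
      fix k l assume "m = k + single v 1" "n = l + single v 1"
      then have "m + n - single v 1 = k + l + single v 1" "m - single v 1 + n = k + l + single v 1"
        "m + (n - single v 1) = k + l + single v 1"
        by (auto intro!: poly_mapping_eqI simp: lookup_add lookup_minus)
      then show ?thesis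
        by (simp add: mult_single partial_single lookup_add algebra_simps flip: single_add)
    qed (simp add: mult_single partial_single lookup_add)
  qed (simp add: distrib_left partial_add)
qed (simp add: distrib_right partial_add)

lemma pvars_partial: "pvars p \<subseteq> S \<Longrightarrow> pvars (partial v p) \<subseteq> S"
  unfolding pvars_subset_iff lookup_partial using keys_add_nat[of _ "single v 1"] by (metis Un_subset_iff mult_zero_right)

lemma pvars_antideriv: "pvars p \<subseteq> S \<Longrightarrow> v \<in> S \<Longrightarrow> pvars (antideriv v p) \<subseteq> S"
  unfolding pvars_subset_iff
proof (intro allI impI)
  fix m assume *: "\<forall>m. lookup p m \<noteq> 0 \<longrightarrow> keys m \<subseteq> S" "v \<in> S" "lookup (antideriv v p) m \<noteq> 0"
  then have "lookup p (m - single v 1) \<noteq> 0" by (auto simp: lookup_antideriv split: if_splits)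
  then have "keys (m - single v 1) \<subseteq> S" using * by blast
  moreover have "keys m \<subseteq> insert v (keys (m - single v 1))"
    by (auto simp: in_keys_iff lookup_minus lookup_single when_def split: if_splits)
  ultimately show "keys m \<subseteq> S" using *(2) by blast
qed

text \<open>The chain rule. The index set is a fixed \<open>S\<close> rather than
  \<open>pvars p\<close>, so that the sums for two factors can be combined by the product
  rule.\<close>

lemma partial_psubst:
  assumes "finite S" "pvars p \<subseteq> S"
  shows "partial v (psubst s p) = (\<Sum>w\<in>S. partial v (s w) * psubst s (partial w p))"
  using assms(2)
proof (induction p rule: mpoly_induct)
  case (var w)
  have "(\<Sum>u\<in>S. partial v (s u) * psubst s (partial u (pvar w))) = (\<Sum>u\<in>S. if u = w then partial v (s u) else 0)"
    by (rule sum.cong) (auto simp: partial_pvar)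
  then show ?case using assms(1) var by simp
next
  case (add p q)
  then show ?case by (simp add: psubst_add partial_add distrib_left sum.distrib)
next
  case (mult p q)
  then show ?case
    by (simp add: psubst_mult partial_mult psubst_add distrib_left sum.distrib sum_distrib_left
        sum_distrib_right algebra_simps)
qed simp

lemma antideriv_add: "antideriv v (p + q) = antideriv v p + antideriv v q"
  by (rule poly_mapping_eqI) (simp add: lookup_antideriv lookup_add algebra_simps add_divide_distrib)

lemma antideriv_pconst_mult: "antideriv v (pconst c * p) = pconst c * antideriv v p"
  by (rule poly_mapping_eqI) (simp add: lookup_antideriv)

lemma antideriv_zero [simp]: "antideriv v 0 = 0"
  by (rule poly_mapping_eqI) (simp add: lookup_antideriv)

lemma antideriv_sum: "antideriv v (sum f A) = (\<Sum>x\<in>A. antideriv v (f x))"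
  by (induction A rule: infinite_finite_induct) (auto simp: antideriv_add)

lemma partial_antideriv: "partial v (antideriv v p) = p"
  by (rule poly_mapping_eqI) (simp add: lookup_antideriv lookup_partial lookup_add)

lemma partial_antideriv_other:
  assumes "v \<noteq> w"
  shows "partial v (antideriv w p) = antideriv w (partial v p)"
proof (rule poly_mapping_eqI)
  fix n :: "'a \<Rightarrow>\<^sub>0 nat"
  have "n + single v 1 - single w 1 = (n - single w 1) + single v 1" if "lookup n w \<noteq> 0"
    using that assms by (intro poly_mapping_eqI) (auto simp: lookup_add lookup_minus lookup_single when_def)
  then show "lookup (partial v (antideriv w p)) n = lookup (antideriv w (partial v p)) n"
    using assms
    by (auto simp: lookup_partial lookup_antideriv lookup_add lookup_minus lookup_single when_def)
qed

text \<open>Integration with zero constant term loses the value at \<open>v = 0\<close>, which the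
  substitution on the right computes. Terms without \<open>v\<close> are fixed by it and have
  derivative 0; terms with \<open>v\<close> vanish under it.\<close>

lemma antideriv_partial:
  "antideriv v (partial v p) = p - psubst (\<lambda>w. if w = v then 0 else pvar w) p"
proof (induction p rule: poly_mapping_add_induct)
  case (single m c)
  show ?case
  proof (rule exponent_cases[of m v])
    assume m: "lookup m v = 0"
    have "psubst (\<lambda>w. if w = v then 0 else pvar w) (single m c) = psubst pvar (single m c)"
      by (rule psubst_cong) (use m in \<open>auto simp: pvars_def in_keys_iff split: if_splits\<close>)
    moreover have "psubst pvar p = p" for p :: "'a mpoly"
    proof -
      have "pvars p \<subseteq> UNIV" by simp
      then show ?thesis by (induction p rule: mpoly_induct) (auto simp: psubst_add psubst_mult)
    qed
    ultimately show ?thesis using m by (simp add: partial_single)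
  next
    fix k assume m: "m = k + single v 1"
    have "antideriv v (single k a) = single m (a / real (lookup m v))" for a
      by (cases "a = 0") (auto simp: antideriv_def m lookup_add)
    moreover have "psubst (\<lambda>w. if w = v then 0 else pvar w) (single m c) = 0"
      unfolding m single_exponent_add psubst_mult by simp
    ultimately show ?thesis
      by (simp add: partial_single m lookup_add)
  qed
qed (simp add: partial_add antideriv_add psubst_add)

section \<open>Polynomials acting as differential operators\<close>

lemma comp_fun_commute_partial_power: "comp_fun_commute (\<lambda>v. partial v ^^ f v)"
proof
  have *: "partial v ((partial w ^^ n) p) = (partial w ^^ n) (partial v p)" for v w n and p :: "'a mpoly"
    by (induction n) (simp, simp, metis partial_commute)
  have "(partial v ^^ m) ((partial w ^^ n) p) = (partial w ^^ n) ((partial v ^^ m) p)"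
    for v w m n and p :: "'a mpoly"
    by (induction m) (simp_all add: *)
  then show "(partial w ^^ f w) \<circ> (partial v ^^ f v) = (partial v ^^ f v) \<circ> (partial w ^^ f w)"
    for v w :: 'a
    by (simp add: fun_eq_iff)
qed

lemma mono_diff_zero [simp]: "mono_diff 0 V = V"
  by (simp add: mono_diff_def)

text \<open>The fold is unrolled at \<open>v\<close> for both exponents; the remaining folds run
  over the same set, on which the two exponents agree.\<close>

lemma mono_diff_add_single: "mono_diff (m + single v 1) V = partial v (mono_diff m V)"
proof -
  interpret comp_fun_commute "\<lambda>w. partial w ^^ lookup m w"
    by (rule comp_fun_commute_partial_power)
  interpret m': comp_fun_commute "\<lambda>w. partial w ^^ lookup (m + single v 1) w"
    by (rule comp_fun_commute_partial_power)
  let ?R = "Finite_Set.fold (\<lambda>w. partial w ^^ lookup m w) V (keys m - {v})"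
  have "mono_diff m V = (partial v ^^ lookup m v) ?R"
  proof (cases "v \<in> keys m")
    case True
    then show ?thesis unfolding mono_diff_def by (rule fold_rec[OF finite_keys])
  next
    case False
    then show ?thesis by (simp add: mono_diff_def in_keys_iff)
  qed
  moreover have "mono_diff (m + single v 1) V
      = (partial v ^^ lookup (m + single v 1) v)
          (Finite_Set.fold (\<lambda>w. partial w ^^ lookup (m + single v 1) w) V (keys (m + single v 1) - {v}))"
    unfolding mono_diff_def by (rule m'.fold_rec[OF finite_keys]) (simp add: keys_add_nat)
  moreover have "keys (m + single v 1) - {v} = keys m - {v}"
    by (auto simp: keys_add_nat)
  moreover have "Finite_Set.fold (\<lambda>w. partial w ^^ lookup (m + single v 1) w) V (keys m - {v}) = ?R"
  proof -
    have "Finite_Set.fold (\<lambda>w. partial w ^^ lookup (m + single v 1) w) V A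
        = Finite_Set.fold (\<lambda>w. partial w ^^ lookup m w) V A" if "finite A" "v \<notin> A" for A
      using that
    proof induction
      case (insert x F)
      then show ?case
        unfolding fold_insert[OF insert.hyps] m'.fold_insert[OF insert.hyps] by (simp add: lookup_add lookup_single when_def)
    qed simp
    then show ?thesis by simp
  qed
  ultimately show ?thesis by (simp add: lookup_add)
qed

lemma mono_diff_add: "mono_diff (m + n) V = mono_diff m (mono_diff n V)"
proof (induction m rule: exponent_induct)
  case (add m v)
  then show ?case
    using mono_diff_add_single[of "m + n" v V] mono_diff_add_single[of m v "mono_diff n V"]
    by (simp add: add_ac)
qed simp

lemma mono_diff_plus: "mono_diff m (V + W) = mono_diff m V + mono_diff m W"
  by (induction m rule: exponent_induct) (simp_all only: mono_diff_zero mono_diff_add_single partial_add)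

lemma mono_diff_pconst_mult: "mono_diff m (pconst c * V) = pconst c * mono_diff m V"
  by (induction m rule: exponent_induct)
    (simp_all only: mono_diff_zero mono_diff_add_single partial_pconst_mult)

text \<open>The factor is a product of ratios of factorials. What matters is that it is positive and
  independent of \<open>V\<close>, so that a vanishing derivative forces a vanishing
  coefficient.\<close>

lemma lookup_mono_diff: "\<exists>c>0. \<forall>V. lookup (mono_diff m V) n = c * lookup V (n + m)"
proof (induction m arbitrary: n rule: exponent_induct)
  case zero
  show ?case by (rule exI[of _ 1]) simp
next
  case (add m v)
  obtain c where "c > 0" "\<And>V. lookup (mono_diff m V) (n + single v 1) = c * lookup V (n + single v 1 + m)"
    using add by metis
  then show ?case
    by (intro exI[of _ "real (lookup n v + 1) * c"])
      (simp add: mono_diff_add_single[unfolded One_nat_def] lookup_partial add_ac)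
qed

lemma pdiff_superset:
  assumes "finite A" "keys f \<subseteq> A"
  shows "pdiff f V = (\<Sum>m\<in>A. pconst (lookup f m) * mono_diff m V)"
  unfolding pdiff_def using assms
  by (intro sum.mono_neutral_left) (auto simp: in_keys_iff)

lemma pdiff_add: "pdiff (f + g) V = pdiff f V + pdiff g V"
proof -
  have fin: "finite (keys f \<union> keys g)" by simp
  show ?thesis
    using keys_add[of f g] fin
    by (simp add: pdiff_superset[OF fin] lookup_add pconst_add distrib_right sum.distrib)
qed

lemma pdiff_zero [simp]: "pdiff 0 V = 0"
  by (simp add: pdiff_def)

lemma pdiff_single: "pdiff (single m c) V = pconst c * mono_diff m V"
  by (simp add: pdiff_def)

lemma pdiff_plus: "pdiff f (V + W) = pdiff f V + pdiff f W"
  by (simp add: pdiff_def mono_diff_plus distrib_left sum.distrib)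

lemma pdiff_pconst_mult_right: "pdiff f (pconst c * V) = pconst c * pdiff f V"
  by (simp add: pdiff_def mono_diff_pconst_mult sum_distrib_left mult.left_commute)

text \<open>Multiplication becomes composition of operators, hence the polynomials that annihilate a
  fixed \<open>V\<close> form an ideal.\<close>

lemma pdiff_mult: "pdiff (f * g) V = pdiff f (pdiff g V)"
proof (induction f rule: poly_mapping_add_induct)
  case (single m c)
  show ?case
  proof (induction g rule: poly_mapping_add_induct)
    case (single n b)
    show ?case
      by (simp add: mult_single pdiff_single mono_diff_add mono_diff_pconst_mult pconst_mult mult_ac)
  qed (simp add: distrib_left pdiff_add pdiff_plus)
qed (simp add: distrib_right pdiff_add)

lemma pdiff_pconst [simp]: "pdiff (pconst c) V = pconst c * V"
  by (simp add: pconst_def pdiff_single)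

lemma pdiff_one [simp]: "pdiff 1 V = V"
  using pdiff_pconst[of 1] by (simp del: pdiff_pconst)

lemma pdiff_pvar [simp]: "pdiff (pvar v) V = partial v V"
  using mono_diff_add_single[of 0 v V] by (simp add: pvar_def pdiff_single)

lemma pdiff_uminus: "pdiff (- f) V = - pdiff f V"
  using pdiff_add[of f "-f" V] by (simp add: minus_unique)

lemma pdiff_diff: "pdiff (f - g) V = pdiff f V - pdiff g V"
  using pdiff_add[of f "-g" V] by (simp add: pdiff_uminus)

lemma pdiff_sum: "pdiff (sum f A) V = (\<Sum>x\<in>A. pdiff (f x) V)"
  by (induction A rule: infinite_finite_induct) (auto simp: pdiff_add)

lemma pdiff_zero_right [simp]: "pdiff f 0 = 0"
  using pdiff_pconst_mult_right[of f 0 0] by simp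

lemma pdiff_diff_right: "pdiff f (V - W) = pdiff f V - pdiff f W"
  using pdiff_plus[of f "V - W" W] by simp

section \<open>Homogeneous polynomials\<close>

lemma homogeneous_iff: "homogeneous n p \<longleftrightarrow> (\<forall>m. lookup p m \<noteq> 0 \<longrightarrow> mdegree m = n)"
  by (auto simp: homogeneous_def in_keys_iff)

lemma homogeneous_zero [simp]: "homogeneous n 0"
  by (simp add: homogeneous_def)

lemma homogeneous_pconst [simp]: "homogeneous 0 (pconst c)"
  by (simp add: homogeneous_iff lookup_pconst)

lemma homogeneous_pvar [simp]: "homogeneous (Suc 0) (pvar v)"
  by (simp add: homogeneous_iff lookup_pvar)

lemma homogeneous_single: "mdegree m = n \<Longrightarrow> homogeneous n (single m c)"
  by (simp add: homogeneous_iff lookup_single when_def)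

lemma homogeneous_add: "homogeneous n p \<Longrightarrow> homogeneous n q \<Longrightarrow> homogeneous n (p + q)"
  unfolding homogeneous_def using keys_add[of p q] by blast

lemma homogeneous_uminus: "homogeneous n p \<Longrightarrow> homogeneous n (- p)"
  by (simp add: homogeneous_iff)

lemma homogeneous_diff: "homogeneous n p \<Longrightarrow> homogeneous n q \<Longrightarrow> homogeneous n (p - q)"
  using homogeneous_add[of n p "-q"] by (simp add: homogeneous_uminus)

lemma homogeneous_sum: "(\<And>x. x \<in> A \<Longrightarrow> homogeneous n (f x)) \<Longrightarrow> homogeneous n (sum f A)"
  by (induction A rule: infinite_finite_induct) (auto simp: homogeneous_add)

lemma homogeneous_mult: "homogeneous m p \<Longrightarrow> homogeneous n q \<Longrightarrow> homogeneous (m + n) (p * q)"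
  unfolding homogeneous_def using keys_mult[of p q] by fastforce

lemma homogeneous_pconst_mult: "homogeneous n p \<Longrightarrow> homogeneous n (pconst c * p)"
  by (simp add: homogeneous_iff)

lemma homogeneous_power: "homogeneous m p \<Longrightarrow> homogeneous (m * n) (p ^ n)"
  by (induction n) (use homogeneous_pconst[of 1] in \<open>auto intro: homogeneous_mult\<close>)

lemma homogeneous_prod:
  "(\<And>x. x \<in> A \<Longrightarrow> homogeneous (n x) (f x)) \<Longrightarrow> homogeneous (sum n A) (prod f A)"
  by (induction A rule: infinite_finite_induct)
    (use homogeneous_pconst[of 1] in \<open>auto intro: homogeneous_mult\<close>)

lemma homogeneous_psubst:
  assumes "homogeneous n p" "\<And>v. v \<in> pvars p \<Longrightarrow> homogeneous 1 (s v)"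
  shows "homogeneous n (psubst s p)"
  unfolding psubst_def
proof (intro homogeneous_sum homogeneous_pconst_mult)
  fix m assume m: "m \<in> keys p"
  then have "homogeneous (\<Sum>v\<in>keys m. 1 * lookup m v) (\<Prod>v\<in>keys m. s v ^ lookup m v)"
    by (intro homogeneous_prod homogeneous_power assms(2)) (auto simp: pvars_def)
  then show "homogeneous n (\<Prod>v\<in>keys m. s v ^ lookup m v)"
    using assms(1) m by (simp add: homogeneous_def mdegree_def)
qed

lemma homogeneous_antideriv:
  assumes "homogeneous n p"
  shows "homogeneous (Suc n) (antideriv v p)"
  unfolding homogeneous_iff
proof (intro allI impI)
  fix m assume m: "lookup (antideriv v p) m \<noteq> 0"
  then obtain k where k: "m = k + single v 1"
    by (metis exponent_cases lookup_antideriv)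
  then have "lookup p k \<noteq> 0" using m by (auto simp: lookup_antideriv split: if_splits)
  then show "mdegree m = Suc n" using assms k by (simp add: homogeneous_iff)
qed

text \<open>The coefficient of \<open>mono_diff m V\<close> at \<open>k\<close> comes from that of
  \<open>V\<close> at \<open>k + m\<close>, whose degree is n only for \<open>k = 0\<close>.\<close>

lemma pdiff_homogeneous_const:
  assumes "homogeneous n f" "homogeneous n V"
  obtains c where "pdiff f V = pconst c"
proof
  have "mono_diff m V = pconst (lookup (mono_diff m V) 0)" if "mdegree m = n" for m
  proof (rule poly_mapping_eqI)
    fix k
    obtain c where "lookup (mono_diff m V) k = c * lookup V (k + m)"
      using lookup_mono_diff by metis
    then show "lookup (mono_diff m V) k = lookup (pconst (lookup (mono_diff m V) 0)) k"
      using assms(2) that by (auto simp: lookup_pconst homogeneous_iff)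
  qed
  then have "pdiff f V = (\<Sum>m\<in>keys f. pconst (lookup f m) * pconst (lookup (mono_diff m V) 0))"
    unfolding pdiff_def using assms(1) by (intro sum.cong) (auto simp: homogeneous_def)
  then show "pdiff f V = pconst (\<Sum>m\<in>keys f. lookup f m * lookup (mono_diff m V) 0)"
    by (simp add: pconst_sum pconst_mult)
qed

text \<open>\<open>g v\<close> is the operator on the original variables to which differentiation
  along the new variable \<open>v\<close> pulls back. It serves both for the passage to flat
  variables, where \<open>g v\<close> is a linear form, and for the renaming of variables.\<close>

lemma pdiff_prod_psubst:
  assumes "finite C" "pvars p \<subseteq> S"
    and step: "\<And>v q. v \<in> C \<Longrightarrow> pvars q \<subseteq> S \<Longrightarrow>
      partial v (psubst s q) = psubst s (pdiff (g v) q) \<and> pvars (pdiff (g v) q) \<subseteq> S"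
  shows "pdiff (\<Prod>v\<in>C. pvar v) (psubst s p) = psubst s (pdiff (\<Prod>v\<in>C. g v) p)"
  using assms
proof (induction C arbitrary: p rule: finite_induct)
  case (insert v C)
  have *: "partial v (psubst s p) = psubst s (pdiff (g v) p)" "pvars (pdiff (g v) p) \<subseteq> S"
    using insert.prems by auto
  have "pdiff (\<Prod>w\<in>insert v C. pvar w) (psubst s p) = pdiff (\<Prod>w\<in>C. pvar w) (partial v (psubst s p))"
    using insert.hyps by (simp add: pdiff_mult mult.commute[of "pvar v"])
  also have "\<dots> = psubst s (pdiff (\<Prod>w\<in>C. g w) (pdiff (g v) p))"
    unfolding * by (rule insert.IH) (use * insert.prems in auto)
  also have "\<dots> = psubst s (pdiff (\<Prod>w\<in>insert v C. g w) p)"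
    using insert.hyps by (simp add: pdiff_mult mult.commute[of "g v"])
  finally show ?case .
qed simp

section \<open>Mixed volumes of simplicial fans\<close>

lemma mpoly_ring_cring: "cring (mpoly_ring X)"
proof (rule cringI)
  show "abelian_group (mpoly_ring X)"
  proof (rule abelian_groupI)
    fix x assume "x \<in> carrier (mpoly_ring X)"
    then show "\<exists>y\<in>carrier (mpoly_ring X). y \<oplus>\<^bsub>mpoly_ring X\<^esub> x = \<zero>\<^bsub>mpoly_ring X\<^esub>"
      by (intro bexI[of _ "- x"]) (auto simp: mpoly_ring_def)
  qed (auto simp: mpoly_ring_def add_ac dest: subsetD[OF pvars_add])
  show "comm_monoid (mpoly_ring X)"
    by (rule comm_monoidI) (auto simp: mpoly_ring_def mult_ac dest: subsetD[OF pvars_mult])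
qed (simp add: mpoly_ring_def algebra_simps)

lemma mpoly_ring_uminus:
  assumes "pvars p \<subseteq> X"
  shows "\<ominus>\<^bsub>mpoly_ring X\<^esub> p = - p"
proof -
  interpret cring "mpoly_ring X" by (rule mpoly_ring_cring)
  show ?thesis using assms by (intro minus_equality) (auto simp: mpoly_ring_def)
qed

lemma mpoly_ring_minus:
  assumes "pvars p \<subseteq> X" "pvars q \<subseteq> X"
  shows "p \<ominus>\<^bsub>mpoly_ring X\<^esub> q = p - q"
  using assms by (simp add: a_minus_def mpoly_ring_uminus) (simp add: mpoly_ring_def)

lemma mpoly_ring_idealI:
  assumes "\<And>p. p \<in> I \<Longrightarrow> pvars p \<subseteq> X" "0 \<in> I" "\<And>p q. p \<in> I \<Longrightarrow> q \<in> I \<Longrightarrow> p + q \<in> I"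
    and mult: "\<And>p q. p \<in> I \<Longrightarrow> pvars q \<subseteq> X \<Longrightarrow> q * p \<in> I"
  shows "ideal I (mpoly_ring X)"
proof -
  interpret cring "mpoly_ring X" by (rule mpoly_ring_cring)
  show ?thesis
  proof (rule idealI[OF ring_axioms])
    show "subgroup I (add_monoid (mpoly_ring X))"
    proof (rule add.subgroupI)
      fix p assume p: "p \<in> I"
      then have "pconst (-1) * p \<in> I" by (intro mult) auto
      then show "\<ominus>\<^bsub>mpoly_ring X\<^esub> p \<in> I"
        using assms(1)[OF p] by (simp add: mpoly_ring_uminus pconst_uminus)
    qed (use assms in \<open>auto simp: mpoly_ring_def\<close>)
  qed (use mult in \<open>auto simp: mpoly_ring_def mult.commute\<close>)
qed

lemma linear_functions_add:
  "l \<in> linear_functions E \<Longrightarrow> l' \<in> linear_functions E \<Longrightarrow> (\<lambda>u. l u + l' u) \<in> linear_functions E"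
  by (simp add: linear_functions_def algebra_simps)

lemma linear_functions_scale:
  "l \<in> linear_functions E \<Longrightarrow> (\<lambda>u. c * l u) \<in> linear_functions E"
  by (simp add: linear_functions_def algebra_simps)

lemma linear_functions_coord_diff:
  "a \<in> E \<Longrightarrow> b \<in> E \<Longrightarrow> (\<lambda>u. u a - u b) \<in> linear_functions E"
  by (simp add: linear_functions_def algebra_simps)

lemma linear_functions_indicator:
  assumes l: "l \<in> linear_functions E" and "finite F" "F \<subseteq> E"
  shows "l (indicator F) = (\<Sum>a\<in>F. l (indicator {a}))"
  using assms(2,3)
proof (induction F rule: finite_induct)
  case empty
  \<comment> \<open>The indicator of the empty set is the zero vector; scaling by 0 gives its
    value.\<close>
  have "l (\<lambda>a. 0 * (indicator {} :: 'a \<Rightarrow> real) a) = 0 * l (indicator {})"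
    using l unfolding linear_functions_def mem_Collect_eq by (metis empty_iff indicator_simps(2))
  then show ?case by (simp add: indicator_def)
next
  case (insert x F)
  have "\<forall>a. a \<notin> E \<longrightarrow> indicator {x} a = (0::real) \<and> indicator F a = (0::real)"
    using insert.prems by (auto simp: indicator_def)
  then have "l (\<lambda>a. indicator {x} a + indicator F a) = l (indicator {x}) + l (indicator F)"
    using l unfolding linear_functions_def by blast
  moreover have "(\<lambda>a. indicator {x} a + indicator F a) = (indicator (insert x F) :: 'a \<Rightarrow> real)"
    using insert.hyps by (auto simp: indicator_def fun_eq_iff)
  ultimately show ?case using insert by simp
qed

lemma linear_functions_sum_eq_0:
  assumes "l \<in> linear_functions E" "finite E"
  shows "(\<Sum>a\<in>E. l (indicator {a})) = 0"
  using linear_functions_indicator[OF assms order_refl] assms(1) by (simp add: linear_functions_def)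

lemma lookup_mult_0: "lookup (p * q) 0 = lookup p 0 * lookup q (0 :: 'v \<Rightarrow>\<^sub>0 nat)"
  for p q :: "'v mpoly"
proof (induction p rule: poly_mapping_add_induct)
  case (single m c)
  have *: "m + n = 0 \<longleftrightarrow> m = 0 \<and> n = 0" for n
    by (metis mdegree_eq_0_iff mdegree_add add_is_0)
  show ?case
    by (induction q rule: poly_mapping_add_induct)
      (auto simp: mult_single lookup_single when_def * distrib_left lookup_add)
qed (simp add: distrib_right lookup_add)

text \<open>The coefficient of \<open>v\<close> is the partial derivative at the origin, so this is
  the product rule evaluated there.\<close>

lemma lookup_mult_single: "lookup (p * q) (single v 1)
    = lookup p (single v 1) * lookup q 0 + lookup p 0 * lookup q (single v 1)"
  for p q :: "'v mpoly"
proof -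
  have "lookup f (single v 1) = lookup (partial v f) 0" for f :: "'v mpoly"
    by (simp add: lookup_partial)
  then show ?thesis by (simp only: partial_mult lookup_add lookup_mult_0)
qed

lemma prod_pvar_homogeneous: "finite A \<Longrightarrow> homogeneous (card A) (\<Prod>v\<in>A. pvar v)"
  using homogeneous_prod[of A "\<lambda>_. 1" pvar] by simp

text \<open>\<open>dual\<close> expresses that the ray vectors of a cone are linearly independent
  modulo the all-ones vector. Dual functionals are the convenient form, since each of them directly
  gives a linear relation of the Chow ring.\<close>

locale pure_simplicial_fan =
  fixes D :: "('v, 'a) fan"
  assumes finite_rays: "finite (rays D)"
    and cones_subset: "\<sigma> \<in> cones D \<Longrightarrow> \<sigma> \<subseteq> rays D"
    and pure: "\<sigma> \<in> maximal_cones D \<Longrightarrow> card \<sigma> = fan_dim D"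
    and dual: "\<sigma> \<in> cones D \<Longrightarrow> \<rho> \<in> \<sigma> \<Longrightarrow>
      \<exists>l\<in>linear_functions (ambient D). l (ray_vec D \<rho>) = 1 \<and> (\<forall>\<rho>'\<in>\<sigma> - {\<rho>}. l (ray_vec D \<rho>') = 0)"
begin

abbreviation "R \<equiv> mpoly_ring (rays D)"

sublocale cring R
  by (rule mpoly_ring_cring)

lemma generators_carrier: "sr_generators D \<union> linear_generators D \<subseteq> carrier R"
proof -
  have "pvars (\<Prod>\<rho>\<in>N. pvar \<rho>) \<subseteq> rays D" if "N \<subseteq> rays D" for N
    using that by (intro pvars_prod) auto
  moreover have "pvars (\<Sum>\<rho>\<in>rays D. pconst (l (ray_vec D \<rho>)) * pvar \<rho>) \<subseteq> rays D" for l
    by (intro pvars_sum pvars_mult) auto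
  ultimately show ?thesis
    unfolding sr_generators_def linear_generators_def mpoly_ring_def by auto
qed

sublocale chow: ideal "chow_ideal D" R
  unfolding chow_ideal_def by (rule genideal_ideal[OF generators_carrier])

lemma generator_in_chow_ideal: "f \<in> sr_generators D \<union> linear_generators D \<Longrightarrow> f \<in> chow_ideal D"
  unfolding chow_ideal_def using genideal_self[OF generators_carrier] by blast

lemma chow_ideal_minimal:
  "ideal I R \<Longrightarrow> sr_generators D \<union> linear_generators D \<subseteq> I \<Longrightarrow> chow_ideal D \<subseteq> I"
  unfolding chow_ideal_def by (rule genideal_minimal)

lemma chow_ideal_mult: "f \<in> chow_ideal D \<Longrightarrow> pvars g \<subseteq> rays D \<Longrightarrow> f * g \<in> chow_ideal D"
  using chow.I_r_closed[of f g] by (simp add: mpoly_ring_def)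

lemma chow_class_eq_iff:
  assumes "pvars f \<subseteq> rays D" "pvars g \<subseteq> rays D"
  shows "chow_class D f = chow_class D g \<longleftrightarrow> f - g \<in> chow_ideal D"
  using quotient_eq_iff_same_a_r_cos[OF chow.is_ideal, of f g] assms
  by (simp add: chow_class_def mpoly_ring_minus) (simp add: mpoly_ring_def)

lemma forms_iff: "f \<in> forms D n \<longleftrightarrow> pvars f \<subseteq> rays D \<and> homogeneous n f"
  by (simp add: forms_def mpoly_ring_def)

lemma forms_add: "f \<in> forms D n \<Longrightarrow> g \<in> forms D n \<Longrightarrow> f + g \<in> forms D n"
  by (simp add: forms_iff pvars_add homogeneous_add)

lemma forms_diff: "f \<in> forms D n \<Longrightarrow> g \<in> forms D n \<Longrightarrow> f - g \<in> forms D n"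
  by (simp add: forms_iff pvars_diff homogeneous_diff)

lemma forms_pconst_mult: "f \<in> forms D n \<Longrightarrow> pconst c * f \<in> forms D n"
  by (simp add: forms_iff pvars_mult homogeneous_pconst_mult)

lemma finite_cones: "finite (cones D)"
  by (rule finite_subset[of _ "Pow (rays D)"]) (use cones_subset finite_rays in auto)

lemma cone_finite: "\<sigma> \<in> cones D \<Longrightarrow> finite \<sigma>"
  using cones_subset finite_rays finite_subset by blast

lemma card_cone_le: "\<sigma> \<in> cones D \<Longrightarrow> card \<sigma> \<le> fan_dim D"
  unfolding fan_dim_def using finite_cones by simp

lemma top_cone_maximal: "\<sigma> \<in> cones D \<Longrightarrow> card \<sigma> = fan_dim D \<Longrightarrow> \<sigma> \<in> maximal_cones D"
  unfolding maximal_cones_def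
proof (intro CollectI conjI ballI impI)
  fix \<tau> assume "\<sigma> \<in> cones D" "card \<sigma> = fan_dim D" "\<tau> \<in> cones D" "\<sigma> \<subseteq> \<tau>"
  then show "\<tau> = \<sigma>" using card_seteq[of \<tau> \<sigma>] card_cone_le cone_finite by simp
qed

lemma prod_maximal_cone: "\<sigma> \<in> maximal_cones D \<Longrightarrow> (\<Prod>\<rho>\<in>\<sigma>. pvar \<rho>) \<in> forms D (fan_dim D)"
proof -
  assume *: "\<sigma> \<in> maximal_cones D"
  then have "\<sigma> \<in> cones D" by (simp add: maximal_cones_def)
  moreover from this have "pvars (\<Prod>\<rho>\<in>\<sigma>. pvar \<rho>) \<subseteq> rays D"
    by (intro pvars_prod) (use cones_subset in auto)
  ultimately show ?thesis
    using prod_pvar_homogeneous[of \<sigma>] pure[OF *] cone_finite by (simp add: forms_iff)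
qed

text \<open>A repeated variable \<open>\<rho>\<close> of a monomial supported on a cone is traded, by the linear relation dual to
  \<open>\<rho>\<close>, for variables outside the cone: the support grows until the monomial is square-free.\<close>

lemma monomial_killed:
  assumes kill: "\<And>f. f \<in> forms D (fan_dim D) \<Longrightarrow> f \<in> chow_ideal D \<Longrightarrow> pdiff f U = 0"
    and top: "\<And>\<sigma>. \<sigma> \<in> maximal_cones D \<Longrightarrow> pdiff (\<Prod>\<rho>\<in>\<sigma>. pvar \<rho>) U = 0"
    and m: "keys m \<subseteq> rays D" "mdegree m = fan_dim D"
  shows "pdiff (single m 1) U = 0"
  using m
proof (induction "fan_dim D - card (keys m)" arbitrary: m rule: less_induct)
  case less
  let ?n = "fan_dim D"
  have form: "single m 1 \<in> forms D ?n"
    using less.prems by (auto simp: forms_iff pvars_def homogeneous_single split: if_splits)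
  \<comment> \<open>Splits off the square-free part on the support of \<open>m\<close>: if no cone
    contains the support, this factor is a Stanley-Reisner generator.\<close>
  have fac: "m = (\<Sum>v\<in>keys m. single v 1) + (m - (\<Sum>v\<in>keys m. single v 1))"
    by (rule poly_mapping_eqI) (auto simp: lookup_add lookup_minus lookup_sum lookup_single when_def in_keys_iff)
  have pv: "pvars (single k (c::real)) \<subseteq> rays D" if "keys k \<subseteq> rays D" for k c
    using that by (auto simp: pvars_def split: if_splits)
  show ?case
  proof (cases "\<exists>\<tau>\<in>cones D. keys m \<subseteq> \<tau>")
    case False
    have "(\<Prod>\<rho>\<in>keys m. pvar \<rho>) \<in> chow_ideal D"
      using False less.prems by (intro generator_in_chow_ideal) (auto simp: sr_generators_def)
    then have "(\<Prod>\<rho>\<in>keys m. pvar \<rho>) * single (m - (\<Sum>v\<in>keys m. single v 1)) 1 \<in> chow_ideal D"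
      by (intro chow_ideal_mult pv)
        (use less.prems in \<open>auto simp: in_keys_iff lookup_minus\<close>)
    also have "(\<Prod>\<rho>\<in>keys m. pvar \<rho>) * single (m - (\<Sum>v\<in>keys m. single v 1)) 1 = single m (1::real)"
      unfolding prod_pvar[OF finite_keys] mult_single fac[symmetric] by simp
    finally show ?thesis using kill form by blast
  next
    case True
    then obtain \<tau> where \<tau>: "\<tau> \<in> cones D" "keys m \<subseteq> \<tau>" by blast
    have card_le: "card (keys m) \<le> ?n"
      using \<tau> card_cone_le card_mono cone_finite order.trans by metis
    show ?thesis
    proof (cases "\<exists>\<rho>. lookup m \<rho> \<ge> 2")
      case False
      then have "lookup m v = (if v \<in> keys m then 1 else 0)" for v
        by (metis One_nat_def Suc_1 in_keys_iff less_2_cases_iff not_less)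
      then have m_eq: "m = (\<Sum>v\<in>keys m. single v 1)"
        by (intro poly_mapping_eqI) (simp add: lookup_sum lookup_single when_def)
      have "card (keys m) = ?n"
      proof -
        have "mdegree m = (\<Sum>v\<in>keys m. 1)"
          unfolding mdegree_def
          by (rule sum.cong) (use \<open>\<And>v. lookup m v = _\<close> in auto)
        then show ?thesis using less.prems by simp
      qed
      moreover from this have "keys m = \<tau>"
        using \<tau> card_cone_le card_seteq cone_finite by metis
      ultimately have "keys m \<in> maximal_cones D" using \<tau> top_cone_maximal by simp
      then have "pdiff (\<Prod>\<rho>\<in>keys m. pvar \<rho>) U = 0" by (rule top)
      then show ?thesis using m_eq by (simp add: prod_pvar)
    next
      case True
      then obtain \<rho> where \<rho>: "lookup m \<rho> \<ge> 2" by blast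
      then have \<rho>m: "\<rho> \<in> keys m" by (simp add: in_keys_iff)
      obtain k where k: "m = k + single \<rho> 1" using \<rho> by (metis exponent_cases not_numeral_le_zero)
      have kk: "keys k = keys m"
        using \<rho> by (auto simp: k in_keys_iff lookup_add lookup_single when_def split: if_splits)
      obtain l where l: "l \<in> linear_functions (ambient D)" "l (ray_vec D \<rho>) = 1"
        "\<forall>\<rho>'\<in>\<tau> - {\<rho>}. l (ray_vec D \<rho>') = 0"
        using dual \<tau> \<rho>m by blast
      let ?L = "\<Sum>\<rho>\<in>rays D. pconst (l (ray_vec D \<rho>)) * pvar \<rho>"
      have "?L * single k 1 \<in> chow_ideal D"
        using l(1) less.prems kk
        by (intro chow_ideal_mult generator_in_chow_ideal pv) (auto simp: linear_generators_def)
      moreover have exp: "?L * single k 1 = (\<Sum>\<rho>'\<in>rays D. pconst (l (ray_vec D \<rho>')) * single (k + single \<rho>' 1) 1)"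
        unfolding single_exponent_add sum_distrib_right by (intro sum.cong refl) (simp only: mult_ac)
      moreover have "?L * single k 1 \<in> forms D ?n"
        unfolding exp forms_iff
      proof (intro conjI pvars_sum pvars_mult homogeneous_sum homogeneous_pconst_mult homogeneous_single pv)
        fix \<rho>' assume "\<rho>' \<in> rays D"
        then show "keys (k + single \<rho>' 1) \<subseteq> rays D" using less.prems by (simp add: keys_add_nat kk)
        have "mdegree k + 1 = ?n" using less.prems(2) unfolding k by simp
        then show "mdegree (k + single \<rho>' 1) = ?n" by simp
      qed simp
      ultimately have "pdiff (\<Sum>\<rho>'\<in>rays D. pconst (l (ray_vec D \<rho>')) * single (k + single \<rho>' 1) 1) U = 0"
        using kill by simp
      then have "(\<Sum>\<rho>'\<in>rays D. pconst (l (ray_vec D \<rho>')) * pdiff (single (k + single \<rho>' 1) 1) U) = 0"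
        by (simp add: pdiff_sum pdiff_mult)
      moreover have "pconst (l (ray_vec D \<rho>')) * pdiff (single (k + single \<rho>' 1) 1) U = 0"
        if \<rho>': "\<rho>' \<in> rays D - {\<rho>}" for \<rho>'
      proof (cases "\<rho>' \<in> \<tau>")
        case False
        then have new: "\<rho>' \<notin> keys m" using \<tau> by blast
        have keys': "keys (k + single \<rho>' 1) = insert \<rho>' (keys m)"
          by (auto simp: keys_add_nat kk)
        have "pdiff (single (k + single \<rho>' 1) 1) U = 0"
        proof (rule less.hyps)
          \<comment> \<open>The measure is a truncated difference and decreases only while the
            support is smaller than the degree; the repeated \<rho> guarantees this.\<close>
          have "card (keys m) < ?n"
          proof (rule ccontr)
            assume "\<not> card (keys m) < ?n"
            then have "(\<Sum>v\<in>keys m. lookup m v) \<le> (\<Sum>v\<in>keys m. 1)"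
              using less.prems by (simp add: mdegree_def)
            moreover have "(\<Sum>v\<in>keys m. 1) < (\<Sum>v\<in>keys m. lookup m v)"
              by (rule sum_strict_mono_ex1) (use \<rho> \<rho>m in \<open>auto simp: in_keys_iff intro!: bexI[of _ \<rho>]\<close>)
            ultimately show False by simp
          qed
          then show "?n - card (keys (k + single \<rho>' 1)) < ?n - card (keys m)"
            unfolding keys' using new by simp
          show "keys (k + single \<rho>' 1) \<subseteq> rays D" unfolding keys' using \<rho>' less.prems by simp
          show "mdegree (k + single \<rho>' 1) = ?n" using less.prems k by simp
        qed
        then show ?thesis by simp
      qed (use l \<rho>' in simp)
      ultimately have "pconst (l (ray_vec D \<rho>)) * pdiff (single (k + single \<rho> 1) 1) U = 0"
        using \<rho>m less.prems finite_rays
        by (subst (asm) sum.remove[of _ \<rho>]) (auto simp: subset_iff)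
      then show ?thesis using l k by simp
    qed
  qed
qed

lemma form_eq_0I:
  assumes "U \<in> forms D n" "\<And>m. keys m \<subseteq> rays D \<Longrightarrow> mdegree m = n \<Longrightarrow> pdiff (single m 1) U = 0"
  shows "U = 0"
proof (rule poly_mapping_eqI)
  fix m
  show "lookup U m = lookup 0 m"
  proof (rule ccontr)
    assume *: "lookup U m \<noteq> lookup 0 m"
    then have "keys m \<subseteq> rays D" "mdegree m = n"
      using assms(1) by (auto simp: forms_iff pvars_subset_iff homogeneous_iff)
    then have "mono_diff m U = 0" using assms(2) by (simp add: pdiff_single)
    moreover obtain c where "c > 0" "lookup (mono_diff m U) 0 = c * lookup U (0 + m)"
      using lookup_mono_diff by metis
    ultimately show False using * by simp
  qed
qed

lemma mixed_volume_eqI: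
  assumes V: "V \<in> forms D (fan_dim D)"
    and sr: "\<And>N. N \<subseteq> rays D \<Longrightarrow> \<not> (\<exists>\<sigma>\<in>cones D. N \<subseteq> \<sigma>) \<Longrightarrow> pdiff (\<Prod>\<rho>\<in>N. pvar \<rho>) V = 0"
    and lin: "\<And>l. l \<in> linear_functions (ambient D) \<Longrightarrow>
      (\<Sum>\<rho>\<in>rays D. pconst (l (ray_vec D \<rho>)) * partial \<rho> V) = 0"
    and top: "\<And>\<sigma>. \<sigma> \<in> maximal_cones D \<Longrightarrow> pdiff (\<Prod>\<rho>\<in>\<sigma>. pvar \<rho>) V = 1"
  shows "mixed_volume D = V"
proof -
  let ?n = "fan_dim D"
  have "chow_ideal D \<subseteq> {f. pvars f \<subseteq> rays D \<and> pdiff f V = 0}"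
  proof (rule chow_ideal_minimal)
    show "ideal {f. pvars f \<subseteq> rays D \<and> pdiff f V = 0} R"
      by (rule mpoly_ring_idealI) (auto simp: pdiff_add pdiff_mult dest: subsetD[OF pvars_add] subsetD[OF pvars_mult])
    show "sr_generators D \<union> linear_generators D \<subseteq> {f. pvars f \<subseteq> rays D \<and> pdiff f V = 0}"
      using generators_carrier sr lin
      by (auto simp: sr_generators_def linear_generators_def mpoly_ring_def pdiff_sum pdiff_mult)
  qed
  then have ann: "pdiff f V = 0" if "f \<in> chow_ideal D" for f
    using that by blast
  \<comment> \<open>The value on a class is read off a form that represents it; two such forms
    differ by an element of the ideal, which annihilates \<open>V\<close>.\<close>
  define \<phi> where "\<phi> x = lookup (pdiff (SOME f. f \<in> forms D ?n \<and> chow_class D f = x) V) 0" for x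
  have \<phi>: "pdiff f V = pconst (\<phi> (chow_class D f))" if f: "f \<in> forms D ?n" for f
  proof -
    define g where "g = (SOME g. g \<in> forms D ?n \<and> chow_class D g = chow_class D f)"
    have "g \<in> forms D ?n \<and> chow_class D g = chow_class D f"
      unfolding g_def by (rule someI[of _ f]) (use f in simp)
    then have "pdiff (f - g) V = 0"
      using f by (intro ann) (simp add: forms_iff flip: chow_class_eq_iff)
    moreover obtain c where "pdiff f V = pconst c"
      using pdiff_homogeneous_const f V forms_iff by metis
    ultimately have "pdiff f V = pconst c" "pdiff g V = pconst c"
      by (simp_all add: pdiff_diff)
    then show ?thesis
      unfolding \<phi>_def g_def[symmetric] by (simp add: lookup_pconst)
  qed
  have class_add: "chow_class D f \<oplus>\<^bsub>CH D\<^esub> chow_class D g = chow_class D (f + g)"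
    if "pvars f \<subseteq> rays D" "pvars g \<subseteq> rays D" for f g
    using chow.a_rcos_sum[of f g] that by (simp add: chow_class_def CH_def FactRing_def mpoly_ring_def)
  have class_mult: "chow_class D f \<otimes>\<^bsub>CH D\<^esub> chow_class D g = chow_class D (f * g)"
    if "pvars f \<subseteq> rays D" "pvars g \<subseteq> rays D" for f g
    using chow.rcoset_mult_add[of f g] that by (simp add: chow_class_def CH_def FactRing_def mpoly_ring_def)
  have deg: "is_degree_map D \<phi>"
    unfolding is_degree_map_def
  proof (intro conjI ballI allI)
    fix x y assume "x \<in> chow_class D ` forms D ?n" "y \<in> chow_class D ` forms D ?n"
    then obtain f g where fg: "x = chow_class D f" "y = chow_class D g" "f \<in> forms D ?n" "g \<in> forms D ?n"
      by blast
    then have "x \<oplus>\<^bsub>CH D\<^esub> y = chow_class D (f + g)"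
      using class_add by (simp add: forms_iff)
    then have "pconst (\<phi> (x \<oplus>\<^bsub>CH D\<^esub> y)) = pdiff (f + g) V"
      by (simp only: \<phi>[OF forms_add[OF fg(3,4)]])
    also have "\<dots> = pconst (\<phi> x + \<phi> y)"
      by (simp only: pdiff_add pconst_add \<phi>[OF fg(3)] \<phi>[OF fg(4)] fg(1,2))
    finally show "\<phi> (x \<oplus>\<^bsub>CH D\<^esub> y) = \<phi> x + \<phi> y" by simp
  next
    fix c x assume "x \<in> chow_class D ` forms D ?n"
    then obtain f where f: "x = chow_class D f" "f \<in> forms D ?n" by blast
    then have "chow_class D (pconst c) \<otimes>\<^bsub>CH D\<^esub> x = chow_class D (pconst c * f)"
      using class_mult by (simp add: forms_iff)
    then have "pconst (\<phi> (chow_class D (pconst c) \<otimes>\<^bsub>CH D\<^esub> x)) = pdiff (pconst c * f) V"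
      by (simp only: \<phi>[OF forms_pconst_mult[OF f(2)]])
    also have "\<dots> = pconst (c * \<phi> x)"
      by (simp only: pdiff_mult pdiff_pconst pconst_mult \<phi>[OF f(2)] f(1))
    finally show "\<phi> (chow_class D (pconst c) \<otimes>\<^bsub>CH D\<^esub> x) = c * \<phi> x" by simp
  next
    fix \<sigma> assume \<sigma>: "\<sigma> \<in> maximal_cones D"
    then have "(pconst (\<phi> (chow_class D (\<Prod>\<rho>\<in>\<sigma>. pvar \<rho>))) :: 'v mpoly) = pconst 1"
      using top[OF \<sigma>] \<phi>[OF prod_maximal_cone[OF \<sigma>]] by (metis pconst_1)
    then show "\<phi> (chow_class D (\<Prod>\<rho>\<in>\<sigma>. pvar \<rho>)) = 1" by (simp only: pconst_eq_iff)
  qed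
  show ?thesis
    unfolding mixed_volume_def
  proof (rule the_equality)
    show "V \<in> forms D ?n \<and> (\<exists>\<phi>. is_degree_map D \<phi> \<and>
        (\<forall>f\<in>forms D ?n. pdiff f V = pconst (\<phi> (chow_class D f))))"
      using V deg \<phi> by blast
  next
    fix W assume "W \<in> forms D ?n \<and> (\<exists>\<phi>. is_degree_map D \<phi> \<and>
        (\<forall>f\<in>forms D ?n. pdiff f W = pconst (\<phi> (chow_class D f))))"
    then obtain \<psi> where W: "W \<in> forms D ?n" "is_degree_map D \<psi>"
      "\<And>f. f \<in> forms D ?n \<Longrightarrow> pdiff f W = pconst (\<psi> (chow_class D f))"
      by blast
    have zero: "0 \<in> forms D ?n" by (simp add: forms_iff)
    have "W - V = 0"
    \<comment> \<open>The difference is annihilated by the top-degree part of the ideal and by all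
      maximal cones, hence by every monomial of top degree.\<close>
    proof (rule form_eq_0I[OF forms_diff[OF W(1) V]], rule monomial_killed)
      fix f assume f: "f \<in> forms D ?n" "f \<in> chow_ideal D"
      then have "chow_class D f = chow_class D 0"
        using chow_class_eq_iff[of f 0] by (simp add: forms_iff)
      then have "pdiff f W = pdiff 0 W" using W(3) f(1) zero by metis
      then show "pdiff f (W - V) = 0" using f ann by (simp add: pdiff_diff_right)
    next
      fix \<sigma> assume \<sigma>: "\<sigma> \<in> maximal_cones D"
      then have "pdiff (\<Prod>\<rho>\<in>\<sigma>. pvar \<rho>) W = pconst 1"
        using W(2,3) prod_maximal_cone by (simp add: is_degree_map_def)
      then show "pdiff (\<Prod>\<rho>\<in>\<sigma>. pvar \<rho>) (W - V) = 0"
        using top[OF \<sigma>] by (simp add: pdiff_diff_right)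
    qed
    then show "W = V" by simp
  qed
qed

text \<open>When the empty set and all single rays are cones, a non-cone has at least two rays, so
  Stanley-Reisner generators have no part of degree at most one. The polynomials without constant
  term whose linear part comes from a functional form an ideal, which then contains all
  generators.\<close>

lemma chow_ideal_linear_part:
  assumes singletons: "\<And>\<rho>. \<rho> \<in> rays D \<Longrightarrow> {\<rho>} \<in> cones D" and "{} \<in> cones D"
    and "f \<in> chow_ideal D"
  obtains l where "l \<in> linear_functions (ambient D)"
    "\<And>\<rho>. \<rho> \<in> rays D \<Longrightarrow> lookup f (single \<rho> 1) = l (ray_vec D \<rho>)"
proof -
  let ?P = "\<lambda>f. lookup f 0 = 0 \<and> (\<exists>l\<in>linear_functions (ambient D).
        \<forall>\<rho>\<in>rays D. lookup f (single \<rho> 1) = l (ray_vec D \<rho>))"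
  let ?I = "{f. pvars f \<subseteq> rays D \<and> ?P f}"
  have zero: "(\<lambda>_. 0) \<in> linear_functions (ambient D)"
    by (simp add: linear_functions_def)
  have "chow_ideal D \<subseteq> ?I"
  proof (rule chow_ideal_minimal)
    show "ideal ?I R"
    proof (rule mpoly_ring_idealI)
      show "0 \<in> ?I" using zero by auto
    next
      fix p q assume "p \<in> ?I" "q \<in> ?I"
      moreover from this obtain l l' where "l \<in> linear_functions (ambient D)" "l' \<in> linear_functions (ambient D)"
        "\<forall>\<rho>\<in>rays D. lookup p (single \<rho> 1) = l (ray_vec D \<rho>)"
        "\<forall>\<rho>\<in>rays D. lookup q (single \<rho> 1) = l' (ray_vec D \<rho>)" by blast
      moreover from this have "\<forall>\<rho>\<in>rays D. lookup (p + q) (single \<rho> 1) = l (ray_vec D \<rho>) + l' (ray_vec D \<rho>)"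
        by (simp add: lookup_add)
      ultimately show "p + q \<in> ?I"
        using linear_functions_add[of l "ambient D" l'] pvars_add[of p "rays D" q]
        by (auto simp: lookup_add intro!: bexI[of _ "\<lambda>u. l u + l' u"])
    next
      fix p q assume pq: "p \<in> ?I" "pvars q \<subseteq> rays D"
      then obtain l where l: "l \<in> linear_functions (ambient D)"
        "\<forall>\<rho>\<in>rays D. lookup p (single \<rho> 1) = l (ray_vec D \<rho>)" by blast
      \<comment> \<open>As \<open>p\<close> has no constant term, the linear part of
        \<open>q * p\<close> is that of \<open>p\<close> scaled by the constant term of
        \<open>q\<close>.\<close>
      have "\<forall>\<rho>\<in>rays D. lookup (q * p) (single \<rho> 1) = lookup q 0 * l (ray_vec D \<rho>)"
        using pq l by (simp only: lookup_mult_single) simp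
      then show "q * p \<in> ?I"
        using pq linear_functions_scale[OF l(1), of "lookup q 0"] pvars_mult[of q "rays D" p]
        by (auto simp: lookup_mult_0 intro!: bexI[of _ "\<lambda>u. lookup q 0 * l u"])
    qed blast
    show "sr_generators D \<union> linear_generators D \<subseteq> ?I"
    proof
      fix f assume f: "f \<in> sr_generators D \<union> linear_generators D"
      then have "pvars f \<subseteq> rays D"
        using generators_carrier by (auto simp: mpoly_ring_def)
      moreover have "?P f"
      proof (cases "f \<in> linear_generators D")
        case True
        then obtain l where l: "l \<in> linear_functions (ambient D)"
          "f = (\<Sum>\<rho>\<in>rays D. pconst (l (ray_vec D \<rho>)) * pvar \<rho>)"
          by (auto simp: linear_generators_def)
        have "lookup f 0 = 0"
          unfolding l(2) lookup_sum lookup_pconst_mult lookup_pvar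
          by (intro sum.neutral ballI) (metis mdegree_single mdegree_zero mult_zero_right zero_neq_one)
        moreover have "lookup f (single \<rho> 1) = l (ray_vec D \<rho>)" if "\<rho> \<in> rays D" for \<rho>
        proof -
          have "single \<rho> (1::nat) = single \<rho>' 1 \<longleftrightarrow> \<rho> = \<rho>'" for \<rho>'
            by (metis keys_single singleton_inject zero_neq_one)
          then show ?thesis
            unfolding l(2) lookup_sum lookup_pconst_mult lookup_pvar
            using that finite_rays by (simp add: if_distrib[of "(*) _"] cong: if_cong)
        qed
        ultimately show ?thesis using l(1) by blast
      next
        case False
        then obtain N where N: "finite N" "N \<subseteq> rays D" "\<not> (\<exists>\<sigma>\<in>cones D. N \<subseteq> \<sigma>)" "f = (\<Prod>\<rho>\<in>N. pvar \<rho>)"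
          using f by (auto simp: sr_generators_def)
        have "card N \<noteq> 0" "card N \<noteq> 1"
          using N assms(2) singletons by (auto simp: card_1_singleton_iff)
        moreover have "homogeneous (card N) f" using N prod_pvar_homogeneous by blast
        ultimately have "lookup f 0 = 0" "lookup f (single \<rho> 1) = 0" for \<rho>
          unfolding homogeneous_iff by (metis mdegree_zero, metis mdegree_single)
        then show ?thesis using zero by auto
      qed
      ultimately show "f \<in> ?I" by blast
    qed
  qed
  then have "f \<in> ?I" using assms(3) by (rule subsetD)
  then have "\<exists>l\<in>linear_functions (ambient D). \<forall>\<rho>\<in>rays D. lookup f (single \<rho> 1) = l (ray_vec D \<rho>)"
    by (simp only: mem_Collect_eq)
  then show ?thesis using that by (elim bexE) simp
qed

end

section \<open>Matroids and their Bergman fans\<close>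

lemma subset_chain_mono: "subset.chain A C \<Longrightarrow> S \<subseteq> C \<Longrightarrow> subset.chain A S"
  unfolding subset_chain_def by blast

locale finite_matroid =
  fixes N :: "'a matroid"
  assumes is_matroid: "is_matroid N"
begin

abbreviation "E \<equiv> ground N"
abbreviation "rk \<equiv> rank_in N"
abbreviation "cl \<equiv> mclosure N"

lemma finite_E: "finite E"
  using is_matroid by (simp add: is_matroid_def)

lemma indep_subset_E: "I \<in> indep N \<Longrightarrow> I \<subseteq> E"
  using is_matroid by (simp add: is_matroid_def)

lemma indep_finite: "I \<in> indep N \<Longrightarrow> finite I"
  using indep_subset_E finite_E finite_subset by blast

lemma indep_empty: "{} \<in> indep N"
  using is_matroid by (simp add: is_matroid_def)

lemma indep_mono: "I \<in> indep N \<Longrightarrow> J \<subseteq> I \<Longrightarrow> J \<in> indep N"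
  using is_matroid unfolding is_matroid_def by blast

lemma indep_augment:
  "I \<in> indep N \<Longrightarrow> J \<in> indep N \<Longrightarrow> card I < card J \<Longrightarrow> \<exists>y\<in>J - I. insert y I \<in> indep N"
  using is_matroid unfolding is_matroid_def by blast

lemma finite_indep: "finite (indep N)"
  by (rule finite_subset[of _ "Pow E"]) (use indep_subset_E finite_E in auto)

lemma card_le_rk: "I \<in> indep N \<Longrightarrow> I \<subseteq> X \<Longrightarrow> card I \<le> rk X"
  unfolding rank_in_def using finite_indep by (intro Max_ge) auto

lemma rk_basis: obtains B where "B \<in> indep N" "B \<subseteq> X" "card B = rk X"
proof -
  have "rk X \<in> card ` {I \<in> indep N. I \<subseteq> X}"
    unfolding rank_in_def using finite_indep indep_empty by (intro Max_in) auto
  then show ?thesis using that by auto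
qed

lemma extend_to_basis:
  assumes "I \<in> indep N" "I \<subseteq> X"
  obtains B where "B \<in> indep N" "I \<subseteq> B" "B \<subseteq> X" "card B = rk X"
proof -
  let ?S = "{B \<in> indep N. I \<subseteq> B \<and> B \<subseteq> X}"
  have "finite ?S" "?S \<noteq> {}" using finite_indep assms by auto
  then have "\<exists>B\<in>?S. \<forall>C\<in>?S. B \<subseteq> C \<longrightarrow> B = C" by (rule finite_has_maximal)
  then obtain B where "B \<in> ?S" and max: "\<forall>C\<in>?S. B \<subseteq> C \<longrightarrow> B = C" by (rule bexE)
  then have B: "B \<in> indep N" "I \<subseteq> B" "B \<subseteq> X" by simp_all
  have "card B = rk X"
  proof (rule ccontr)
    assume "card B \<noteq> rk X"
    then have "card B < rk X" using card_le_rk B by (simp add: order_less_le)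
    moreover obtain J where "J \<in> indep N" "J \<subseteq> X" "card J = rk X"
      by (rule rk_basis)
    ultimately have J: "J \<in> indep N" "J \<subseteq> X" "card B < card J" by simp_all
    then obtain y where y: "y \<in> J - B" "insert y B \<in> indep N"
      using indep_augment[of B J] B(1) by blast
    then have "insert y B \<in> ?S" using B J by blast
    then show False using max y by blast
  qed
  then show ?thesis using B that by blast
qed

lemma rk_mono: "X \<subseteq> Y \<Longrightarrow> rk X \<le> rk Y"
proof -
  assume *: "X \<subseteq> Y"
  obtain B where "B \<in> indep N" "B \<subseteq> X" "card B = rk X" by (rule rk_basis)
  then show ?thesis using card_le_rk[of B Y] * by simp
qed

lemma rk_le_card: "finite X \<Longrightarrow> rk X \<le> card X"
proof -
  assume *: "finite X"
  obtain B where "B \<in> indep N" "B \<subseteq> X" "card B = rk X" by (rule rk_basis)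
  then show ?thesis using card_mono[of X B] * by simp
qed

lemma rk_empty [simp]: "rk {} = 0"
  using rk_le_card[of "{}"] by simp

text \<open>A basis of the intersection is extended to a basis \<open>J\<close> of the union;
  counting \<open>J\<close> in \<open>X\<close> and in \<open>Y\<close> separately counts the former
  basis twice.\<close>

lemma rk_submodular: "rk (X \<union> Y) + rk (X \<inter> Y) \<le> rk X + rk Y"
proof -
  obtain I where I: "I \<in> indep N" "I \<subseteq> X \<inter> Y" "card I = rk (X \<inter> Y)"
    by (rule rk_basis)
  then obtain J where J: "J \<in> indep N" "I \<subseteq> J" "J \<subseteq> X \<union> Y" "card J = rk (X \<union> Y)"
    using extend_to_basis[of I "X \<union> Y"] by blast
  have fin: "finite J" using J indep_finite by blast
  have "card (J \<inter> X) + card (J \<inter> Y) = card (J \<inter> X \<union> J \<inter> Y) + card (J \<inter> X \<inter> (J \<inter> Y))"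
    using fin by (intro card_Un_Int) auto
  moreover have "J \<inter> X \<union> J \<inter> Y = J" using J by blast
  moreover have "card I \<le> card (J \<inter> X \<inter> (J \<inter> Y))"
    using I J fin by (intro card_mono) auto
  moreover have "card (J \<inter> X) \<le> rk X" "card (J \<inter> Y) \<le> rk Y"
    using J indep_mono by (auto intro!: card_le_rk)
  ultimately show ?thesis using I J by simp
qed

lemma rk_insert_le: "rk (insert e X) \<le> rk X + 1"
  using rk_submodular[of X "{e}"] rk_le_card[of "{e}"] by simp

lemma mem_cl_iff: "e \<in> cl X \<longleftrightarrow> e \<in> E \<and> rk (insert e X) = rk X"
  by (simp add: mclosure_def)

lemma cl_subset_E: "cl X \<subseteq> E"
  by (auto simp: mclosure_def)

lemma subset_cl: "X \<subseteq> E \<Longrightarrow> X \<subseteq> cl X"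
  by (auto simp: mem_cl_iff insert_absorb)

text \<open>Elements of the closure are added one at a time, each at no cost by submodularity. The
  union with \<open>X\<close> is taken because \<open>subset_cl\<close> puts \<open>X\<close> into
  \<open>cl X\<close> only inside the ground set.\<close>

lemma rk_Un_cl: "rk (X \<union> cl X) = rk X"
proof -
  have "finite A \<Longrightarrow> A \<subseteq> cl X \<Longrightarrow> rk (X \<union> A) \<le> rk X" for A
  proof (induction A rule: finite_induct)
    case (insert e A)
    have "(X \<union> A) \<union> insert e X = X \<union> insert e A" by blast
    moreover have "rk X \<le> rk ((X \<union> A) \<inter> insert e X)" by (rule rk_mono) blast
    moreover have "rk (insert e X) = rk X" using insert.prems by (simp add: mem_cl_iff)
    ultimately show ?case using rk_submodular[of "X \<union> A" "insert e X"] insert by simp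
  qed simp
  moreover have "finite (cl X)" using cl_subset_E finite_E finite_subset by blast
  ultimately show ?thesis using rk_mono[of X "X \<union> cl X"] by (simp add: order_antisym)
qed

lemma rk_cl_Un: "X \<subseteq> E \<Longrightarrow> rk (cl X \<union> Y) = rk (X \<union> Y)"
proof -
  assume X: "X \<subseteq> E"
  have "rk ((X \<union> cl X) \<union> (X \<union> Y)) + rk ((X \<union> cl X) \<inter> (X \<union> Y)) \<le> rk (X \<union> cl X) + rk (X \<union> Y)"
    by (rule rk_submodular)
  moreover have "(X \<union> cl X) \<union> (X \<union> Y) = cl X \<union> Y" using subset_cl[OF X] by blast
  moreover have "rk X \<le> rk ((X \<union> cl X) \<inter> (X \<union> Y))" by (rule rk_mono) blast
  moreover have "rk (X \<union> Y) \<le> rk (cl X \<union> Y)" by (rule rk_mono) (use subset_cl[OF X] in blast)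
  ultimately show ?thesis by (simp add: rk_Un_cl)
qed

lemma rk_cl: "X \<subseteq> E \<Longrightarrow> rk (cl X) = rk X"
  using rk_cl_Un[of X "{}"] by simp

lemma flats_iff: "F \<in> flats N \<longleftrightarrow> F \<subseteq> E \<and> (\<forall>e\<in>E - F. rk F < rk (insert e F))"
proof -
  have *: "rk F < rk (insert e F) \<longleftrightarrow> rk (insert e F) \<noteq> rk F" for e
    using rk_mono[of F "insert e F"] by (auto simp: order_less_le)
  show ?thesis
    using subset_cl[of F] unfolding flats_def * by (auto simp: mclosure_def)
qed

lemma flat_subset_E: "F \<in> flats N \<Longrightarrow> F \<subseteq> E"
  by (simp add: flats_iff)

lemma cl_minimal:
  assumes "F \<in> flats N" "X \<subseteq> F"
  shows "cl X \<subseteq> F"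
proof
  fix e assume e: "e \<in> cl X"
  show "e \<in> F"
  proof (rule ccontr)
    assume "e \<notin> F"
    then have "rk F < rk (insert e F)" using assms e by (simp add: flats_iff mem_cl_iff)
    moreover have "F \<union> insert e X = insert e F" "F \<inter> insert e X = X" using assms \<open>e \<notin> F\<close> by auto
    ultimately show False using rk_submodular[of F "insert e X"] e by (simp add: mem_cl_iff)
  qed
qed

lemma cl_flat: "X \<subseteq> E \<Longrightarrow> cl X \<in> flats N"
proof -
  assume X: "X \<subseteq> E"
  have "rk (insert e (cl X)) = rk (insert e X)" for e
    using rk_cl_Un[OF X, of "{e}"] by simp
  then show ?thesis
    using rk_mono[of X "insert _ X"] unfolding flats_iff
    by (auto simp: cl_subset_E rk_cl[OF X] mem_cl_iff order_less_le subset_insertI)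
qed

lemma E_flat: "E \<in> flats N"
  by (simp add: flats_iff)

lemma finite_flats: "finite (flats N)"
  by (rule finite_subset[of _ "Pow E"]) (use flat_subset_E finite_E in auto)

lemma finite_nontrivial_flats: "finite (nontrivial_flats N)"
  using finite_flats by (simp add: nontrivial_flats_def)

lemma rk_flat_strict_mono: "F \<in> flats N \<Longrightarrow> F \<subset> G \<Longrightarrow> G \<subseteq> E \<Longrightarrow> rk F < rk G"
proof -
  assume *: "F \<in> flats N" "F \<subset> G" "G \<subseteq> E"
  then obtain e where e: "e \<in> G - F" by blast
  then have "rk F < rk (insert e F)" using * by (auto simp: flats_iff)
  also have "\<dots> \<le> rk G" by (rule rk_mono) (use * e in blast)
  finally show ?thesis .
qed

text \<open>Closing up \<open>F\<close> with one further element of \<open>G\<close> raises the rank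
  by exactly one and stays within the flat \<open>G\<close>.\<close>

lemma flat_cover:
  assumes "F \<in> flats N" "F \<subset> G" "G \<in> flats N"
  obtains H where "H \<in> flats N" "F \<subset> H" "H \<subseteq> G" "rk H = rk F + 1"
proof -
  obtain e where e: "e \<in> G - F" using assms by blast
  have sub: "insert e F \<subseteq> E" using assms e flat_subset_E by blast
  show ?thesis
  proof (rule that[of "cl (insert e F)"])
    show "cl (insert e F) \<in> flats N" using sub by (rule cl_flat)
    show "F \<subset> cl (insert e F)" using subset_cl[OF sub] e by blast
    show "cl (insert e F) \<subseteq> G" using cl_minimal assms e by blast
    have "rk F < rk (insert e F)" using assms e flat_subset_E by (auto simp: flats_iff)
    then show "rk (cl (insert e F)) = rk F + 1"
      using rk_cl[OF sub] rk_insert_le[of e F] by simp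
  qed
qed

end

locale loopless_matroid = finite_matroid +
  assumes empty_flat: "{} \<in> flats N"
begin

abbreviation "B \<equiv> bergman_fan N"
abbreviation "Ln \<equiv> nontrivial_flats N"

lemma Ln_flat: "F \<in> Ln \<Longrightarrow> F \<in> flats N"
  by (simp add: nontrivial_flats_def)

lemma rk_pos: "F \<subseteq> E \<Longrightarrow> F \<noteq> {} \<Longrightarrow> 0 < rk F"
  using rk_flat_strict_mono[OF empty_flat, of F] by (simp add: psubset_eq eq_commute)

lemma rk_nontrivial:
  assumes "F \<in> Ln"
  shows "0 < rk F" "rk F < rk E"
  using assms rk_pos[of F] rk_flat_strict_mono[of F E] flat_subset_E[of F]
  by (auto simp: nontrivial_flats_def)

lemma cone_iff: "C \<in> cones B \<longleftrightarrow> subset.chain Ln C"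
  by (simp add: bergman_fan_def)

lemma cone_comparable: "C \<in> cones B \<Longrightarrow> F \<in> C \<Longrightarrow> G \<in> C \<Longrightarrow> F \<subseteq> G \<or> G \<subseteq> F"
  by (auto simp: cone_iff subset_chain_def)

lemma cone_subset_Ln: "C \<in> cones B \<Longrightarrow> C \<subseteq> Ln"
  by (simp add: cone_iff subset_chain_def)

lemma cone_finite: "C \<in> cones B \<Longrightarrow> finite C"
  using cone_subset_Ln finite_nontrivial_flats finite_subset by blast

lemma cone_inj_rk: "C \<in> cones B \<Longrightarrow> inj_on rk C"
proof (rule inj_onI)
  fix F G assume *: "C \<in> cones B" "F \<in> C" "G \<in> C" "rk F = rk G"
  then have "F \<in> flats N" "G \<in> flats N" using cone_subset_Ln Ln_flat by blast+
  then show "F = G"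
    using * cone_comparable[of C F G] rk_flat_strict_mono[of F G] rk_flat_strict_mono[of G F]
      flat_subset_E by fastforce
qed

lemma card_cone_bound: "C \<in> cones B \<Longrightarrow> card C \<le> rk E - 1"
proof -
  assume C: "C \<in> cones B"
  have "card C = card (rk ` C)" using cone_inj_rk[OF C] by (simp add: card_image)
  also have "\<dots> \<le> card {1..<rk E}"
    by (rule card_mono) (use cone_subset_Ln[OF C] rk_nontrivial in \<open>fastforce\<close>)+
  finally show ?thesis by simp
qed

text \<open>If rank \<open>r\<close> were missing, take the largest member G of smaller rank and the
  smallest member H of larger rank. A cover of G inside H has rank at most \<open>r\<close> and is
  comparable with every member, so maximality puts it into the chain, contradicting the choice of
  G.\<close>

lemma maximal_cone_rk:
  assumes C: "C \<in> maximal_cones B" and r: "0 < r" "r < rk E"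
  obtains F where "F \<in> C" "rk F = r"
proof (rule ccontr)
  assume "\<not> thesis"
  then have no: "rk F \<noteq> r" if "F \<in> C" for F using that \<open>\<And>F. F \<in> C \<Longrightarrow> rk F = r \<Longrightarrow> thesis\<close> by blast
  have cone: "C \<in> cones B" using C by (simp add: maximal_cones_def)
  \<comment> \<open>The two trivial flats are adjoined so that a gap at either end of the chain is
    also bounded on both sides.\<close>
  let ?C = "insert {} (insert E C)"
  have flat: "F \<in> flats N" if "F \<in> ?C" for F
    using that empty_flat E_flat cone_subset_Ln[OF cone] Ln_flat by blast
  then have chain: "subset.chain (flats N) ?C"
    using cone_comparable[OF cone] flat_subset_E by (auto simp: subset_chain_def)
  have sub: "subset.chain (flats N) S" if "S \<subseteq> ?C" for S
    using chain that by (rule subset_chain_mono)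
  have fin: "finite ?C" using cone_finite[OF cone] by simp
  let ?A = "{F \<in> ?C. rk F < r}" and ?B = "{F \<in> ?C. r < rk F}"
  have "\<Union>?A \<in> ?A" 
  proof (rule Union_in_chain)
    show "finite ?A" by (rule finite_subset[OF _ fin]) (rule Collect_subset)
    have "{} \<in> ?A" using r by simp
    then show "?A \<noteq> {}" by (metis empty_iff)
    show "subset.chain (flats N) ?A" by (rule sub) (rule Collect_subset)
  qed
  then have G: "\<Union>?A \<in> ?C" "rk (\<Union>?A) < r" by simp_all
  have GU: "F \<subseteq> \<Union>?A" if "F \<in> ?C" "rk F < r" for F
    by (rule Union_upper) (use that in simp)
  define G where "G = \<Union>?A"
  note G = G[folded G_def] GU[folded G_def]
  have "\<Inter>?B \<in> ?B" 
  proof (rule Inter_in_chain)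
    show "finite ?B" by (rule finite_subset[OF _ fin]) (rule Collect_subset)
    have "E \<in> ?B" using r by simp
    then show "?B \<noteq> {}" by (metis empty_iff)
    show "subset.chain (flats N) ?B" by (rule sub) (rule Collect_subset)
  qed
  then have H: "\<Inter>?B \<in> ?C" "r < rk (\<Inter>?B)" by simp_all
  have HI: "\<Inter>?B \<subseteq> F" if "F \<in> ?C" "r < rk F" for F
    by (rule Inter_lower) (use that in simp)
  define H where "H = \<Inter>?B"
  note H = H[folded H_def] HI[folded H_def]
  have "G \<subset> H"
  proof -
    have "\<forall>X\<in>?C. \<forall>Y\<in>?C. X \<subseteq> Y \<or> Y \<subseteq> X"
      using chain unfolding subset_chain_def by (rule conjunct2)
    then have "G \<subseteq> H \<or> H \<subseteq> G" by (rule bspec[OF bspec[OF _ G(1)] H(1)])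
    then show ?thesis using rk_mono[of H G] G(2) H(2) by force
  qed
  then obtain K where K: "K \<in> flats N" "G \<subset> K" "K \<subseteq> H" "rk K = rk G + 1"
    using flat_cover[OF flat[OF G(1)] _ flat[OF H(1)]] by blast
  have "K \<noteq> {}" "K \<noteq> E" using K G(2) r by auto
  then have KLn: "K \<in> Ln" using K by (simp add: nontrivial_flats_def)
  have "F \<subseteq> K \<or> K \<subseteq> F" if "F \<in> C" for F
  proof (cases "rk F < r")
    case True
    then have "F \<subseteq> G" using G(3) that by simp
    then show ?thesis using K(2) by blast
  next
    case False
    then have "H \<subseteq> F" using H(3) that no[OF that] by simp
    then show ?thesis using K(3) by blast
  qed
  then have "insert K C \<in> cones B"
    using cone KLn by (auto simp: cone_iff subset_chain_def)
  then have "K \<in> C" using C by (auto simp: maximal_cones_def)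
  then have "rk K < r" using no[of K] K G(2) by simp
  then show False using G(3)[of K] \<open>K \<in> C\<close> K(2) by blast
qed

lemma card_maximal_cone: "C \<in> maximal_cones B \<Longrightarrow> card C = rk E - 1"
proof -
  assume C: "C \<in> maximal_cones B"
  then have cone: "C \<in> cones B" by (simp add: maximal_cones_def)
  have "{1..<rk E} \<subseteq> rk ` C"
  proof
    fix r assume "r \<in> {1..<rk E}"
    then have r: "0 < r" "r < rk E" by simp_all
    obtain F where "F \<in> C" "rk F = r" by (rule maximal_cone_rk[OF C r])
    then show "r \<in> rk ` C" by blast
  qed
  then have "card {1..<rk E} \<le> card (rk ` C)" using cone_finite[OF cone] by (intro card_mono) auto
  also have "\<dots> = card C" using cone_inj_rk[OF cone] by (rule card_image)
  finally show ?thesis using card_cone_bound[OF cone] by simp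
qed

lemma finite_cones: "finite (cones B)"
  by (rule finite_subset[of _ "Pow Ln"]) (use cone_subset_Ln finite_nontrivial_flats in auto)

lemma fan_dim_bergman: "fan_dim B = rk E - 1"
proof -
  have "{} \<in> cones B" by (simp add: cone_iff)
  then obtain C where "C \<in> cones B" "\<And>D. D \<in> cones B \<Longrightarrow> C \<subseteq> D \<Longrightarrow> C = D"
    using finite_has_maximal[OF finite_cones] by blast
  then have "C \<in> maximal_cones B" by (auto simp: maximal_cones_def)
  moreover from this have "C \<in> cones B" by (simp add: maximal_cones_def)
  ultimately have "rk E - 1 \<in> card ` cones B" using card_maximal_cone by force
  then show ?thesis
    unfolding fan_dim_def using finite_cones card_cone_bound by (intro Max_eqI) auto
qed

text \<open>\<open>a\<close> lies in \<open>F\<close> but not in the preceding member of the chain,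
  \<open>b\<close> in the following one but not in \<open>F\<close>, with the empty set and
  \<open>E\<close> at the ends. Then u_a - u_b is the functional dual to \<open>F\<close>.\<close>

lemma cone_separate:
  assumes C: "C \<in> cones B" and F: "F \<in> C"
  obtains a b where "a \<in> F" "b \<in> E - F"
    "\<And>G. G \<in> C \<Longrightarrow> G \<noteq> F \<Longrightarrow> a \<in> G \<longleftrightarrow> b \<in> G"
proof -
  have FLn: "F \<in> Ln" using C F cone_subset_Ln by blast
  let ?A = "insert {} {G \<in> C. G \<subset> F}" and ?B = "insert E {G \<in> C. F \<subset> G}"
  have GE: "G \<subseteq> E" if "G \<in> C" for G using that C cone_subset_Ln Ln_flat flat_subset_E by blast
  have chain: "subset.chain UNIV ?A" "subset.chain UNIV ?B"
    using cone_comparable[OF C] GE by (auto simp: subset_chain_def)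
  have "\<Union>?A \<in> ?A" using chain cone_finite[OF C] by (intro Union_in_chain) auto
  then have "\<Union>?A \<subset> F" using FLn by (auto simp: nontrivial_flats_def)
  then obtain a where a: "a \<in> F" "a \<notin> \<Union>?A" by blast
  have "\<Inter>?B \<in> ?B" using chain cone_finite[OF C] by (intro Inter_in_chain) auto
  then have "F \<subset> \<Inter>?B" using FLn flat_subset_E by (auto simp: nontrivial_flats_def)
  then obtain b where b: "b \<in> \<Inter>?B" "b \<notin> F" by blast
  show ?thesis
  proof (rule that)
    fix G assume "G \<in> C" "G \<noteq> F"
    then have "G \<subset> F \<or> F \<subset> G" using cone_comparable[OF C F] by blast
    then show "a \<in> G \<longleftrightarrow> b \<in> G" using a b \<open>G \<in> C\<close> by auto
  qed (use a b in auto)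
qed

sublocale bergman: pure_simplicial_fan B
proof
  show "finite (rays B)" using finite_nontrivial_flats by (simp add: bergman_fan_def)
  show "\<sigma> \<subseteq> rays B" if "\<sigma> \<in> cones B" for \<sigma>
    using cone_subset_Ln[OF that] by (simp add: bergman_fan_def)
  show "card \<sigma> = fan_dim B" if "\<sigma> \<in> maximal_cones B" for \<sigma>
    using card_maximal_cone[OF that] by (simp add: fan_dim_bergman)
  show "\<exists>l\<in>linear_functions (ambient B). l (ray_vec B F) = 1 \<and> (\<forall>G\<in>C - {F}. l (ray_vec B G) = 0)"
    if "C \<in> cones B" "F \<in> C" for C F
  proof -
    obtain a b where ab: "a \<in> F" "b \<in> E - F" "\<And>G. G \<in> C \<Longrightarrow> G \<noteq> F \<Longrightarrow> a \<in> G \<longleftrightarrow> b \<in> G"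
      using cone_separate[OF \<open>C \<in> cones B\<close> \<open>F \<in> C\<close>] by blast
    have "a \<in> E" using ab(1) \<open>C \<in> cones B\<close> \<open>F \<in> C\<close> cone_subset_Ln Ln_flat flat_subset_E by blast
    then have "(\<lambda>u. u a - u b) \<in> linear_functions E"
      using ab by (intro linear_functions_coord_diff) auto
    then show ?thesis
      using ab by (intro bexI[of _ "\<lambda>u. u a - u b"]) (auto simp: bergman_fan_def indicator_def)
  qed
qed

end

section \<open>The volume polynomial of a loopless matroid\<close>

text \<open>Moebius inversion by peeling off a minimal member \<open>M\<close>: no other member lies
  below it, so \<open>f M\<close> enters only its own equation and can be chosen last.\<close>

lemma upward_inversion:
  fixes g :: "'a set \<Rightarrow> 'b::ab_group_add"
  assumes "finite P"
  shows "\<exists>f. \<forall>F\<in>P. (\<Sum>G | G \<in> P \<and> F \<subseteq> G. f G) = g F"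
  using assms
proof (induction P rule: finite_psubset_induct)
  case (psubset P)
  show ?case
  proof (cases "P = {}")
    case False
    then obtain M where M: "M \<in> P" "\<And>F. F \<in> P \<Longrightarrow> F \<subseteq> M \<Longrightarrow> F = M"
      using finite_has_minimal[OF psubset.hyps] by blast
    have "P - {M} \<subset> P" using M by blast
    from psubset.IH[OF this]
    obtain f where f: "\<forall>F\<in>P - {M}. (\<Sum>G | G \<in> P - {M} \<and> F \<subseteq> G. f G) = g F" by (rule exE)
    let ?f = "f(M := g M - (\<Sum>G | G \<in> P - {M} \<and> M \<subseteq> G. f G))"
    have "(\<Sum>G | G \<in> P \<and> F \<subseteq> G. ?f G) = g F" if F: "F \<in> P" for F
    proof (cases "F = M")
      case True
      have "{G. G \<in> P \<and> F \<subseteq> G} = insert M {G. G \<in> P - {M} \<and> M \<subseteq> G}" using M True by auto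
      moreover have "(\<Sum>G | G \<in> P - {M} \<and> M \<subseteq> G. ?f G) = (\<Sum>G | G \<in> P - {M} \<and> M \<subseteq> G. f G)"
        by (rule sum.cong) auto
      ultimately show ?thesis using psubset.hyps True by simp
    next
      case False
      then have "{G. G \<in> P \<and> F \<subseteq> G} = {G. G \<in> P - {M} \<and> F \<subseteq> G}" using M F by auto
      moreover have "(\<Sum>G | G \<in> P - {M} \<and> F \<subseteq> G. ?f G) = (\<Sum>G | G \<in> P - {M} \<and> F \<subseteq> G. f G)"
        by (rule sum.cong) auto
      ultimately show ?thesis using f F False by simp
    qed
    then show ?thesis by blast
  qed simp
qed

locale positive_rank_matroid = loopless_matroid +
  assumes rk_E_pos: "0 < rk E"
begin

text \<open>The ground set is included. It is no ray of the Bergman fan, but it can be the join in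
  the exchange relation, and it ends every flag.\<close>

definition "P = flats N - {{}}"

lemma P_eq: "P = insert E Ln"
  using rk_E_pos E_flat by (auto simp: P_def nontrivial_flats_def)

lemma P_flat: "F \<in> P \<Longrightarrow> F \<in> flats N"
  by (simp add: P_def)

lemma P_subset_E: "F \<in> P \<Longrightarrow> F \<subseteq> E"
  using P_flat flat_subset_E by blast

lemma Ln_subset_P: "F \<in> Ln \<Longrightarrow> F \<in> P"
  by (simp add: P_eq)

lemma finite_P: "finite P"
  by (simp add: P_def finite_flats)

lemma cl_in_P: "X \<subseteq> E \<Longrightarrow> X \<noteq> {} \<Longrightarrow> cl X \<in> P"
  using cl_flat[of X] subset_cl[of X] by (auto simp: P_def)

subsection \<open>The dragon Hall--Rado condition\<close>

definition weight :: "('a set \<Rightarrow>\<^sub>0 nat) \<Rightarrow> 'a set set \<Rightarrow> nat" where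
  "weight m A = (\<Sum>F\<in>A. lookup m F)"

text \<open>The usual condition asks every nonempty subfamily of a multiset of flats to have a union
  of rank larger than its size. Only full multiplicities are tested, because further copies of a
  flat increase the size and not the union.\<close>

definition dhr :: "('a set \<Rightarrow>\<^sub>0 nat) \<Rightarrow> bool" where
  "dhr m \<longleftrightarrow> (\<forall>A\<subseteq>P. 0 < weight m A \<longrightarrow> weight m A < rk (\<Union>A))"

text \<open>Collects the conditions on subfamilies that contain \<open>k\<close> new members with
  union \<open>X\<close>; the values 1 and 2 describe adding one and two flats. The empty
  \<open>A\<close> is included, since the new members alone must satisfy the condition.\<close>

definition room :: "nat \<Rightarrow> ('a set \<Rightarrow>\<^sub>0 nat) \<Rightarrow> 'a set \<Rightarrow> bool" where
  "room k m X \<longleftrightarrow> (\<forall>A\<subseteq>P. weight m A + k < rk (X \<union> \<Union>A))"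

lemma dhrD: "dhr m \<Longrightarrow> A \<subseteq> P \<Longrightarrow> 0 < weight m A \<Longrightarrow> weight m A < rk (\<Union>A)"
  by (simp add: dhr_def)

lemma roomD: "room k m X \<Longrightarrow> A \<subseteq> P \<Longrightarrow> weight m A + k < rk (X \<union> \<Union>A)"
  by (simp add: room_def)

lemma weight_add: "weight (m + n) A = weight m A + weight n A"
  by (simp add: weight_def lookup_add sum.distrib)

lemma weight_single: "A \<subseteq> P \<Longrightarrow> weight (single F 1) A = (if F \<in> A then 1 else 0)"
  using finite_subset[OF _ finite_P] by (simp add: weight_def lookup_single when_def)

lemma weight_insert_le: "A \<subseteq> P \<Longrightarrow> F \<in> P \<Longrightarrow> weight m A \<le> weight m (insert F A)"
  using finite_subset[OF _ finite_P] by (auto simp: weight_def intro!: sum_mono2)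

text \<open>Subfamilies are split by whether they contain the new copy of \<open>F\<close>. Those
  that do are the subject of \<open>room\<close>; \<open>F\<close> may already occur in
  \<open>m\<close>, and then its old copies count as well.\<close>

lemma dhr_add:
  assumes F: "F \<in> P"
  shows "dhr (m + single F 1) \<longleftrightarrow> dhr m \<and> room 1 m F"
proof (intro iffI conjI)
  assume *: "dhr (m + single F 1)"
  show "dhr m"
    unfolding dhr_def
  proof (intro allI impI)
    fix A assume A: "A \<subseteq> P" "0 < weight m A"
    then have "weight (m + single F 1) A < rk (\<Union>A)"
      by (intro dhrD[OF *]) (simp_all add: weight_add)
    then show "weight m A < rk (\<Union>A)" by (simp add: weight_add)
  qed
  show "room 1 m F"
    unfolding room_def
  proof (intro allI impI)
    fix A assume A: "A \<subseteq> P"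
    then have ins: "insert F A \<subseteq> P" using F by blast
    then have "weight (m + single F 1) (insert F A) = weight m (insert F A) + 1"
      by (simp add: weight_add weight_single[unfolded One_nat_def])
    then have "weight m (insert F A) + 1 < rk (\<Union>(insert F A))"
      using dhrD[OF * ins] by simp
    then show "weight m A + 1 < rk (F \<union> \<Union>A)"
      using weight_insert_le[OF A F, of m] by simp
  qed
next
  assume *: "dhr m \<and> room 1 m F"
  show "dhr (m + single F 1)"
    unfolding dhr_def
  proof (intro allI impI)
    fix A assume A: "A \<subseteq> P" "0 < weight (m + single F 1) A"
    show "weight (m + single F 1) A < rk (\<Union>A)"
    proof (cases "F \<in> A")
      case True
      have "weight m A + 1 < rk (F \<union> \<Union>A)" using * A by (simp add: room_def)
      moreover have "F \<union> \<Union>A = \<Union>A" using True by blast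
      ultimately show ?thesis using True A by (simp add: weight_add weight_single[unfolded One_nat_def])
    next
      case False
      then have "weight (m + single F 1) A = weight m A"
        using A by (simp add: weight_add weight_single[unfolded One_nat_def])
      then show ?thesis using * A by (simp add: dhr_def)
    qed
  qed
qed

lemma room_add:
  assumes F: "F \<in> P"
  shows "room 1 (m + single F 1) G \<longleftrightarrow> room 1 m G \<and> room 2 m (F \<union> G)"
proof (intro iffI conjI)
  assume *: "room 1 (m + single F 1) G"
  show "room 1 m G"
    unfolding room_def
  proof (intro allI impI)
    fix A assume "A \<subseteq> P"
    then have "weight (m + single F 1) A + 1 < rk (G \<union> \<Union>A)" using * by (simp add: room_def)
    then show "weight m A + 1 < rk (G \<union> \<Union>A)" by (simp add: weight_add)
  qed
  show "room 2 m (F \<union> G)"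
    unfolding room_def
  proof (intro allI impI)
    fix A assume A: "A \<subseteq> P"
    then have ins: "insert F A \<subseteq> P" using F by blast
    then have "weight (m + single F 1) (insert F A) = weight m (insert F A) + 1"
      by (simp add: weight_add weight_single[unfolded One_nat_def])
    moreover have "weight (m + single F 1) (insert F A) + 1 < rk (G \<union> \<Union>(insert F A))"
      using ins by (rule roomD[OF *])
    moreover have "G \<union> \<Union>(insert F A) = F \<union> G \<union> \<Union>A" by blast
    ultimately have "weight m (insert F A) + 2 < rk (F \<union> G \<union> \<Union>A)" by simp
    then show "weight m A + 2 < rk (F \<union> G \<union> \<Union>A)"
      using weight_insert_le[OF A F, of m] by simp
  qed
next
  assume *: "room 1 m G \<and> room 2 m (F \<union> G)"
  show "room 1 (m + single F 1) G"
    unfolding room_def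
  proof (intro allI impI)
    fix A assume A: "A \<subseteq> P"
    show "weight (m + single F 1) A + 1 < rk (G \<union> \<Union>A)"
    proof (cases "F \<in> A")
      case True
      have "weight m A + 2 < rk (F \<union> G \<union> \<Union>A)" using * A by (simp add: room_def)
      moreover have "F \<union> G \<union> \<Union>A = G \<union> \<Union>A" using True by blast
      ultimately show ?thesis using True A by (simp add: weight_add weight_single[unfolded One_nat_def])
    next
      case False
      then have "weight (m + single F 1) A = weight m A"
        using A by (simp add: weight_add weight_single[unfolded One_nat_def])
      then show ?thesis using * A by (simp add: room_def)
    qed
  qed
qed

lemma dhr_add2:
  assumes "F \<in> P" "G \<in> P"
  shows "dhr (m + single F 1 + single G 1) \<longleftrightarrow> dhr m \<and> room 1 m F \<and> room 1 m G \<and> room 2 m (F \<union> G)"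
  using dhr_add[OF assms(2), of "m + single F 1"] dhr_add[OF assms(1), of m] room_add[OF assms(1), of m G]
  by blast

lemma room_cl: "X \<subseteq> E \<Longrightarrow> room k m (cl X) \<longleftrightarrow> room k m X"
  by (simp add: room_def rk_cl_Un)

text \<open>If both \<open>F\<close> and \<open>G\<close> violated the condition, witnessed by \<open>A\<close> and \<open>B\<close>, then submodularity
  applied to \<open>F \<union> \<Union>A\<close> and \<open>G \<union> \<Union>B\<close> would produce a violation by \<open>A \<inter> B\<close>.\<close>

lemma room_alternative:
  assumes m: "dhr m" and FG: "room 2 m (F \<union> G)"
  shows "room 1 m F \<or> room 1 m G"
proof (rule ccontr)
  assume "\<not> ?thesis"
  then obtain A B where AB: "A \<subseteq> P" "rk (F \<union> \<Union>A) \<le> weight m A + 1"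
    "B \<subseteq> P" "rk (G \<union> \<Union>B) \<le> weight m B + 1"
    unfolding room_def not_less[symmetric] by blast
  have fin: "finite A" "finite B" using AB finite_P finite_subset by blast+
  have w: "weight m (A \<union> B) + weight m (A \<inter> B) = weight m A + weight m B"
    unfolding weight_def using fin by (rule sum.union_inter)
  have "A \<union> B \<subseteq> P" using AB by blast
  then have "weight m (A \<union> B) + 2 < rk (F \<union> G \<union> \<Union>(A \<union> B))" by (rule roomD[OF FG])
  moreover have "F \<union> G \<union> \<Union>(A \<union> B) = (F \<union> \<Union>A) \<union> (G \<union> \<Union>B)" by blast
  ultimately have "weight m (A \<union> B) + 2 + rk ((F \<union> \<Union>A) \<inter> (G \<union> \<Union>B)) < rk (F \<union> \<Union>A) + rk (G \<union> \<Union>B)"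
    using rk_submodular[of "F \<union> \<Union>A" "G \<union> \<Union>B"] by simp
  moreover have "rk (\<Union>(A \<inter> B)) \<le> rk ((F \<union> \<Union>A) \<inter> (G \<union> \<Union>B))" by (rule rk_mono) blast
  \<comment> \<open>Being above a rank, the weight of the intersection is positive, so the condition
    on \<open>m\<close> applies to it.\<close>
  ultimately have "rk (\<Union>(A \<inter> B)) < weight m (A \<inter> B)" using AB w by simp
  moreover have "A \<inter> B \<subseteq> P" using AB by blast
  ultimately show False using dhrD[OF m, of "A \<inter> B"] by simp
qed

text \<open>In terms of degrees, this is the relation \<open>(h_Z - h_F)(h_Z - h_G) = 0\<close>.\<close>

lemma dhr_exchange:
  assumes F: "F \<in> P" and G: "G \<in> P" and Z: "Z = cl (F \<union> G)"
  shows "of_bool (dhr (m + single F 1 + single G 1)) + of_bool (dhr (m + single Z 1 + single Z 1))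
       = of_bool (dhr (m + single F 1 + single Z 1)) + (of_bool (dhr (m + single G 1 + single Z 1)) :: real)"
proof -
  have sub: "F \<union> G \<subseteq> E" using F G P_subset_E by blast
  have "F \<noteq> {}" using F by (simp add: P_def)
  then have ZP: "Z \<in> P" unfolding Z using sub by (intro cl_in_P) auto
  have *: "room 2 m (F \<union> G) \<longleftrightarrow> room 2 m Z" by (simp add: Z room_cl[OF sub])
  have FZ: "F \<union> Z = Z" "G \<union> Z = Z" using subset_cl[OF sub] Z by blast+
  have Z12: "room 1 m Z" if "room 2 m Z" using that unfolding room_def by (metis add_lessD1 nat_1_add_1 add.assoc)
  have alt: "room 1 m F \<or> room 1 m G" if "dhr m" "room 2 m Z"
    using that room_alternative * by blast
  show ?thesis
    \<comment> \<open>All four terms share the factors \<open>dhr m\<close> and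
      \<open>room 2 m Z\<close>. What remains is (1 - f)(1 - g) = 0 for the truth values f, g of
      \<open>room 1 m F\<close> and \<open>room 1 m G\<close>, which is the alternative.\<close>
    unfolding dhr_add2[OF F G] dhr_add2[OF ZP ZP] dhr_add2[OF F ZP] dhr_add2[OF G ZP] * FZ Un_absorb
    using Z12 alt
    by (cases "dhr m"; cases "room 2 m Z"; cases "room 1 m F"; cases "room 1 m G") simp_all
qed

subsection \<open>The volume polynomial in the nef variables\<close>

definition efact :: "('a set \<Rightarrow>\<^sub>0 nat) \<Rightarrow> real" where
  "efact m = (\<Prod>F\<in>P. fact (lookup m F))"

text \<open>Intended meaning: the degree of the (r-1)-st power of the sum of all t_H h_H, divided by
  (r-1)!, where r is the rank. In divided powers, the coefficient of \<open>m\<close> is the degree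
  of the product of the h_H with multiplicities \<open>m\<close>.\<close>

definition Q :: "'a set mpoly" where
  "Q = (\<Sum>m | keys m \<subseteq> P \<and> mdegree m = rk E - 1. single m (of_bool (dhr m) / efact m))"

lemma efact_add: "F \<in> P \<Longrightarrow> efact (m + single F 1) = (real (lookup m F) + 1) * efact m"
proof -
  assume F: "F \<in> P"
  have "efact (m + single F 1) = (\<Prod>G\<in>P. (if G = F then real (lookup m F) + 1 else 1) * fact (lookup m G))"
    unfolding efact_def
    by (rule prod.cong) (auto simp: lookup_add lookup_single when_def)
  also have "\<dots> = (real (lookup m F) + 1) * efact m"
    using F finite_P by (simp add: prod.distrib efact_def)
  finally show ?thesis .
qed

lemma lookup_Q: "lookup Q m =
    (if keys m \<subseteq> P \<and> mdegree m = rk E - 1 then of_bool (dhr m) / efact m else 0)"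
  using finite_bounded_degree[OF finite_P]
  by (simp add: Q_def lookup_sum lookup_single when_def)

text \<open>The factorials in \<open>Q\<close> absorb the factors produced by differentiation, so
  that \<open>mono_diff k\<close> merely shifts the argument of \<open>dhr\<close> by
  \<open>k\<close>.\<close>

lemma lookup_mono_diff_Q:
  assumes "keys k \<subseteq> P"
  shows "lookup (mono_diff k Q) m = (if keys m \<subseteq> P \<and> mdegree m + mdegree k = rk E - 1
    then of_bool (dhr (m + k)) / efact m else 0)"
  using assms
proof (induction k arbitrary: m rule: exponent_induct)
  case (add k F)
  have F: "F \<in> P" and k: "keys k \<subseteq> P" using add.prems by (auto simp: keys_add_nat)
  have "lookup (mono_diff (k + single F 1) Q) m = (real (lookup m F) + 1) * lookup (mono_diff k Q) (m + single F 1)"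
    by (simp add: mono_diff_add_single[unfolded One_nat_def] lookup_partial)
  also have "\<dots> = (if keys m \<subseteq> P \<and> mdegree m + 1 + mdegree k = rk E - 1
    then (real (lookup m F) + 1) * (of_bool (dhr (m + single F 1 + k)) / ((real (lookup m F) + 1) * efact m)) else 0)"
    unfolding add.IH[OF k] efact_add[OF F] using F by (auto simp: keys_add_nat)
  also have "\<dots> = (if keys m \<subseteq> P \<and> mdegree m + mdegree (k + single F 1) = rk E - 1
    then of_bool (dhr (m + (k + single F 1))) / efact m else 0)"
    by (auto simp: add_ac)
  finally show ?case .
qed (simp add: lookup_Q)

lemma mono_diff_Q_eq_0:
  assumes "keys k \<subseteq> P" "\<And>m. \<not> dhr (m + k)"
  shows "mono_diff k Q = 0"
  by (rule poly_mapping_eqI) (simp add: lookup_mono_diff_Q assms)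

lemma pvars_Q: "pvars Q \<subseteq> P"
  by (simp add: pvars_subset_iff lookup_Q)

lemma homogeneous_Q: "homogeneous (rk E - 1) Q"
  by (auto simp: homogeneous_iff lookup_Q split: if_splits)

lemma not_dhr_overfull:
  assumes "A \<subseteq> P" "keys k \<subseteq> A" "rk (\<Union>A) \<le> mdegree k" "0 < mdegree k"
  shows "\<not> dhr (m + k)"
proof
  assume "dhr (m + k)"
  have "weight k A = mdegree k"
    unfolding weight_def using mdegree_superset assms finite_P finite_subset by metis
  then have "0 < weight (m + k) A" "rk (\<Union>A) \<le> weight (m + k) A"
    using assms by (auto simp: weight_add)
  then show False using dhrD[OF \<open>dhr (m + k)\<close> assms(1)] by simp
qed

text \<open>A flat of rank one violates the condition alone: weight 1 is not below rank 1. So h_F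
  acts as 0 for such \<open>F\<close>, which is the source of the linear relations.\<close>

lemma partial_rank_one_Q: "F \<in> P \<Longrightarrow> rk F = 1 \<Longrightarrow> partial F Q = 0"
  using mono_diff_Q_eq_0[of "single F 1"] not_dhr_overfull[of "{F}" "single F 1"]
    mono_diff_add_single[of 0 F Q] by simp

lemma exchange_Q:
  assumes F: "F \<in> P" and G: "G \<in> P" and Z: "Z = cl (F \<union> G)"
  shows "pdiff ((pvar Z - pvar F) * (pvar Z - pvar G)) Q = 0"
proof -
  have sub: "F \<union> G \<subseteq> E" using F G P_subset_E by blast
  have "F \<noteq> {}" using F by (simp add: P_def)
  then have ZP: "Z \<in> P" unfolding Z using sub by (intro cl_in_P) auto
  have two: "partial A (partial B Q) = mono_diff (single B 1 + single A 1) Q" for A B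
    using mono_diff_add_single[of 0 B Q] mono_diff_add_single[of "single B 1" A Q] by simp
  have "pdiff ((pvar Z - pvar F) * (pvar Z - pvar G)) Q
      = mono_diff (single Z 1 + single Z 1) Q - mono_diff (single G 1 + single Z 1) Q
        - mono_diff (single F 1 + single Z 1) Q + mono_diff (single F 1 + single G 1) Q"
    unfolding pdiff_mult pdiff_diff pdiff_diff_right pdiff_pvar two
    by (simp add: add.commute)
  also have "\<dots> = 0"
  proof (rule poly_mapping_eqI)
    fix m
    have "of_bool (dhr (m + (single Z 1 + single Z 1))) - of_bool (dhr (m + (single G 1 + single Z 1)))
        - of_bool (dhr (m + (single F 1 + single Z 1))) + of_bool (dhr (m + (single F 1 + single G 1))) = (0::real)"
      using dhr_exchange[OF F G Z, of m] by (simp add: add.assoc)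
    then show "lookup (mono_diff (single Z 1 + single Z 1) Q - mono_diff (single G 1 + single Z 1) Q
        - mono_diff (single F 1 + single Z 1) Q + mono_diff (single F 1 + single G 1) Q) m = lookup 0 m"
      using F G ZP
      by (simp add: lookup_add lookup_minus lookup_mono_diff_Q keys_add_nat
          flip: diff_divide_distrib add_divide_distrib)
  qed
  finally show ?thesis .
qed

subsection \<open>Flat variables\<close>

definition coef :: "'a set \<Rightarrow> 'a set \<Rightarrow> real" where
  "coef = (SOME c. \<forall>H. \<forall>F\<in>P. (\<Sum>G | G \<in> P \<and> F \<subseteq> G. c G H) = (if F = H then - 1 else 0))"

text \<open>\<open>xi F\<close> expresses \<open>x_F\<close> in the nef variables; \<open>coef\<close> is minus the Moebius function of the flats.\<close>

definition xi :: "'a set \<Rightarrow> 'a set mpoly" where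
  "xi F = (\<Sum>H\<in>P. pconst (coef F H) * pvar H)"

lemma sum_coef: "F \<in> P \<Longrightarrow> (\<Sum>G | G \<in> P \<and> F \<subseteq> G. coef G H) = (if F = H then - 1 else 0)"
proof -
  have "\<exists>f. \<forall>F\<in>P. (\<Sum>G | G \<in> P \<and> F \<subseteq> G. f G) = (if F = H then - 1 else (0::real))" for H
    by (rule upward_inversion[OF finite_P])
  then obtain f where f: "\<And>H. \<forall>F\<in>P. (\<Sum>G | G \<in> P \<and> F \<subseteq> G. f H G) = (if F = H then - 1 else (0::real))"
    by metis
  have "\<forall>H. \<forall>F\<in>P. (\<Sum>G | G \<in> P \<and> F \<subseteq> G. coef G H) = (if F = H then - 1 else 0)"
    unfolding coef_def by (rule someI[of _ "\<lambda>G H. f H G"]) (use f in blast)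
  then show "F \<in> P \<Longrightarrow> ?thesis" by blast
qed

lemma sum_xi: "F \<in> P \<Longrightarrow> (\<Sum>G | G \<in> P \<and> F \<subseteq> G. xi G) = - pvar F"
proof -
  assume F: "F \<in> P"
  have "(\<Sum>G | G \<in> P \<and> F \<subseteq> G. xi G) = (\<Sum>H\<in>P. pconst (\<Sum>G | G \<in> P \<and> F \<subseteq> G. coef G H) * pvar H)"
    unfolding xi_def by (subst sum.swap) (simp add: pconst_sum sum_distrib_right)
  also have "\<dots> = (\<Sum>H\<in>P. if F = H then - pvar H else 0)"
    using F by (intro sum.cong) (auto simp: sum_coef pconst_uminus)
  also have "\<dots> = - pvar F" using F finite_P by simp
  finally show ?thesis .
qed

text \<open>The upward sums at \<open>F\<close> and \<open>Z\<close> cancel above \<open>Z\<close>.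
  This converts the differences in the exchange relation into flat variables.\<close>

lemma sum_xi_diff:
  assumes F: "F \<in> P" and Z: "Z \<in> P" "F \<subseteq> Z"
  shows "(\<Sum>A | A \<in> P \<and> F \<subseteq> A \<and> \<not> Z \<subseteq> A. xi A) = pvar Z - pvar F"
proof -
  have "{A. A \<in> P \<and> F \<subseteq> A} = {A. A \<in> P \<and> F \<subseteq> A \<and> \<not> Z \<subseteq> A} \<union> {A. A \<in> P \<and> Z \<subseteq> A}"
    using Z by blast
  then have "(\<Sum>A | A \<in> P \<and> F \<subseteq> A. xi A)
      = (\<Sum>A | A \<in> P \<and> F \<subseteq> A \<and> \<not> Z \<subseteq> A. xi A) + (\<Sum>A | A \<in> P \<and> Z \<subseteq> A. xi A)"
    using finite_P by (subst sum.union_disjoint[symmetric]) auto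
  then show ?thesis using sum_xi[OF F] sum_xi[OF Z(1)] by (simp add: algebra_simps)
qed

text \<open>The two differences in the exchange relation expand to flats A above \<open>F\<close>
  and B above \<open>G\<close>, neither above the join. A flat above both \<open>F\<close> and
  \<open>G\<close> contains the join, so A does not contain \<open>G\<close>, B does not contain
  \<open>F\<close>, and A, B are again incomparable. All pairs other than (F, G) are higher and
  vanish by induction from the top, which isolates x_F x_G.\<close>

lemma xi_incomparable:
  assumes "F \<in> P" "G \<in> P" "\<not> F \<subseteq> G" "\<not> G \<subseteq> F"
  shows "pdiff (xi F * xi G) Q = 0"
  using assms
proof (induction "card (E - F) + card (E - G)" arbitrary: F G rule: less_induct)
  case less
  define Z where "Z = cl (F \<union> G)"
  have sub: "F \<union> G \<subseteq> E" using less.prems P_subset_E by blast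
  have "F \<noteq> {}" using less.prems by blast
  then have ZP: "Z \<in> P" unfolding Z_def using sub by (intro cl_in_P) auto
  have FZ: "F \<subseteq> Z" "G \<subseteq> Z" using subset_cl[OF sub] Z_def by blast+
  let ?S = "{A. A \<in> P \<and> F \<subseteq> A \<and> \<not> Z \<subseteq> A}" and ?T = "{A. A \<in> P \<and> G \<subseteq> A \<and> \<not> Z \<subseteq> A}"
  have S: "A \<in> P" "F \<subseteq> A" "\<not> G \<subseteq> A" if "A \<in> ?S" for A
    using that cl_minimal[of A "F \<union> G"] P_flat Z_def by auto
  have T: "A \<in> P" "G \<subseteq> A" "\<not> F \<subseteq> A" if "A \<in> ?T" for A
    using that cl_minimal[of A "F \<union> G"] P_flat Z_def by auto
  have zero: "pdiff (xi A * xi B) Q = 0" if "(A, B) \<in> ?S \<times> ?T - {(F, G)}" for A B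
  proof (rule less.hyps)
    have A: "A \<in> P" "F \<subseteq> A" "\<not> G \<subseteq> A" and B: "B \<in> P" "G \<subseteq> B" "\<not> F \<subseteq> B"
      using that S T by blast+
    then show "A \<in> P" "B \<in> P" "\<not> A \<subseteq> B" "\<not> B \<subseteq> A" by blast+
    have card_less: "card (E - Y) < card (E - X)" if "X \<subseteq> Y" "X \<noteq> Y" "Y \<subseteq> E" for X Y
      by (rule psubset_card_mono) (use that finite_E in auto)
    have "A \<noteq> F \<or> B \<noteq> G" using that by blast
    then show "card (E - A) + card (E - B) < card (E - F) + card (E - G)"
      using card_less[of F A] card_less[of G B] A(2) B(2) P_subset_E[OF A(1)] P_subset_E[OF B(1)]
      by (cases "A = F"; cases "B = G") simp_all
  qed
  have FG: "(F, G) \<in> ?S \<times> ?T" using less.prems FZ by auto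
  have fin: "finite (?S \<times> ?T)" using finite_P by simp
  have "0 = pdiff ((pvar Z - pvar F) * (pvar Z - pvar G)) Q"
    using exchange_Q[OF less.prems(1,2) Z_def] by simp
  also have "\<dots> = (\<Sum>(A, B)\<in>?S \<times> ?T. pdiff (xi A * xi B) Q)"
    unfolding sum_xi_diff[OF less.prems(1) ZP FZ(1), symmetric]
      sum_xi_diff[OF less.prems(2) ZP FZ(2), symmetric]
    by (simp add: sum_product sum.cartesian_product pdiff_sum case_prod_beta)
  also have "\<dots> = pdiff (xi F * xi G) Q + (\<Sum>(A, B)\<in>?S \<times> ?T - {(F, G)}. pdiff (xi A * xi B) Q)"
    using sum.remove[OF fin FG, of "\<lambda>(A, B). pdiff (xi A * xi B) Q"] by simp
  also have "(\<Sum>(A, B)\<in>?S \<times> ?T - {(F, G)}. pdiff (xi A * xi B) Q) = 0"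
    by (rule sum.neutral) (use zero in auto)
  finally show ?case by simp
qed

text \<open>Regrouped by elements a of the ground set: the variables of the flats through a add up
  to minus h of the flat spanned by a, which has rank one and is killed. The term of
  \<open>E\<close> may be added because \<open>l\<close> vanishes on the all-ones vector.\<close>

lemma xi_linear:
  assumes l: "l \<in> linear_functions E"
  shows "pdiff (\<Sum>F\<in>Ln. pconst (l (indicator F)) * xi F) Q = 0"
proof -
  have "l (indicator E) = 0" using l by (simp add: linear_functions_def)
  then have "(\<Sum>F\<in>Ln. pconst (l (indicator F)) * xi F) = (\<Sum>F\<in>P. pconst (l (indicator F)) * xi F)"
    unfolding P_eq using finite_nontrivial_flats by (simp add: nontrivial_flats_def)
  also have "\<dots> = (\<Sum>F\<in>P. \<Sum>a\<in>E. if a \<in> F then pconst (l (indicator {a})) * xi F else 0)"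
  proof (rule sum.cong)
    fix F assume F: "F \<in> P"
    have "pconst (l (indicator F)) * xi F = (\<Sum>a\<in>F. pconst (l (indicator {a})) * xi F)"
      using linear_functions_indicator[OF l] F P_subset_E finite_E finite_subset
      by (metis pconst_sum sum_distrib_right)
    also have "\<dots> = (\<Sum>a\<in>E. if a \<in> F then pconst (l (indicator {a})) * xi F else 0)"
      using P_subset_E[OF F] finite_E by (simp add: sum.If_cases Int_absorb1)
    finally show "pconst (l (indicator F)) * xi F
        = (\<Sum>a\<in>E. if a \<in> F then pconst (l (indicator {a})) * xi F else 0)" .
  qed simp
  also have "\<dots> = (\<Sum>a\<in>E. \<Sum>F\<in>P. if a \<in> F then pconst (l (indicator {a})) * xi F else 0)"
    by (rule sum.swap)
  also have "\<dots> = (\<Sum>a\<in>E. pconst (l (indicator {a})) * - pvar (cl {a}))"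
  proof (rule sum.cong)
    fix a assume a: "a \<in> E"
    have "a \<in> F \<longleftrightarrow> cl {a} \<subseteq> F" if "F \<in> P" for F
      using cl_minimal[of F "{a}"] subset_cl[of "{a}"] a P_flat[OF that] by blast
    then have "{F. F \<in> P \<and> cl {a} \<subseteq> F} = P \<inter> {F. a \<in> F}" by blast
    then have "(\<Sum>F\<in>P \<inter> {F. a \<in> F}. xi F) = - pvar (cl {a})"
      using sum_xi[of "cl {a}"] cl_in_P[of "{a}"] a by simp
    then show "(\<Sum>F\<in>P. if a \<in> F then pconst (l (indicator {a})) * xi F else 0)
        = pconst (l (indicator {a})) * - pvar (cl {a})"
      using finite_P by (simp add: sum.If_cases flip: sum_distrib_left)
  qed simp
  finally have "(\<Sum>F\<in>Ln. pconst (l (indicator F)) * xi F) = (\<Sum>a\<in>E. pconst (l (indicator {a})) * - pvar (cl {a}))" .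
  moreover have "partial (cl {a}) Q = 0" if "a \<in> E" for a
  proof (rule partial_rank_one_Q)
    show "cl {a} \<in> P" using that by (intro cl_in_P) auto
    show "rk (cl {a}) = 1"
      using that rk_cl[of "{a}"] rk_pos[of "{a}"] rk_le_card[of "{a}"] by simp
  qed
  ultimately show ?thesis
    by (simp add: pdiff_sum pdiff_mult pdiff_uminus)
qed

text \<open>Members are indexed by their rank, and \<open>E\<close> is appended at the end so that
  every member of the chain has a successor.\<close>

lemma flag_enumeration:
  assumes C: "C \<in> maximal_cones B"
  obtains f where "f (rk E) = E" "C = f ` {1..<rk E}"
    "\<And>k. k \<in> {1..rk E} \<Longrightarrow> f k \<in> P" "\<And>k. k \<in> {1..rk E} \<Longrightarrow> rk (f k) = k"
    "\<And>j k. j \<in> {1..rk E} \<Longrightarrow> k \<in> {1..rk E} \<Longrightarrow> j \<le> k \<Longrightarrow> f j \<subseteq> f k"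
proof -
  have cone: "C \<in> cones B" using C by (simp add: maximal_cones_def)
  have "\<forall>k\<in>{1..<rk E}. \<exists>F. F \<in> C \<and> rk F = k"
  proof
    fix k assume "k \<in> {1..<rk E}"
    then have k: "0 < k" "k < rk E" by simp_all
    obtain F where "F \<in> C" "rk F = k" by (rule maximal_cone_rk[OF C k])
    then show "\<exists>F. F \<in> C \<and> rk F = k" by blast
  qed
  then obtain g where g: "\<forall>k\<in>{1..<rk E}. g k \<in> C \<and> rk (g k) = k" by (rule bchoice[THEN exE])
  define f where "f k = (if k = rk E then E else g k)" for k
  have fg: "f k \<in> C" "rk (f k) = k" if "k \<in> {1..<rk E}" for k
    using g that by (auto simp: f_def)
  have inC: "F \<in> Ln" if "F \<in> C" for F using cone_subset_Ln[OF cone] that by blast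
  show ?thesis
  proof (rule that)
    show "f (rk E) = E" by (simp add: f_def)
    show "C = f ` {1..<rk E}"
    proof
      show "C \<subseteq> f ` {1..<rk E}"
      proof
        fix F assume F: "F \<in> C"
        then have k: "rk F \<in> {1..<rk E}" using rk_nontrivial[OF inC[OF F]] by simp
        then have "f (rk F) = F"
          by (intro inj_onD[OF cone_inj_rk[OF cone]]) (use fg F in auto)
        then show "F \<in> f ` {1..<rk E}" using k by (metis imageI)
      qed
    qed (use fg in auto)
    have all: "k = rk E \<or> k \<in> {1..<rk E}" if "k \<in> {1..rk E}" for k
      using that by auto
    show fP: "f k \<in> P" if "k \<in> {1..rk E}" for k
      using all[OF that] fg inC by (auto simp: P_eq f_def)
    show frk: "rk (f k) = k" if "k \<in> {1..rk E}" for k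
      using all[OF that] fg by (auto simp: f_def)
    show "f j \<subseteq> f k" if jk: "j \<in> {1..rk E}" "k \<in> {1..rk E}" "j \<le> k" for j k
    proof (cases "k = rk E")
      case True
      then show ?thesis using P_subset_E[OF fP[OF jk(1)]] by (simp add: f_def)
    next
      case False
      then have "f j \<subseteq> f k \<or> f k \<subseteq> f j"
        using jk fg by (intro cone_comparable[OF cone]) auto
      then show ?thesis
        using rk_flat_strict_mono[OF P_flat[OF fP[OF jk(2)]] _ P_subset_E[OF fP[OF jk(1)]]]
          frk[OF jk(1)] frk[OF jk(2)] jk(3) by (auto simp: psubset_eq)
    qed
  qed
qed

text \<open>For a complete flag, \<open>x_{F_k} y = (h_{F_{k+1}} - h_{F_k}) y\<close> with \<open>y\<close> the product of the later flag
  variables. In the expanded product of the differences only the leading term \<open>h_{F_2} \<cdots> h_{F_r}\<close> survives, as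
  \<open>k\<close> factors contained in \<open>F_k\<close> violate the dragon Hall--Rado condition.\<close>

lemma xi_maximal_cone:
  assumes C: "C \<in> maximal_cones B"
  shows "pdiff (\<Prod>F\<in>C. xi F) Q = 1"
proof -
  let ?r = "rk E"
  obtain f where fE: "f ?r = E" and fC: "C = f ` {1..<?r}"
    and fP: "\<And>k. k \<in> {1..?r} \<Longrightarrow> f k \<in> P" and frk: "\<And>k. k \<in> {1..?r} \<Longrightarrow> rk (f k) = k"
    and fmono: "\<And>j k. j \<in> {1..?r} \<Longrightarrow> k \<in> {1..?r} \<Longrightarrow> j \<le> k \<Longrightarrow> f j \<subseteq> f k"
    using flag_enumeration[OF C] by blast
  have inj: "inj_on f {1..?r}" by (rule inj_on_inverseI[of _ rk]) (rule frk)
  \<comment> \<open>\<open>X k\<close> collects the differences that have replaced the variables of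
    the flats of rank below k, \<open>Y k\<close> the flag variables that remain;
    \<open>mm k\<close> is the leading exponent of \<open>X k\<close>.\<close>
  define Y where "Y k = (\<Prod>j\<in>{k..<?r}. xi (f j))" for k
  define X where "X k = (\<Prod>j\<in>{1..<k}. (pvar (f (Suc j)) - pvar (f j)) :: 'a set mpoly)" for k
  define mm where "mm k = (\<Sum>j\<in>{1..<k}. single (f (Suc j)) 1 :: 'a set \<Rightarrow>\<^sub>0 nat)" for k
  have step: "pdiff ((pvar (f (Suc k)) - pvar (f k)) * Y (Suc k)) Q = pdiff (xi (f k) * Y (Suc k)) Q"
    if k: "k \<in> {1..<?r}" for k
  proof -
    have k': "k \<in> {1..?r}" "Suc k \<in> {1..?r}" using k by auto
    let ?S = "{A. A \<in> P \<and> f k \<subseteq> A \<and> \<not> f (Suc k) \<subseteq> A}"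
    have fk: "f k \<in> ?S"
      using fP[OF k'(1)] rk_mono[of "f (Suc k)" "f k"] frk[OF k'(1)] frk[OF k'(2)] by auto
    \<comment> \<open>Any other flat above \<open>f k\<close> and not above \<open>f (Suc k)\<close>
      has rank above k and is not inside \<open>f (Suc k)\<close>, hence is incomparable to
      it.\<close>
    have "pdiff (xi A * Y (Suc k)) Q = 0" if A: "A \<in> ?S - {f k}" for A
    proof -
      have AP: "A \<in> P" "f k \<subset> A" "\<not> f (Suc k) \<subseteq> A" using A by auto
      have "k < rk A"
        using rk_flat_strict_mono[OF P_flat[OF fP[OF k'(1)]] AP(2) P_subset_E[OF AP(1)]] frk[OF k'(1)]
        by simp
      then have nsub: "\<not> A \<subseteq> f (Suc k)"
        using rk_flat_strict_mono[OF P_flat[OF AP(1)] _ P_subset_E[OF fP[OF k'(2)]]] AP(3)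
          frk[OF k'(2)] by (auto simp: psubset_eq)
      \<comment> \<open>For the last index \<open>Y (Suc k)\<close> would be an empty product; that
        case is void, because every flat lies in \<open>E\<close>.\<close>
      then have "Suc k \<noteq> ?r" using fE P_subset_E[OF AP(1)] by auto
      then have "Y (Suc k) = xi (f (Suc k)) * Y (Suc (Suc k))"
        using k unfolding Y_def by (subst prod.atLeast_Suc_lessThan) auto
      then have "xi A * Y (Suc k) = Y (Suc (Suc k)) * (xi A * xi (f (Suc k)))" by (simp add: mult_ac)
      then show ?thesis
        using xi_incomparable[OF AP(1) fP[OF k'(2)] nsub AP(3)] by (simp add: pdiff_mult)
    qed
    then have "(\<Sum>A\<in>?S - {f k}. pdiff (xi A * Y (Suc k)) Q) = 0" by (rule sum.neutral[rule_format])
    moreover have "(\<Sum>A\<in>?S. pdiff (xi A * Y (Suc k)) Q)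
        = pdiff (xi (f k) * Y (Suc k)) Q + (\<Sum>A\<in>?S - {f k}. pdiff (xi A * Y (Suc k)) Q)"
      using fk finite_P by (intro sum.remove) auto
    moreover have "(\<Sum>A\<in>?S. pdiff (xi A * Y (Suc k)) Q)
        = pdiff ((pvar (f (Suc k)) - pvar (f k)) * Y (Suc k)) Q"
      unfolding sum_xi_diff[OF fP[OF k'(1)] fP[OF k'(2)] fmono[OF k' le_SucI[OF order_refl]], symmetric]
      by (simp only: sum_distrib_right pdiff_sum)
    ultimately show ?thesis by simp
  qed
  have flag: "pdiff (X k * Y k) Q = pdiff (Y 1) Q" if "k \<in> {1..?r}" for k
    using that
  proof (induction k)
    case (Suc k)
    show ?case
    proof (cases "k = 0")
      case False
      then have k: "k \<in> {1..<?r}" using Suc.prems by simp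
      have "X (Suc k) * Y (Suc k) = X k * ((pvar (f (Suc k)) - pvar (f k)) * Y (Suc k))"
        using k unfolding X_def by (simp add: mult_ac)
      then have "pdiff (X (Suc k) * Y (Suc k)) Q = pdiff (X k * (xi (f k) * Y (Suc k))) Q"
        using step[OF k] by (simp add: pdiff_mult)
      also have "xi (f k) * Y (Suc k) = Y k"
        using k unfolding Y_def by (subst (2) prod.atLeast_Suc_lessThan) auto
      finally show ?thesis using Suc k by simp
    qed (simp add: X_def)
  qed simp
  have keys_mm: "keys (mm k) \<subseteq> f ` {1..k}" for k
    unfolding mm_def by (induction k) (auto simp: keys_add_nat)
  have deg_mm: "mdegree (mm k) = k - 1" for k
    unfolding mm_def by (induction k) auto
  have mono: "pdiff (X k) Q = mono_diff (mm k) Q" if "k \<in> {1..?r}" for k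
    using that
  proof (induction k)
    case (Suc k)
    show ?case
    proof (cases "k = 0")
      case False
      then have k: "k \<in> {1..?r}" using Suc.prems by simp
      have sub: "f ` {1..k} \<subseteq> P" using k fP by auto
      have "\<Union>(f ` {1..k}) = f k" using k fmono by fastforce
      \<comment> \<open>\<open>mm k\<close> supplies k - 1 factors inside \<open>f k\<close>; one
        more factor \<open>f k\<close> makes k of them inside a flat of rank k, one too
        many.\<close>
      then have over: "\<not> dhr (m + (mm k + single (f k) 1))" for m
        using keys_mm[of k] k frk[OF k] deg_mm[of k]
        by (intro not_dhr_overfull[OF sub]) (auto simp: keys_add_nat)
      have X: "X (Suc k) = (pvar (f (Suc k)) - pvar (f k)) * X k"
        using k unfolding X_def by (simp add: mult_ac)
      have "pdiff (X (Suc k)) Q = partial (f (Suc k)) (mono_diff (mm k) Q) - partial (f k) (mono_diff (mm k) Q)"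
        unfolding X using Suc.IH[OF k] by (simp add: pdiff_mult pdiff_diff)
      also have "partial (f k) (mono_diff (mm k) Q) = 0"
        using mono_diff_Q_eq_0[OF _ over] keys_mm[of k] sub fP[OF k]
        by (simp add: keys_add_nat flip: mono_diff_add_single)
      also have "partial (f (Suc k)) (mono_diff (mm k) Q) = mono_diff (mm (Suc k)) Q"
        using k unfolding mm_def by (simp flip: mono_diff_add_single)
      finally show ?thesis by simp
    qed (simp add: X_def mm_def)
  qed simp
  have "dhr (mm ?r)"
    unfolding dhr_def
  proof (intro allI impI)
    fix A assume A: "A \<subseteq> P" "0 < weight (mm ?r) A"
    let ?J = "{j \<in> {1..<?r}. f (Suc j) \<in> A}"
    have "weight (mm ?r) A = (\<Sum>j\<in>{1..<?r}. \<Sum>F\<in>A. lookup (single (f (Suc j)) 1) F)"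
      unfolding weight_def mm_def lookup_sum by (rule sum.swap)
    also have "\<dots> = (\<Sum>j\<in>{1..<?r}. if f (Suc j) \<in> A then 1 else 0)"
      using weight_single[OF A(1)] by (intro sum.cong refl) (simp add: weight_def)
    also have "\<dots> = card ?J" by (simp add: sum.If_cases Int_def conj_commute)
    finally have w: "weight (mm ?r) A = card ?J" .
    then have ne: "?J \<noteq> {}" using A(2) by (metis card.empty less_irrefl)
    have fin: "finite ?J" by simp
    \<comment> \<open>The flats of \<open>mm ?r\<close> have ranks 2 to r, each occurring once. If
      the largest one in \<open>A\<close> has rank j + 1, at most j of them are counted.\<close>
    let ?j = "Max ?J"
    have j: "?j \<in> ?J" using fin ne by (rule Max_in)
    have "card ?J \<le> card {1..?j}" using fin by (intro card_mono) auto
    moreover have "?j + 1 = rk (f (Suc ?j))" using j frk[of "Suc ?j"] by simp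
    moreover have "rk (f (Suc ?j)) \<le> rk (\<Union>A)" using j by (intro rk_mono) blast
    ultimately show "weight (mm ?r) A < rk (\<Union>A)" using w by simp
  qed
  moreover have "keys (mm ?r) \<subseteq> P" using keys_mm[of ?r] fP by (force)
  \<comment> \<open>The exponent has the full degree r - 1, so only the constant coefficient is
    left, and \<open>efact 0\<close> is 1.\<close>
  ultimately have "mono_diff (mm ?r) Q = 1"
    by (intro poly_mapping_eqI)
      (auto simp: lookup_mono_diff_Q deg_mm lookup_one when_def efact_def)
  moreover have "pdiff (X ?r * Y ?r) Q = pdiff (X ?r) Q" by (simp add: Y_def)
  ultimately have "pdiff (Y 1) Q = 1"
    using flag[of ?r] mono[of ?r] rk_E_pos by simp
  moreover have "(\<Prod>F\<in>C. xi F) = Y 1"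
    unfolding fC Y_def using inj by (subst prod.reindex) (auto intro: inj_on_subset)
  ultimately show ?thesis by simp
qed

subsection \<open>Existence of the degree map\<close>

text \<open>The coefficient of h_H when the general divisor, the sum of the ray classes with
  coefficients x_F, is rewritten in nef classes. The sum runs over nontrivial flats since
  \<open>E\<close> carries no ray.\<close>

definition nef :: "'a set \<Rightarrow> 'a set mpoly" where
  "nef H = (\<Sum>F\<in>Ln. pconst (coef F H) * pvar F)"

definition W :: "'a set mpoly" where
  "W = psubst nef Q"

lemma pvars_nef: "pvars (nef H) \<subseteq> Ln"
  unfolding nef_def by (intro pvars_sum pvars_mult) auto

lemma pvars_xi: "pvars p \<subseteq> P \<Longrightarrow> pvars (pdiff (xi F) p) \<subseteq> P"
  unfolding xi_def by (simp add: pdiff_sum pdiff_mult pvars_sum pvars_mult pvars_partial)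

text \<open>Rows and columns of one matrix: \<open>xi\<close> sums \<open>coef\<close> over
  \<open>H\<close> and \<open>nef\<close> over \<open>F\<close>, so the chain rule turns the
  derivative along x_F into the operator \<open>xi F\<close>.\<close>

lemma partial_nef:
  assumes F: "F \<in> Ln" and p: "pvars p \<subseteq> P"
  shows "partial F (psubst nef p) = psubst nef (pdiff (xi F) p)"
proof -
  have "partial F (nef H) = pconst (coef F H)" for H
  proof -
    have "partial F (nef H) = (\<Sum>G\<in>Ln. if F = G then pconst (coef G H) else 0)"
      unfolding nef_def partial_sum partial_pconst_mult partial_pvar by (rule sum.cong) auto
    then show ?thesis using F finite_nontrivial_flats by simp
  qed
  then show ?thesis
    unfolding partial_psubst[OF finite_P p]
    by (simp add: xi_def pdiff_sum pdiff_mult psubst_sum psubst_mult)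
qed

lemma pdiff_prod_W:
  assumes "C \<subseteq> Ln"
  shows "pdiff (\<Prod>F\<in>C. pvar F) W = psubst nef (pdiff (\<Prod>F\<in>C. xi F) Q)"
  unfolding W_def
  by (rule pdiff_prod_psubst[OF finite_subset[OF assms finite_nontrivial_flats] pvars_Q])
    (use assms partial_nef pvars_xi in blast)

lemma W_form: "W \<in> forms B (rk E - 1)"
proof -
  have "pvars W \<subseteq> Ln" unfolding W_def by (rule pvars_psubst) (rule pvars_nef)
  moreover have "homogeneous 1 (nef H)" for H
    unfolding nef_def by (intro homogeneous_sum homogeneous_pconst_mult) simp
  then have "homogeneous (rk E - 1) W"
    unfolding W_def by (intro homogeneous_psubst homogeneous_Q)
  ultimately show ?thesis by (simp add: bergman.forms_iff) (simp add: bergman_fan_def)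
qed

lemma W_incomparable:
  assumes "F \<in> Ln" "G \<in> Ln" "\<not> F \<subseteq> G" "\<not> G \<subseteq> F"
  shows "partial F (partial G W) = 0"
proof -
  have "F \<noteq> G" using assms by blast
  then show ?thesis
    using pdiff_prod_W[of "{F, G}"] xi_incomparable[of F G] assms Ln_subset_P by (simp add: pdiff_mult)
qed

lemma W_linear:
  assumes l: "l \<in> linear_functions E"
  shows "(\<Sum>F\<in>Ln. pconst (l (indicator F)) * partial F W) = 0"
proof -
  have "(\<Sum>F\<in>Ln. pconst (l (indicator F)) * partial F W)
      = psubst nef (pdiff (\<Sum>F\<in>Ln. pconst (l (indicator F)) * xi F) Q)"
    unfolding W_def by (simp add: partial_nef pvars_Q pdiff_sum pdiff_mult psubst_sum psubst_mult)
  then show ?thesis by (simp add: xi_linear[OF l])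
qed

lemma W_maximal_cone:
  assumes "C \<in> maximal_cones B"
  shows "pdiff (\<Prod>F\<in>C. pvar F) W = 1"
proof -
  have "C \<subseteq> Ln" using assms cone_subset_Ln by (simp add: maximal_cones_def)
  then show ?thesis by (simp add: pdiff_prod_W xi_maximal_cone[OF assms])
qed

lemma matroid_volume_eq: "matroid_volume N = W"
  unfolding matroid_volume_def
proof (rule bergman.mixed_volume_eqI)
  show "W \<in> forms B (fan_dim B)" unfolding fan_dim_bergman by (rule W_form)
  show "pdiff (\<Prod>\<rho>\<in>C. pvar \<rho>) W = 0" if C: "C \<subseteq> rays B" "\<not> (\<exists>\<sigma>\<in>cones B. C \<subseteq> \<sigma>)" for C
  proof -
    have CLn: "C \<subseteq> Ln" using C by (simp add: bergman_fan_def)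
    then have fin: "finite C" using finite_nontrivial_flats finite_subset by blast
    have "C \<notin> cones B" using C by blast
    then obtain F G where FG: "F \<in> C" "G \<in> C" "\<not> F \<subseteq> G" "\<not> G \<subseteq> F"
      using CLn by (auto simp: cone_iff subset_chain_def)
    have G: "G \<in> C - {F}" using FG by blast
    have "(\<Prod>\<rho>\<in>C. pvar \<rho>) = (\<Prod>\<rho>\<in>C - {F} - {G}. pvar \<rho>) * (pvar F * pvar G :: 'a set mpoly)"
      using prod.remove[OF fin FG(1), of "pvar :: 'a set \<Rightarrow> 'a set mpoly"]
        prod.remove[OF _ G, of "pvar :: 'a set \<Rightarrow> 'a set mpoly"] fin by (simp add: mult_ac)
    then show ?thesis
      using W_incomparable[of F G] FG CLn by (simp add: pdiff_mult subset_iff)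
  qed
  show "(\<Sum>\<rho>\<in>rays B. pconst (l (ray_vec B \<rho>)) * partial \<rho> W) = 0"
    if "l \<in> linear_functions (ambient B)" for l
    using W_linear[of l] that by (simp add: bergman_fan_def)
  show "pdiff (\<Prod>\<rho>\<in>\<sigma>. pvar \<rho>) W = 1" if "\<sigma> \<in> maximal_cones B" for \<sigma>
    using that by (rule W_maximal_cone)
qed

lemma pvars_matroid_volume: "pvars (matroid_volume N) \<subseteq> Ln"
  using W_form by (simp add: matroid_volume_eq bergman.forms_iff) (simp add: bergman_fan_def)

lemma homogeneous_matroid_volume: "homogeneous (rk E - 1) (matroid_volume N)"
  using W_form by (simp add: matroid_volume_eq bergman.forms_iff)

lemmas matroid_volume_incomparable = W_incomparable[folded matroid_volume_eq]
lemmas matroid_volume_linear = W_linear[folded matroid_volume_eq]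
lemmas matroid_volume_maximal_cone = W_maximal_cone[folded matroid_volume_eq]

end

section \<open>Integration along a line\<close>

text \<open>\<open>r\<close> renames the flats of the deletion to rays and \<open>v\<close> is a
  pole of the suspension; the two integrals of the theorem are instances with opposite
  \<open>c\<close>.\<close>

locale line_substitution =
  fixes S :: "'v set" and r :: "'v \<Rightarrow> 'w" and v :: 'w and c :: "'v \<Rightarrow> real"
  assumes finite_S: "finite S" and inj_r: "inj_on r S" and v_new: "v \<notin> r ` S"
begin

definition s :: "'v \<Rightarrow> 'w mpoly" where
  "s x = pvar (r x) + pconst (c x) * pvar v"

definition I :: "'v mpoly \<Rightarrow> 'w mpoly" where
  "I p = antideriv v (psubst s p)"

lemma partial_s: "partial u (s x) = (if u = r x then 1 else 0) + pconst (c x) * (if u = v then 1 else 0)"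
  unfolding s_def partial_add partial_pconst_mult partial_pvar by simp

lemma partial_r_psubst:
  assumes x: "x \<in> S" and p: "pvars p \<subseteq> S"
  shows "partial (r x) (psubst s p) = psubst s (partial x p)"
proof -
  have "partial (r x) (psubst s p) = (\<Sum>y\<in>S. if x = y then psubst s (partial y p) else 0)"
    unfolding partial_psubst[OF finite_S p] partial_s
    by (rule sum.cong) (use x v_new inj_onD[OF inj_r] in auto)
  then show ?thesis using x finite_S by simp
qed

lemma partial_v_psubst:
  assumes p: "pvars p \<subseteq> S"
  shows "partial v (psubst s p) = psubst s (\<Sum>x\<in>S. pconst (c x) * partial x p)"
  unfolding partial_psubst[OF finite_S p] partial_s psubst_sum
  by (rule sum.cong) (use v_new in \<open>auto simp: psubst_mult\<close>)

lemma partial_other_psubst: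
  assumes p: "pvars p \<subseteq> S" and u: "u \<noteq> v" "u \<notin> r ` S"
  shows "partial u (psubst s p) = 0"
  unfolding partial_psubst[OF finite_S p] partial_s
  by (rule sum.neutral) (use u in auto)

lemma pdiff_prod_r_psubst:
  assumes C: "C \<subseteq> S" and p: "pvars p \<subseteq> S"
  shows "pdiff (\<Prod>\<rho>\<in>r ` C. pvar \<rho>) (psubst s p) = psubst s (pdiff (\<Prod>x\<in>C. pvar x) p)"
proof -
  have "inj_on r C" using inj_r C inj_on_subset by blast
  then have "(\<Prod>\<rho>\<in>r ` C. pvar (the_inv_into S r \<rho>)) = (\<Prod>x\<in>C. pvar x :: 'v mpoly)"
    using C by (subst prod.reindex) (auto intro!: prod.cong simp: the_inv_into_f_f[OF inj_r])
  moreover have "pdiff (\<Prod>\<rho>\<in>r ` C. pvar \<rho>) (psubst s p)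
      = psubst s (pdiff (\<Prod>\<rho>\<in>r ` C. pvar (the_inv_into S r \<rho>)) p)"
  proof (rule pdiff_prod_psubst[OF _ p])
    show "finite (r ` C)" using C finite_S finite_subset by blast
    fix \<rho> q assume \<rho>: "\<rho> \<in> r ` C" and q: "pvars q \<subseteq> S"
    then obtain x where x: "\<rho> = r x" "x \<in> S" using C by blast
    then show "partial \<rho> (psubst s q) = psubst s (pdiff (pvar (the_inv_into S r \<rho>)) q) \<and>
        pvars (pdiff (pvar (the_inv_into S r \<rho>)) q) \<subseteq> S"
      using partial_r_psubst[OF x(2) q] pvars_partial[OF q] by (simp add: the_inv_into_f_f[OF inj_r])
  qed
  ultimately show ?thesis by simp
qed

lemma partial_r_I:
  assumes "x \<in> S" "pvars p \<subseteq> S"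
  shows "partial (r x) (I p) = I (partial x p)"
proof -
  have "r x \<noteq> v" using v_new assms by blast
  then show ?thesis
    unfolding I_def by (simp add: partial_antideriv_other partial_r_psubst[OF assms])
qed

lemma partial_v_I: "partial v (I p) = psubst s p"
  by (simp add: I_def partial_antideriv)

lemma partial_other_I:
  assumes "pvars p \<subseteq> S" "u \<noteq> v" "u \<notin> r ` S"
  shows "partial u (I p) = 0"
  unfolding I_def using assms by (simp add: partial_antideriv_other partial_other_psubst)

lemma sum_partial_r_I:
  assumes p: "pvars p \<subseteq> S"
  shows "(\<Sum>x\<in>S. pconst (e x) * partial (r x) (I p)) = I (\<Sum>x\<in>S. pconst (e x) * partial x p)"
proof -
  have "I (\<Sum>x\<in>S. pconst (e x) * partial x p) = (\<Sum>x\<in>S. pconst (e x) * I (partial x p))"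
    unfolding I_def psubst_sum antideriv_sum psubst_mult psubst_pconst antideriv_pconst_mult ..
  then show ?thesis using p by (simp add: partial_r_I)
qed

text \<open>The derivative of the substituted polynomial along \<open>v\<close> is the derivative in
  the direction \<open>c\<close>. Integrating it back loses the value at \<open>v = 0\<close>, where
  the substitution is mere renaming.\<close>

lemma fundamental_theorem:
  assumes p: "pvars p \<subseteq> S"
  shows "(\<Sum>x\<in>S. pconst (c x) * partial (r x) (I p)) = psubst s p - psubst (\<lambda>x. pvar (r x)) p"
proof -
  have "(\<Sum>x\<in>S. pconst (c x) * partial (r x) (I p)) = antideriv v (partial v (psubst s p))"
    by (simp only: sum_partial_r_I[OF p]) (simp only: I_def partial_v_psubst[OF p])
  also have "\<dots> = psubst s p - psubst (\<lambda>x. psubst (\<lambda>w. if w = v then 0 else pvar w) (s x)) p"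
    unfolding antideriv_partial psubst_psubst ..
  also have "psubst (\<lambda>x. psubst (\<lambda>w. if w = v then 0 else pvar w) (s x)) p = psubst (\<lambda>x. pvar (r x)) p"
    by (rule psubst_cong) (use p v_new in \<open>auto simp: s_def psubst_add psubst_mult\<close>)
  finally show ?thesis .
qed

lemma I_form:
  assumes "pvars p \<subseteq> S" "homogeneous n p"
  shows "pvars (I p) \<subseteq> insert v (r ` S)" "homogeneous (Suc n) (I p)"
proof -
  have "pvars (s x) \<subseteq> insert v (r ` S)" if "x \<in> S" for x
    unfolding s_def using that by (intro pvars_add pvars_mult) auto
  then show "pvars (I p) \<subseteq> insert v (r ` S)"
    unfolding I_def using assms(1) by (intro pvars_antideriv pvars_psubst) auto
  have "homogeneous 1 (s x)" for x
    unfolding s_def by (intro homogeneous_add homogeneous_pconst_mult) simp_all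
  then show "homogeneous (Suc n) (I p)"
    unfolding I_def using assms(2) by (intro homogeneous_antideriv homogeneous_psubst)
qed

end

section \<open>Deleting a coloop\<close>

lemma deletion_is_matroid: "is_matroid M \<Longrightarrow> is_matroid (deletion M i)"
proof -
  assume "is_matroid M"
  then interpret finite_matroid M by unfold_locales
  show ?thesis
    unfolding is_matroid_def
  proof (intro conjI ballI allI impI)
    fix X Y assume *: "X \<in> indep (deletion M i)" "Y \<in> indep (deletion M i)" "card X < card Y"
    then obtain y where "y \<in> Y - X" "insert y X \<in> indep M"
      using indep_augment[of X Y] by (auto simp: deletion_def)
    then show "\<exists>y\<in>Y - X. insert y X \<in> indep (deletion M i)"
      using * by (auto simp: deletion_def)
  next
    fix X Y assume "X \<in> indep (deletion M i)" "Y \<subseteq> X"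
    then show "Y \<in> indep (deletion M i)" using indep_mono by (auto simp: deletion_def)
  qed (use finite_E indep_subset_E indep_empty in \<open>auto simp: deletion_def\<close>)
qed

lemma rank_in_deletion: "rank_in (deletion M i) X = rank_in M (X - {i})"
proof -
  have "{I \<in> indep (deletion M i). I \<subseteq> X} = {I \<in> indep M. I \<subseteq> X - {i}}"
    by (auto simp: deletion_def)
  then show ?thesis by (simp add: rank_in_def)
qed

lemma ground_deletion [simp]: "ground (deletion M i) = ground M - {i}"
  by (simp add: deletion_def)

text \<open>The rank bound gives the deletion positive rank, so that {i} and E - i are nontrivial
  flats.\<close>

locale loopless_coloop = M: finite_matroid M
  for M :: "'a matroid" and i :: 'a +
  assumes coloop: "coloop M i" and i_flat: "{i} \<in> flats M" and rank_ge_2: "2 \<le> mrank M"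
begin

abbreviation "N \<equiv> deletion M i"
abbreviation "E0 \<equiv> ground M - {i}"

lemma i_in_E: "i \<in> ground M"
  using coloop by (simp add: coloop_def)

text \<open>Dropping a coloop lowers the rank of the ground set, so every basis contains it, in
  particular one that extends \<open>I\<close>.\<close>

lemma indep_insert_i:
  assumes I: "I \<in> indep M"
  shows "insert i I \<in> indep M"
proof -
  obtain B where B: "B \<in> indep M" "I \<subseteq> B" "B \<subseteq> ground M" "card B = rank_in M (ground M)"
    by (rule M.extend_to_basis[OF I M.indep_subset_E[OF I]])
  have "i \<in> B"
  proof (rule ccontr)
    assume "i \<notin> B"
    then have "card B \<le> rank_in M E0" using B by (intro M.card_le_rk) auto
    then show False
      using coloop B by (simp add: coloop_def mrank_def rank_in_deletion)
  qed
  then show ?thesis using B M.indep_mono[of B "insert i I"] by blast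
qed

lemma rank_M: "rank_in M X = rank_in M (X - {i}) + (if i \<in> X then 1 else 0)"
proof (cases "i \<in> X")
  case True
  obtain I where I: "I \<in> indep M" "I \<subseteq> X - {i}" "card I = rank_in M (X - {i})"
    by (rule M.rk_basis)
  have "card (insert i I) \<le> rank_in M X"
    using I True by (intro M.card_le_rk indep_insert_i) auto
  moreover have "card (insert i I) = card I + 1"
    using I M.indep_finite by (subst card_insert_disjoint) auto
  moreover have "insert i (X - {i}) = X" using True by blast
  ultimately show ?thesis using M.rk_insert_le[of i "X - {i}"] I True by simp
qed simp

text \<open>Adding \<open>i\<close>, when it is absent, always raises the rank; for any other
  element the rank jump is the same with and without \<open>i\<close>.\<close>

lemma flats_M_iff: "F \<in> flats M \<longleftrightarrow> F \<subseteq> ground M \<and> F - {i} \<in> flats N"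
proof -
  interpret N: finite_matroid N
    by unfold_locales (rule deletion_is_matroid[OF M.is_matroid])
  have other: "rank_in M F < rank_in M (insert e F) \<longleftrightarrow>
      rank_in N (F - {i}) < rank_in N (insert e (F - {i}))" if "e \<noteq> i" for e
    using rank_M[of F] rank_M[of "insert e F"] that
    by (simp add: rank_in_deletion insert_Diff_if)
  have coloop: "rank_in M F < rank_in M (insert i F)" if "i \<notin> F"
    using rank_M[of "insert i F"] that by simp
  have "(\<forall>e\<in>ground M - F. rank_in M F < rank_in M (insert e F)) \<longleftrightarrow>
      (\<forall>e\<in>ground N - (F - {i}). rank_in N (F - {i}) < rank_in N (insert e (F - {i})))"
  proof (intro iffI ballI)
    fix e assume *: "\<forall>e\<in>ground M - F. rank_in M F < rank_in M (insert e F)" "e \<in> ground N - (F - {i})"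
    then have "e \<noteq> i" "e \<in> ground M - F" by auto
    then show "rank_in N (F - {i}) < rank_in N (insert e (F - {i}))" using *(1) other by blast
  next
    fix e assume *: "\<forall>e\<in>ground N - (F - {i}). rank_in N (F - {i}) < rank_in N (insert e (F - {i}))"
      "e \<in> ground M - F"
    show "rank_in M F < rank_in M (insert e F)"
    proof (cases "e = i")
      case False
      then have "e \<in> ground N - (F - {i})" using *(2) by auto
      then show ?thesis using *(1) other[OF False] by blast
    qed (use coloop * in blast)
  qed
  then show ?thesis unfolding M.flats_iff N.flats_iff by auto
qed

lemma rank_N: "rank_in N (ground N) + 1 = mrank M"
  using rank_M[of "ground M"] i_in_E by (simp add: mrank_def rank_in_deletion)

sublocale N: positive_rank_matroid N
proof unfold_locales
  show "is_matroid N" by (rule deletion_is_matroid[OF M.is_matroid])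
  show "{} \<in> flats N" using i_flat by (simp add: flats_M_iff)
  show "0 < rank_in N (ground N)" using rank_N rank_ge_2 by simp
qed

lemma E0_nonempty: "E0 \<noteq> {}"
  using N.rk_E_pos by (metis N.rk_empty ground_deletion less_irrefl)

lemma Ln_iff: "G \<in> N.Ln \<longleftrightarrow> G \<in> flats N \<and> G \<noteq> {} \<and> G \<noteq> E0"
  by (simp add: nontrivial_flats_def)

lemma Ln_not_i: "G \<in> N.Ln \<Longrightarrow> i \<notin> G"
  using N.flat_subset_E[of G] by (auto simp: Ln_iff)

lemma nontrivial_flats_M:
  "nontrivial_flats M = insert {i} (insert E0 (N.Ln \<union> insert i ` N.Ln))"
proof (intro Set.set_eqI iffI)
  fix F assume F: "F \<in> nontrivial_flats M"
  then have F': "F \<subseteq> ground M" "F - {i} \<in> flats N" "F \<noteq> {}" "F \<noteq> ground M"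
    by (auto simp: nontrivial_flats_def flats_M_iff)
  consider "F - {i} = {}" | "F - {i} = E0" | "F - {i} \<in> N.Ln" using F'(2) by (auto simp: Ln_iff)
  then show "F \<in> insert {i} (insert E0 (N.Ln \<union> insert i ` N.Ln))"
  proof cases
    case 1
    then have "F = {i}" using F'(3) by blast
    then show ?thesis by simp
  next
    case 2
    then have "F = E0" using F'(1,4) by blast
    then show ?thesis by simp
  next
    case 3
    show ?thesis
    proof (cases "i \<in> F")
      case True
      then have "F = insert i (F - {i})" by blast
      then show ?thesis using 3 by blast
    qed (use 3 in simp)
  qed
next
  fix F assume "F \<in> insert {i} (insert E0 (N.Ln \<union> insert i ` N.Ln))"
  then consider "F = {i}" | "F = E0" | "F \<in> N.Ln" | G where "F = insert i G" "G \<in> N.Ln" by blast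
  then show "F \<in> nontrivial_flats M"
  proof cases
    case 1
    then show ?thesis using i_flat E0_nonempty by (auto simp: nontrivial_flats_def)
  next
    case 2
    then show ?thesis
      using N.E_flat E0_nonempty i_in_E by (auto simp: nontrivial_flats_def flats_M_iff)
  next
    case 3
    then have "F \<in> flats N" "F \<noteq> {}" "F \<subseteq> E0" "i \<notin> F"
      using Ln_not_i N.flat_subset_E by (auto simp: Ln_iff)
    then show ?thesis using i_in_E by (auto simp: nontrivial_flats_def flats_M_iff)
  next
    case 4
    then have "G \<in> flats N" "G \<noteq> E0" "G \<subseteq> E0" "i \<notin> G"
      using Ln_not_i N.flat_subset_E by (auto simp: Ln_iff)
    then show ?thesis using 4 i_in_E by (auto simp: nontrivial_flats_def flats_M_iff)
  qed
qed

lemma S_set_eq: "S_set M i = N.Ln"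
proof (intro Set.set_eqI iffI)
  fix F assume "F \<in> S_set M i"
  then have F: "F \<in> nontrivial_flats M" "insert i F \<in> nontrivial_flats M" "i \<notin> F"
    by (auto simp: S_set_def)
  \<comment> \<open>\<open>E0\<close> is ruled out because adjoining \<open>i\<close> gives the
    whole ground set, a trivial flat; {i} is ruled out because it contains \<open>i\<close>.\<close>
  then have "F \<noteq> E0" using i_in_E by (auto simp: nontrivial_flats_def insert_absorb)
  then show "F \<in> N.Ln" using F(1,3) unfolding nontrivial_flats_M by blast
next
  fix F assume "F \<in> N.Ln"
  then show "F \<in> S_set M i" using Ln_not_i[of F] by (auto simp: S_set_def nontrivial_flats_M)
qed

text \<open>A flat of the deletion is already closed in \<open>M\<close>, so the closures in the
  theorem disappear.\<close>

lemma closure_Ln: "G \<in> N.Ln \<Longrightarrow> mclosure M G = G"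
proof -
  assume "G \<in> N.Ln"
  then have "G \<in> nontrivial_flats M" by (simp add: nontrivial_flats_M)
  then show ?thesis by (simp add: nontrivial_flats_def flats_def)
qed

end

section \<open>The fan obtained by identifying all pairs\<close>

locale coloop_fan = loopless_coloop +
  fixes Fs :: "nat \<Rightarrow> 'a set" and k :: nat
  assumes bij: "bij_betw Fs {1..k} (S_set M i)"
begin

abbreviation "cls \<equiv> ray_class M i Fs k"
definition pair :: "'a set \<Rightarrow> 'a set set" where
  "pair G = {G, insert i G}"

abbreviation "ri \<equiv> {{i}}"
abbreviation "re \<equiv> {E0}"
abbreviation "D \<equiv> delta_fan M i Fs k"

lemma ident_rel_iff: "(A, B) \<in> ident_rel M i Fs k \<longleftrightarrow> A \<in> nontrivial_flats M \<and> B \<in> nontrivial_flats M \<and>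
    (A = B \<or> (\<exists>G\<in>N.Ln. {A, B} = pair G))"
proof -
  have "Fs ` {1..k} = N.Ln" using bij by (simp add: bij_betw_def S_set_eq)
  then have "(\<exists>l\<in>{1..k}. {A, B} = pair (Fs l)) \<longleftrightarrow> (\<exists>G\<in>N.Ln. {A, B} = pair G)"
    by (simp only: bex_simps flip: \<open>Fs ` {1..k} = N.Ln\<close>)
  then show ?thesis unfolding ident_rel_def by (simp add: pair_def)
qed

lemma cls_Ln: "G \<in> N.Ln \<Longrightarrow> cls G = pair G" and cls_insert: "G \<in> N.Ln \<Longrightarrow> cls (insert i G) = pair G"
proof -
  assume G: "G \<in> N.Ln"
  have flats: "G \<in> nontrivial_flats M" "insert i G \<in> nontrivial_flats M"
    using G by (auto simp: nontrivial_flats_M)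
  have "{G, B} = pair H \<longleftrightarrow> G = H \<and> B = insert i G" if "H \<in> N.Ln" for B H
    using Ln_not_i[OF G] by (auto simp: pair_def doubleton_eq_iff)
  then show "cls G = pair G"
    unfolding ray_class_def using G flats by (auto simp: ident_rel_iff pair_def doubleton_eq_iff)
  have "{insert i G, B} = pair H \<longleftrightarrow> G = H \<and> B = G" if "H \<in> N.Ln" for B H
    using Ln_not_i[OF G] Ln_not_i[OF that] by (auto simp: pair_def doubleton_eq_iff)
  then show "cls (insert i G) = pair G"
    unfolding ray_class_def using G flats by (auto simp: ident_rel_iff pair_def doubleton_eq_iff)
qed

lemma cls_eq_singleton:
  assumes F: "F \<in> nontrivial_flats M" and no: "\<And>G B. G \<in> N.Ln \<Longrightarrow> {F, B} \<noteq> pair G"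
  shows "cls F = {F}"
proof -
  have "(F, B) \<in> ident_rel M i Fs k \<longleftrightarrow> B = F" for B
    unfolding ident_rel_iff using F no[of _ B] by (metis (no_types))
  then show ?thesis by (simp add: ray_class_def Image_singleton)
qed

lemma cls_i: "cls {i} = ri"
proof (rule cls_eq_singleton)
  show "{{i}, B} \<noteq> pair G" if "G \<in> N.Ln" for B G
    using Ln_not_i[OF that] that by (auto simp: pair_def doubleton_eq_iff Ln_iff)
qed (simp add: nontrivial_flats_M)

lemma cls_E0: "cls E0 = re"
proof (rule cls_eq_singleton)
  show "{E0, B} \<noteq> pair G" if "G \<in> N.Ln" for B G
    using that by (auto simp: pair_def doubleton_eq_iff Ln_iff)
qed (simp add: nontrivial_flats_M)

lemma rays_D: "rays D = insert ri (insert re (pair ` N.Ln))"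
proof -
  have "rays D = cls ` nontrivial_flats M"
    by (auto simp: delta_fan_def quotient_def ray_class_def)
  also have "\<dots> = insert ri (insert re (cls ` N.Ln \<union> (\<lambda>G. cls (insert i G)) ` N.Ln))"
    by (simp add: nontrivial_flats_M image_Un image_image cls_i cls_E0)
  also have "cls ` N.Ln = pair ` N.Ln" by (rule image_cong) (simp_all add: cls_Ln)
  also have "(\<lambda>G. cls (insert i G)) ` N.Ln = pair ` N.Ln" by (rule image_cong) (simp_all add: cls_insert)
  finally show ?thesis by simp
qed

lemma inj_pair: "inj_on pair N.Ln"
  using Ln_not_i by (auto intro!: inj_onI simp: pair_def doubleton_eq_iff)

text \<open>The classes are told apart by size: a pair has two members, the class of a pole only
  one.\<close>

lemma pair_distinct: "ri \<noteq> re" "ri \<notin> pair ` N.Ln" "re \<notin> pair ` N.Ln"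
proof -
  have "card (pair G) = 2" if "G \<in> N.Ln" for G
  proof -
    have "G \<noteq> insert i G" using Ln_not_i[OF that] by blast
    then show ?thesis by (simp add: pair_def)
  qed
  then have "\<forall>\<rho>\<in>pair ` N.Ln. card \<rho> = 2" by simp
  moreover have "card ri \<noteq> 2" "card re \<noteq> 2" by simp_all
  ultimately show "ri \<notin> pair ` N.Ln" "re \<notin> pair ` N.Ln" by metis+
  show "ri \<noteq> re" by auto
qed

lemma ray_vec_D: "ray_vec D ri = indicator {i}" "ray_vec D re = indicator E0"
    "G \<in> N.Ln \<Longrightarrow> ray_vec D (pair G) = indicator G"
  by (simp_all add: delta_fan_def pair_def subset_insertI Int_absorb2)

lemma comparable_Ln_not_i:
  assumes "F \<in> insert G {insert i G}" "F' \<in> insert H {insert i H}" "i \<notin> G" "i \<notin> H" "F \<subseteq> F' \<or> F' \<subseteq> F"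
  shows "G \<subseteq> H \<or> H \<subseteq> G"
  using assms by blast

text \<open>The suspension of the Bergman fan of the deletion: {i} and \<open>E0\<close> are
  incomparable, so a chain contains at most one of them, and each can be joined to any chain of
  pairs.\<close>

lemma cones_D_iff: "\<sigma> \<in> cones D \<longleftrightarrow>
    (\<exists>C\<in>cones N.B. \<sigma> = pair ` C \<or> \<sigma> = insert ri (pair ` C) \<or> \<sigma> = insert re (pair ` C))"
proof
  assume "\<sigma> \<in> cones D"
  then obtain C where C: "subset.chain (nontrivial_flats M) C" "\<sigma> = cls ` C"
    by (auto simp: delta_fan_def)
  have sub: "C \<subseteq> nontrivial_flats M" and comp: "\<And>A B. A \<in> C \<Longrightarrow> B \<in> C \<Longrightarrow> A \<subseteq> B \<or> B \<subseteq> A"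
    using C(1) by (auto simp: subset_chain_def)
  \<comment> \<open>The trace of the chain on the deletion: a pair counts if either of its members
    occurs. Comparability survives the removal of \<open>i\<close>.\<close>
  define C' where "C' = {G \<in> N.Ln. G \<in> C \<or> insert i G \<in> C}"
  have "G \<subseteq> H \<or> H \<subseteq> G" if GH: "G \<in> C'" "H \<in> C'" for G H
  proof -
    have ex: "\<exists>F. F \<in> C \<and> F \<in> insert G {insert i G}" if "G \<in> C'" for G
      using that unfolding C'_def by blast
    obtain F F' where "F \<in> C" "F \<in> insert G {insert i G}" "F' \<in> C" "F' \<in> insert H {insert i H}"
      using ex[OF GH(1)] ex[OF GH(2)] by (elim exE conjE)
    then show ?thesis
      using comparable_Ln_not_i[of F G F' H] comp[of F F'] GH Ln_not_i[of G] Ln_not_i[of H] by (simp add: C'_def)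
  qed
  then have C': "C' \<in> cones N.B"
    by (auto simp: N.cone_iff subset_chain_def C'_def)
  have "\<sigma> = (if {i} \<in> C then {ri} else {}) \<union> (if E0 \<in> C then {re} else {}) \<union> pair ` C'"
  proof (intro equalityI subsetI)
    fix \<rho> assume "\<rho> \<in> \<sigma>"
    then obtain F where F: "F \<in> C" "\<rho> = cls F" using C(2) by blast
    then consider "F = {i}" | "F = E0" | "F \<in> N.Ln" | G where "F = insert i G" "G \<in> N.Ln"
      using sub unfolding nontrivial_flats_M by blast
    then show "\<rho> \<in> (if {i} \<in> C then {ri} else {}) \<union> (if E0 \<in> C then {re} else {}) \<union> pair ` C'"
    proof cases
      case 3
      then have "F \<in> C'" "\<rho> = pair F" using F by (auto simp: C'_def cls_Ln)
      then show ?thesis by blast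
    next
      case 4
      then have "G \<in> C'" "\<rho> = pair G" using F by (auto simp: C'_def cls_insert)
      then show ?thesis by blast
    qed (use F cls_i cls_E0 in auto)
  next
    fix \<rho> assume "\<rho> \<in> (if {i} \<in> C then {ri} else {}) \<union> (if E0 \<in> C then {re} else {}) \<union> pair ` C'"
    then consider "\<rho> = ri" "{i} \<in> C" | "\<rho> = re" "E0 \<in> C" | G where "\<rho> = pair G" "G \<in> C'"
      by (auto split: if_splits)
    then show "\<rho> \<in> \<sigma>"
    proof cases
      case 3
      then have "G \<in> N.Ln" "G \<in> C \<or> insert i G \<in> C" by (auto simp: C'_def)
      then show ?thesis using 3 cls_Ln[of G] cls_insert[of G] unfolding C(2) by (metis imageI)
    qed (use cls_i cls_E0 C(2) in \<open>metis imageI\<close>)+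
  qed
  moreover have "\<not> ({i} \<in> C \<and> E0 \<in> C)"
    using comp[of "{i}" E0] E0_nonempty by blast
  ultimately show "\<exists>C\<in>cones N.B. \<sigma> = pair ` C \<or> \<sigma> = insert ri (pair ` C) \<or> \<sigma> = insert re (pair ` C)"
    using C' by (intro bexI[of _ C']) (auto split: if_splits)
next
  assume "\<exists>C\<in>cones N.B. \<sigma> = pair ` C \<or> \<sigma> = insert ri (pair ` C) \<or> \<sigma> = insert re (pair ` C)"
  then obtain C where C: "C \<in> cones N.B"
    and \<sigma>: "\<sigma> = pair ` C \<or> \<sigma> = insert ri (pair ` C) \<or> \<sigma> = insert re (pair ` C)" by blast
  have CLn: "C \<subseteq> N.Ln" by (rule N.cone_subset_Ln[OF C])
  have cls_C: "cls ` C = pair ` C" by (rule image_cong) (use CLn cls_Ln in auto)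
  have chain: "subset.chain (nontrivial_flats M) C"
    using C CLn by (auto simp: N.cone_iff subset_chain_def nontrivial_flats_M)
  have CE0: "G \<subseteq> E0" if "G \<in> C" for G
    using subsetD[OF CLn that] N.flat_subset_E[of G] by (simp add: Ln_iff)
  have chain_E0: "subset.chain (nontrivial_flats M) (insert E0 C)"
    using chain CE0 by (auto simp: subset_chain_insert nontrivial_flats_M)
  \<comment> \<open>\<open>E0\<close> lies above the flats of \<open>C\<close> themselves, whereas
    {i} is only below their lifts by \<open>i\<close>; both choices have the same image in the
    classes.\<close>
  have chain_i: "subset.chain (nontrivial_flats M) (insert {i} (insert i ` C))"
    unfolding subset_chain_insert
  proof (intro conjI)
    show "subset.chain (nontrivial_flats M) (insert i ` C)"
      unfolding subset_chain_def
    proof (intro conjI ballI)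
      show "insert i ` C \<subseteq> nontrivial_flats M" using CLn unfolding nontrivial_flats_M by blast
      fix X Y assume "X \<in> insert i ` C" "Y \<in> insert i ` C"
      then obtain G H where "X = insert i G" "Y = insert i H" "G \<in> C" "H \<in> C" by blast
      then show "X \<subseteq> Y \<or> Y \<subseteq> X" using N.cone_comparable[OF C, of G H] by blast
    qed
  qed (auto simp: nontrivial_flats_M)
  have cls_i_C: "cls ` insert i ` C = pair ` C"
    unfolding image_image by (rule image_cong) (use CLn cls_insert in auto)
  have coneI: "cls ` C' \<in> cones D" if "subset.chain (nontrivial_flats M) C'" for C'
    using that by (auto simp: delta_fan_def)
  show "\<sigma> \<in> cones D"
    using \<sigma> coneI[OF chain] coneI[OF chain_E0] coneI[OF chain_i]
    by (auto simp: cls_C cls_i_C cls_i cls_E0)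
qed

lemma card_pair_image: "C \<in> cones N.B \<Longrightarrow> card (pair ` C) = card C"
  using inj_on_subset[OF inj_pair N.cone_subset_Ln] by (rule card_image)

lemma pair_image_distinct:
  assumes C: "C \<in> cones N.B"
  shows "ri \<notin> pair ` C" "re \<notin> pair ` C"
proof -
  have "pair ` C \<subseteq> pair ` N.Ln" by (rule image_mono[OF N.cone_subset_Ln[OF C]])
  then show "ri \<notin> pair ` C" "re \<notin> pair ` C"
    using pair_distinct(2,3) by (meson contra_subsetD)+
qed

lemma cones_D_subset:
  assumes "\<sigma> \<in> cones D"
  shows "\<sigma> \<subseteq> rays D"
proof -
  obtain C where C: "C \<in> cones N.B" "\<sigma> = pair ` C \<or> \<sigma> = insert ri (pair ` C) \<or> \<sigma> = insert re (pair ` C)"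
    using assms unfolding cones_D_iff by (rule bexE)
  have "pair ` C \<subseteq> pair ` N.Ln" by (rule image_mono[OF N.cone_subset_Ln[OF C(1)]])
  then show ?thesis using C(2) unfolding rays_D by blast
qed

lemma fan_dim_D: "fan_dim D = rank_in N (ground N)"
proof -
  let ?r = "rank_in N (ground N)"
  have fin: "finite (cones D)"
  proof (rule finite_subset)
    show "cones D \<subseteq> Pow (rays D)"
      using cones_D_subset by blast
    show "finite (Pow (rays D))" using N.finite_nontrivial_flats by (simp add: rays_D)
  qed
  have le: "card \<sigma> \<le> ?r" if \<sigma>: "\<sigma> \<in> cones D" for \<sigma>
  proof -
    obtain C where C: "C \<in> cones N.B" "\<sigma> = pair ` C \<or> \<sigma> = insert ri (pair ` C) \<or> \<sigma> = insert re (pair ` C)"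
      using \<sigma> unfolding cones_D_iff by (rule bexE)
    have "card \<sigma> \<le> card (pair ` C) + 1"
      using C(2) N.cone_finite[OF C(1)] by (auto simp: card_insert_if)
    then show ?thesis
      using N.card_cone_bound[OF C(1)] N.rk_E_pos card_pair_image[OF C(1)] by simp
  qed
  have "fan_dim N.B \<in> card ` cones N.B"
    unfolding fan_dim_def using N.finite_cones N.cone_iff[of "{}"] by (intro Max_in) auto
  then obtain C where C: "C \<in> cones N.B" "card C = ?r - 1" by (auto simp: N.fan_dim_bergman)
  have "insert ri (pair ` C) \<in> cones D" using C by (auto simp: cones_D_iff)
  moreover have "card (insert ri (pair ` C)) = ?r"
    using C N.cone_finite[OF C(1)] pair_image_distinct[OF C(1)] card_pair_image[OF C(1)] N.rk_E_pos
    by simp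
  ultimately show ?thesis
    unfolding fan_dim_def using fin le by (intro Max_eqI) (auto intro: rev_image_eqI)
qed

text \<open>A cone without a pole can be enlarged by one, and enlarging the base with the pole fixed
  enlarges the whole cone, so the base is maximal too.\<close>

lemma maximal_cone_D:
  assumes \<sigma>: "\<sigma> \<in> maximal_cones D"
  obtains C where "C \<in> maximal_cones N.B" "\<sigma> = insert ri (pair ` C) \<or> \<sigma> = insert re (pair ` C)"
proof -
  have max: "\<tau> = \<sigma>" if "\<tau> \<in> cones D" "\<sigma> \<subseteq> \<tau>" for \<tau> using \<sigma> that by (simp add: maximal_cones_def)
  have "\<sigma> \<in> cones D" using \<sigma> by (simp add: maximal_cones_def)
  then obtain C where C: "C \<in> cones N.B" "\<sigma> = pair ` C \<or> \<sigma> = insert ri (pair ` C) \<or> \<sigma> = insert re (pair ` C)"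
    unfolding cones_D_iff by (rule bexE)
  have "insert ri (pair ` C) \<in> cones D" using C(1) by (auto simp: cones_D_iff)
  then have "\<sigma> \<noteq> pair ` C" using max[of "insert ri (pair ` C)"] pair_image_distinct(1)[OF C(1)] by auto
  then obtain \<rho> where \<rho>: "\<rho> \<in> {ri, re}" "\<sigma> = insert \<rho> (pair ` C)" using C(2) by blast
  have "C' = C" if C': "C' \<in> cones N.B" "C \<subseteq> C'" for C'
  proof -
    have "insert \<rho> (pair ` C') \<in> cones D" using \<rho>(1) C'(1) by (auto simp: cones_D_iff)
    then have "insert \<rho> (pair ` C') = \<sigma>" 
      by (rule max) (simp only: \<rho>(2) insert_mono image_mono C'(2))
    moreover have "\<rho> \<notin> pair ` C'" "\<rho> \<notin> pair ` C"
      using \<rho>(1) pair_image_distinct[OF C'(1)] pair_image_distinct[OF C(1)] by auto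
    ultimately have "pair ` C' = pair ` C" using \<rho>(2) insert_ident by metis
    then show ?thesis
      using inj_on_image_eq_iff[OF inj_pair N.cone_subset_Ln[OF C'(1)] N.cone_subset_Ln[OF C(1)]] by simp
  qed
  then have "C \<in> maximal_cones N.B" using C(1) by (simp add: maximal_cones_def)
  then show ?thesis using that \<rho> by blast
qed

sublocale D: pure_simplicial_fan D
proof
  show "finite (rays D)" using N.finite_nontrivial_flats by (simp add: rays_D)
  show "\<sigma> \<subseteq> rays D" if "\<sigma> \<in> cones D" for \<sigma>
    using that by (rule cones_D_subset)
  show "card \<sigma> = fan_dim D" if \<sigma>: "\<sigma> \<in> maximal_cones D" for \<sigma>
  proof (rule maximal_cone_D[OF \<sigma>])
    fix C assume C: "C \<in> maximal_cones N.B" "\<sigma> = insert ri (pair ` C) \<or> \<sigma> = insert re (pair ` C)"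
    then have cone: "C \<in> cones N.B" by (simp add: maximal_cones_def)
    show "card \<sigma> = fan_dim D"
      using C(2) N.card_maximal_cone[OF C(1)] card_pair_image[OF cone] pair_image_distinct[OF cone]
        N.cone_finite[OF cone] N.rk_E_pos by (auto simp: fan_dim_D)
  qed
  show "\<exists>l\<in>linear_functions (ambient D). l (ray_vec D \<rho>) = 1 \<and> (\<forall>\<rho>'\<in>\<sigma> - {\<rho>}. l (ray_vec D \<rho>') = 0)"
    if \<sigma>: "\<sigma> \<in> cones D" and \<rho>: "\<rho> \<in> \<sigma>" for \<sigma> \<rho>
  proof -
    obtain C where C: "C \<in> cones N.B" "\<sigma> = pair ` C \<or> \<sigma> = insert ri (pair ` C) \<or> \<sigma> = insert re (pair ` C)"
      using \<sigma> unfolding cones_D_iff by (rule bexE)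
    have CLn: "G \<in> N.Ln" if "G \<in> C" for G using N.cone_subset_Ln[OF C(1)] that by blast
    have lin: "(\<lambda>u. u a - u b) \<in> linear_functions (ambient D)" if "a \<in> ground M" "b \<in> ground M" for a b
      using linear_functions_coord_diff[OF that] by (simp add: delta_fan_def)
    \<comment> \<open>The largest flat of the chain is proper in \<open>E0\<close>, so some b avoids
      all of them. Then u_i - u_b and u_b - u_i are dual to the two poles.\<close>
    have "\<exists>b. b \<in> E0 \<and> (\<forall>G\<in>C. b \<notin> G)"
    proof (cases "C = {}")
      case False
      have "subset.chain N.Ln C" using C(1) by (simp add: N.cone_iff)
      then have "\<Union>C \<in> C" using N.cone_finite[OF C(1)] False by (intro Union_in_chain)
      then have "\<Union>C \<in> N.Ln" by (rule CLn)
      then have "\<Union>C \<subset> E0" using N.flat_subset_E[of "\<Union>C"] by (auto simp: Ln_iff)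
      then show ?thesis by blast
    qed (use E0_nonempty in blast)
    then obtain b where b: "b \<in> E0" "\<And>G. G \<in> C \<Longrightarrow> b \<notin> G" by blast
    consider "\<rho> = ri" "\<sigma> = insert ri (pair ` C)" | "\<rho> = re" "\<sigma> = insert re (pair ` C)"
      | G where "\<rho> = pair G" "G \<in> C"
      using C(2) \<rho> by blast
    then show ?thesis
    proof cases
      case 1
      then show ?thesis
        using b i_in_E CLn Ln_not_i
        by (intro bexI[OF _ lin[of i b]]) (auto simp: ray_vec_D indicator_def)
    next
      case 2
      then show ?thesis
        using b i_in_E CLn Ln_not_i
        by (intro bexI[OF _ lin[of b i]]) (auto simp: ray_vec_D indicator_def)
    next
      case 3
      obtain a c where ac: "a \<in> G" "c \<in> ground N - G" "\<And>H. H \<in> C \<Longrightarrow> H \<noteq> G \<Longrightarrow> a \<in> H \<longleftrightarrow> c \<in> H"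
        using N.cone_separate[OF C(1) 3(2)] by blast
      have aE: "a \<in> E0" using ac(1) CLn[OF 3(2)] N.flat_subset_E[of G] by (auto simp: Ln_iff)
      have H: "indicator H a - indicator H c = (if H = G then 1 else (0::real))" if "H \<in> C" for H
        using ac that by (auto simp: indicator_def)
      \<comment> \<open>The functional for a pair has to vanish on the poles as well; it does,
        because both a and c lie in \<open>E0\<close>.\<close>
      have "indicator {i} a - indicator {i} c = (0::real)" "indicator E0 a - indicator E0 c = (0::real)"
        using aE ac(2) by (auto simp: indicator_def)
      note base = this
      have "\<forall>\<rho>'\<in>\<sigma> - {\<rho>}. ray_vec D \<rho>' a - ray_vec D \<rho>' c = 0"
      proof
        fix \<rho>' assume \<rho>': "\<rho>' \<in> \<sigma> - {\<rho>}"
        then consider "\<rho>' = ri" | "\<rho>' = re" | H where "\<rho>' = pair H" "H \<in> C"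
          using C(2) by blast
        then show "ray_vec D \<rho>' a - ray_vec D \<rho>' c = 0"
        proof cases
          case (3 H)
          then have "H \<noteq> G" using \<rho>' \<open>\<rho> = pair G\<close> by blast
          then show ?thesis using 3 H[of H] CLn[of H] by (simp add: ray_vec_D)
        qed (use base in \<open>simp_all add: ray_vec_D\<close>)
      qed
      moreover have "ray_vec D \<rho> a - ray_vec D \<rho> c = 1"
        using 3 H[of G] CLn by (simp add: ray_vec_D)
      ultimately show ?thesis
        using aE ac(2) by (intro bexI[OF _ lin[of a c]]) auto
    qed
  qed
qed

end

section \<open>The sum of the two integrals as the volume of the suspension\<close>

lemma single_one_eq_iff: "single x (1::nat) = single y 1 \<longleftrightarrow> x = y"
  by (metis keys_single singleton_inject zero_neq_one)

text \<open>The all-ones vectors of \<open>E\<close> and of \<open>E - {i}\<close> differ by e_i, so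
  a functional that vanishes at e_i and at one of them vanishes at the other.\<close>

lemma linear_functions_restrict:
  assumes l: "l \<in> linear_functions E" and i: "i \<in> E" "l (indicator {i}) = 0"
  shows "l \<in> linear_functions (E - {i})"
proof -
  have add: "l (\<lambda>a. u a + v a) = l u + l v" if "\<forall>a. a \<notin> E \<longrightarrow> u a = 0 \<and> v a = 0" for u v
    using l that by (simp add: linear_functions_def)
  have "(\<lambda>a. indicator {i} a + indicator (E - {i}) a) = (indicator E :: 'a \<Rightarrow> real)"
    using i(1) by (auto simp: indicator_def fun_eq_iff)
  moreover have "l (\<lambda>a. indicator {i} a + indicator (E - {i}) a) = l (indicator {i}) + l (indicator (E - {i}))"
    by (rule add) (use i(1) in \<open>auto simp: indicator_def\<close>)
  ultimately have "l (indicator (E - {i})) = 0"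
    using l i(2) by (simp add: linear_functions_def)
  then show ?thesis using l by (simp add: linear_functions_def)
qed

lemma linear_functions_complement:
  assumes l: "l \<in> linear_functions E" and "finite E" "i \<in> E"
  shows "l (indicator (E - {i})) = - l (indicator {i})"
proof -
  have "(\<Sum>a\<in>E. l (indicator {a})) = l (indicator {i}) + (\<Sum>a\<in>E - {i}. l (indicator {a}))"
    using assms(2,3) by (rule sum.remove)
  then show ?thesis
    using linear_functions_sum_eq_0[OF l assms(2)] linear_functions_indicator[OF l, of "E - {i}"] assms(2)
    by simp
qed

locale coloop_relation = coloop_fan +
  fixes b :: "'a set set \<Rightarrow> real"
  assumes relation: "chow_class D (pvar ri - pvar re)
    = chow_class D (\<Sum>G\<in>N.Ln. pconst (b (pair G)) * pvar (pair G))"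
begin

sublocale A: line_substitution N.Ln pair ri "\<lambda>G. b (pair G)"
  by unfold_locales (use N.finite_nontrivial_flats inj_pair pair_distinct in auto)

sublocale A': line_substitution N.Ln pair re "\<lambda>G. - b (pair G)"
  by unfold_locales (use N.finite_nontrivial_flats inj_pair pair_distinct in auto)

abbreviation "vol \<equiv> matroid_volume N"

definition "V = A.I vol + A'.I vol"

lemma sum_rays_D:
  "(\<Sum>\<rho>\<in>rays D. h \<rho>) = h ri + h re + (\<Sum>G\<in>N.Ln. h (pair G))" for h :: "_ \<Rightarrow> 'b::comm_monoid_add"
proof -
  have "(\<Sum>\<rho>\<in>pair ` N.Ln. h \<rho>) = (\<Sum>G\<in>N.Ln. h (pair G))"
    using inj_pair by (simp add: sum.reindex)
  then show ?thesis
    unfolding rays_D using pair_distinct N.finite_nontrivial_flats by (simp add: add.assoc)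
qed

text \<open>The difference of the two sides of the hypothesis is a linear form in the ideal, and its
  coefficients are the values of the functional: 1 at the pole i and - b at the pairs.\<close>

lemma relation_functional:
  obtains l where "l \<in> linear_functions (ground M)" "l (indicator {i}) = 1"
    "\<And>G. G \<in> N.Ln \<Longrightarrow> l (indicator G) = - b (pair G)"
proof -
  let ?f = "pvar ri - pvar re" and ?g = "\<Sum>G\<in>N.Ln. pconst (b (pair G)) * pvar (pair G)"
  have singletons: "{\<rho>} \<in> cones D" if "\<rho> \<in> rays D" for \<rho>
  proof -
    have "{} \<in> cones N.B" by (simp add: N.cone_iff)
    then have *: "{ri} \<in> cones D" "{re} \<in> cones D"
      unfolding cones_D_iff by (auto intro!: bexI[of _ "{}"])
    have "{pair G} \<in> cones D" if "G \<in> N.Ln" for G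
    proof -
      have "{G} \<in> cones N.B" using that by (simp add: N.cone_iff subset_chain_def)
      then show ?thesis unfolding cones_D_iff by (auto intro!: bexI[of _ "{G}"])
    qed
    then show ?thesis using that * unfolding rays_D by blast
  qed
  have empty: "{} \<in> cones D"
  proof -
    have "{} \<in> cones N.B" by (simp add: N.cone_iff)
    then show ?thesis unfolding cones_D_iff by (auto intro!: bexI[of _ "{}"])
  qed
  have mem: "?f - ?g \<in> chow_ideal D"
  proof (subst D.chow_class_eq_iff[symmetric])
    show "pvars ?f \<subseteq> rays D" by (intro pvars_diff) (simp_all add: rays_D)
    show "pvars ?g \<subseteq> rays D" by (intro pvars_sum pvars_mult) (simp_all add: rays_D)
    show "chow_class D ?f = chow_class D ?g" by (rule relation)
  qed
  obtain l where l: "l \<in> linear_functions (ambient D)"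
    "\<And>\<rho>. \<rho> \<in> rays D \<Longrightarrow> lookup (?f - ?g) (single \<rho> 1) = l (ray_vec D \<rho>)"
    using D.chow_ideal_linear_part[OF singletons empty mem] by blast
  have lk: "lookup (?f - ?g) (single \<rho> 1) = (if \<rho> = ri then 1 else 0) - (if \<rho> = re then 1 else 0)
      - (\<Sum>G\<in>N.Ln. b (pair G) * (if \<rho> = pair G then 1 else 0))" for \<rho>
    by (simp only: lookup_minus lookup_sum lookup_pconst_mult lookup_pvar single_one_eq_iff)
  show ?thesis
  proof (rule that)
    show "l \<in> linear_functions (ground M)" using l(1) by (simp add: delta_fan_def)
    have "(\<Sum>G\<in>N.Ln. b (pair G) * (if ri = pair G then 1 else 0)) = 0"
      by (rule sum.neutral) (use pair_distinct(2) in auto)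
    then show "l (indicator {i}) = 1"
      using l(2)[of ri] lk[of ri] pair_distinct(1) by (simp add: rays_D ray_vec_D)
  next
    fix G assume G: "G \<in> N.Ln"
    have "(\<Sum>H\<in>N.Ln. b (pair H) * (if pair G = pair H then 1 else 0)) = (\<Sum>H\<in>N.Ln. if G = H then b (pair H) else 0)"
      by (rule sum.cong) (use G inj_onD[OF inj_pair] in auto)
    then have "(\<Sum>H\<in>N.Ln. b (pair H) * (if pair G = pair H then 1 else 0)) = b (pair G)"
      using G N.finite_nontrivial_flats by simp
    moreover have "pair G \<noteq> ri" "pair G \<noteq> re" using pair_distinct(2,3) G by auto
    moreover have "pair G \<in> rays D" using G by (simp add: rays_D)
    ultimately show "l (indicator G) = - b (pair G)"
      using l(2)[of "pair G"] lk[of "pair G"] ray_vec_D(3)[OF G] by simp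
  qed
qed

lemma partial_ri_V: "partial ri V = psubst A.s vol"
  unfolding V_def partial_add A.partial_v_I
  using A'.partial_other_I[OF N.pvars_matroid_volume pair_distinct(1,2)] by simp

lemma partial_re_V: "partial re V = psubst A'.s vol"
  unfolding V_def partial_add A'.partial_v_I
  using A.partial_other_I[OF N.pvars_matroid_volume pair_distinct(1)[symmetric] pair_distinct(3)] by simp

lemma partial_pair_V: "G \<in> N.Ln \<Longrightarrow> partial (pair G) V = A.I (partial G vol) + A'.I (partial G vol)"
  unfolding V_def partial_add
  by (simp add: A.partial_r_I[OF _ N.pvars_matroid_volume] A'.partial_r_I[OF _ N.pvars_matroid_volume])

text \<open>A non-cone contains both poles or two incomparable flats. In the first case the
  derivative along one pole no longer involves the other; in the second the two derivatives pass
  through both integrals and kill the volume of the deletion.\<close>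

lemma sr_V:
  assumes S: "S \<subseteq> rays D" and no: "\<not> (\<exists>\<sigma>\<in>cones D. S \<subseteq> \<sigma>)"
  shows "pdiff (\<Prod>\<rho>\<in>S. pvar \<rho>) V = 0"
proof -
  have fin: "finite S" using S D.finite_rays finite_subset by blast
  have kill: ?thesis if \<rho>: "\<rho> \<in> S" "\<rho>' \<in> S" "\<rho> \<noteq> \<rho>'" "partial \<rho> (partial \<rho>' V) = 0" for \<rho> \<rho>'
  proof -
    have \<rho>'S: "\<rho>' \<in> S - {\<rho>}" using \<rho> by blast
    have "(\<Prod>\<rho>\<in>S. pvar \<rho>) = (\<Prod>\<rho>\<in>S - {\<rho>} - {\<rho>'}. pvar \<rho>) * (pvar \<rho> * pvar \<rho>' :: 'a set set mpoly)"
      using prod.remove[OF fin \<rho>(1), of "pvar :: 'a set set \<Rightarrow> 'a set set mpoly"]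
        prod.remove[OF _ \<rho>'S, of "pvar :: 'a set set \<Rightarrow> 'a set set mpoly"] fin by (simp add: mult_ac)
    then show ?thesis using \<rho>(4) by (simp add: pdiff_mult)
  qed
  show ?thesis
  proof (cases "ri \<in> S \<and> re \<in> S")
    case True
    have "partial ri (partial re V) = 0"
      unfolding partial_re_V
      by (rule A'.partial_other_psubst[OF N.pvars_matroid_volume pair_distinct(1,2)])
    then show ?thesis using kill True pair_distinct(1) by blast
  next
    case False
    define C where "C = {G \<in> N.Ln. pair G \<in> S}"
    have "S \<subseteq> insert ri (insert re (pair ` C))"
    proof
      fix \<rho> assume "\<rho> \<in> S"
      moreover from this have "\<rho> = ri \<or> \<rho> = re \<or> (\<exists>G\<in>N.Ln. \<rho> = pair G)" using S by (auto simp: rays_D)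
      ultimately show "\<rho> \<in> insert ri (insert re (pair ` C))" unfolding C_def by blast
    qed
    then have sub: "S \<subseteq> insert ri (pair ` C) \<or> S \<subseteq> insert re (pair ` C)" using False by blast
    have "C \<notin> cones N.B"
    proof
      assume "C \<in> cones N.B"
      then have "insert ri (pair ` C) \<in> cones D" "insert re (pair ` C) \<in> cones D"
        unfolding cones_D_iff by blast+
      then show False using sub no by blast
    qed
    moreover have "C \<subseteq> N.Ln" by (auto simp: C_def)
    ultimately obtain F G where FG: "F \<in> C" "G \<in> C" "\<not> F \<subseteq> G" "\<not> G \<subseteq> F"
      by (auto simp: N.cone_iff subset_chain_def)
    then have Ln: "F \<in> N.Ln" "G \<in> N.Ln" and inS: "pair F \<in> S" "pair G \<in> S" by (simp_all add: C_def)
    have "pair F \<noteq> pair G" using inj_onD[OF inj_pair _ Ln] FG by blast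
    moreover have "partial (pair F) (partial (pair G) V) = 0"
      using pvars_partial[OF N.pvars_matroid_volume, of G] N.matroid_volume_incomparable[OF Ln FG(3,4)] Ln
      by (simp add: partial_pair_V partial_add A.partial_r_I A'.partial_r_I) (simp add: A.I_def A'.I_def)
    ultimately show ?thesis using kill inS by blast
  qed
qed

lemma linear_V:
  assumes l: "l \<in> linear_functions (ambient D)"
  shows "(\<Sum>\<rho>\<in>rays D. pconst (l (ray_vec D \<rho>)) * partial \<rho> V) = 0"
proof -
  have lM: "l \<in> linear_functions (ground M)" using l by (simp add: delta_fan_def)
  obtain l0 where l0: "l0 \<in> linear_functions (ground M)" "l0 (indicator {i}) = 1"
    "\<And>G. G \<in> N.Ln \<Longrightarrow> l0 (indicator G) = - b (pair G)"
    using relation_functional by blast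
  define c where "c = l (indicator {i})"
  define l' where "l' u = l u + (- c) * l0 u" for u
  have "l' \<in> linear_functions (ground M)"
    unfolding l'_def[abs_def] by (intro linear_functions_add linear_functions_scale lM l0(1))
  moreover have "l' (indicator {i}) = 0" by (simp add: l'_def c_def l0)
  ultimately have l': "l' \<in> linear_functions (ground N)"
    using linear_functions_restrict i_in_E by simp
  let ?p1 = "psubst A.s vol" and ?p2 = "psubst A'.s vol" and ?p0 = "psubst (\<lambda>G. pvar (pair G)) vol"
  have "(\<Sum>G\<in>N.Ln. pconst (l' (indicator G)) * partial (pair G) (A.I vol)) = 0"
    "(\<Sum>G\<in>N.Ln. pconst (l' (indicator G)) * partial (pair G) (A'.I vol)) = 0"
    unfolding A.sum_partial_r_I[OF N.pvars_matroid_volume] A'.sum_partial_r_I[OF N.pvars_matroid_volume]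
      N.matroid_volume_linear[OF l'] by (simp_all add: A.I_def A'.I_def)
  then have N_part: "(\<Sum>G\<in>N.Ln. pconst (l' (indicator G)) * partial (pair G) V) = 0"
    unfolding V_def partial_add distrib_left sum.distrib by simp
  have "(\<Sum>G\<in>N.Ln. pconst (- b (pair G)) * partial (pair G) (A.I vol)) = - (?p1 - ?p0)"
    unfolding A.fundamental_theorem[OF N.pvars_matroid_volume, symmetric] pconst_uminus
    by (simp add: sum_negf)
  moreover have "(\<Sum>G\<in>N.Ln. pconst (- b (pair G)) * partial (pair G) (A'.I vol)) = ?p2 - ?p0"
    by (rule A'.fundamental_theorem[OF N.pvars_matroid_volume])
  ultimately have b_part: "(\<Sum>G\<in>N.Ln. pconst (- b (pair G)) * partial (pair G) V) = ?p2 - ?p1"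
    unfolding V_def partial_add distrib_left sum.distrib by simp
  have "(\<Sum>G\<in>N.Ln. pconst (l (ray_vec D (pair G))) * partial (pair G) V)
      = (\<Sum>G\<in>N.Ln. pconst (l' (indicator G)) * partial (pair G) V
          + pconst c * (pconst (- b (pair G)) * partial (pair G) V))"
  proof (rule sum.cong)
    fix G assume G: "G \<in> N.Ln"
    have "l (indicator G) = l' (indicator G) + c * (- b (pair G))"
      by (simp add: l'_def l0(3)[OF G])
    then show "pconst (l (ray_vec D (pair G))) * partial (pair G) V
        = pconst (l' (indicator G)) * partial (pair G) V + pconst c * (pconst (- b (pair G)) * partial (pair G) V)"
      by (simp only: ray_vec_D(3)[OF G] pconst_add pconst_mult distrib_right mult.assoc)
  qed simp
  also have "\<dots> = pconst c * (?p2 - ?p1)"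
    by (simp only: sum.distrib N_part b_part add_0 flip: sum_distrib_left)
  finally have pairs: "(\<Sum>G\<in>N.Ln. pconst (l (ray_vec D (pair G))) * partial (pair G) V) = pconst c * (?p2 - ?p1)" .
  \<comment> \<open>The all-ones vector is zero in the quotient, so the poles carry opposite values.
    They contribute c times \<open>?p1\<close> and - c times \<open>?p2\<close>, which cancels the
    sum over the pairs.\<close>
  have "l (indicator E0) = - c"
    unfolding c_def by (rule linear_functions_complement[OF lM M.finite_E i_in_E])
  then show ?thesis
    unfolding sum_rays_D pairs ray_vec_D(1,2) partial_ri_V partial_re_V c_def[symmetric]
    by (simp add: pconst_uminus algebra_simps)
qed

lemma maximal_V:
  assumes \<sigma>: "\<sigma> \<in> maximal_cones D"
  shows "pdiff (\<Prod>\<rho>\<in>\<sigma>. pvar \<rho>) V = 1"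
proof (rule maximal_cone_D[OF \<sigma>])
  fix C assume C: "C \<in> maximal_cones N.B" and \<sigma>C: "\<sigma> = insert ri (pair ` C) \<or> \<sigma> = insert re (pair ` C)"
  have cone: "C \<in> cones N.B" using C by (simp add: maximal_cones_def)
  have CLn: "C \<subseteq> N.Ln" by (rule N.cone_subset_Ln[OF cone])
  have fin: "finite (pair ` C)" using N.cone_finite[OF cone] by simp
  have ins: "pdiff (\<Prod>\<rho>'\<in>insert \<rho> (pair ` C). pvar \<rho>') V = pdiff (\<Prod>\<rho>'\<in>pair ` C. pvar \<rho>') (partial \<rho> V)"
    if "\<rho> \<notin> pair ` C" for \<rho>
    using fin that by (simp add: mult.commute[of "pvar \<rho>"] pdiff_mult)
  show ?thesis
    using \<sigma>C
  proof
    assume "\<sigma> = insert ri (pair ` C)"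
    then show ?thesis
      using ins[OF pair_image_distinct(1)[OF cone]] A.pdiff_prod_r_psubst[OF CLn N.pvars_matroid_volume]
      by (simp add: partial_ri_V N.matroid_volume_maximal_cone[OF C])
  next
    assume "\<sigma> = insert re (pair ` C)"
    then show ?thesis
      using ins[OF pair_image_distinct(2)[OF cone]] A'.pdiff_prod_r_psubst[OF CLn N.pvars_matroid_volume]
      by (simp add: partial_re_V N.matroid_volume_maximal_cone[OF C])
  qed
qed

lemma mixed_volume_D: "mixed_volume D = V"
proof (rule D.mixed_volume_eqI)
  have dim: "Suc (rank_in N (ground N) - 1) = fan_dim D" using N.rk_E_pos by (simp add: fan_dim_D)
  have "pvars (A.I vol) \<subseteq> rays D" "pvars (A'.I vol) \<subseteq> rays D"
    using A.I_form(1)[OF N.pvars_matroid_volume N.homogeneous_matroid_volume]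
      A'.I_form(1)[OF N.pvars_matroid_volume N.homogeneous_matroid_volume] by (auto simp: rays_D)
  moreover have "homogeneous (fan_dim D) (A.I vol)" "homogeneous (fan_dim D) (A'.I vol)"
    using A.I_form(2)[OF N.pvars_matroid_volume N.homogeneous_matroid_volume]
      A'.I_form(2)[OF N.pvars_matroid_volume N.homogeneous_matroid_volume] unfolding dim by simp_all
  ultimately show "V \<in> forms D (fan_dim D)"
    by (simp add: D.forms_iff V_def pvars_add homogeneous_add)
qed (fact sr_V linear_V maximal_V)+

end

theorem theorem1p8:
  fixes M :: "'a matroid" and i :: 'a and d k :: nat
    and Fs :: "nat \<Rightarrow> 'a set" and b :: "'a set set \<Rightarrow> real"
  assumes "is_matroid M" and "mrank M = d + 1" and "d \<ge> 1"
    and "coloop M i" and "{i} \<in> flats M"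
    and "bij_betw Fs {1..k} (S_set M i)"
    and "\<And>l m. l \<in> {1..k} \<Longrightarrow> m \<in> {1..k} \<Longrightarrow> Fs l \<subset> Fs m \<Longrightarrow> l < m"
    and "chow_class (delta_fan M i Fs k)
           (pvar (ray_class M i Fs k {i}) - pvar (ray_class M i Fs k (ground M - {i}))) =
         chow_class (delta_fan M i Fs k)
           (\<Sum>G\<in>nontrivial_flats (deletion M i).
              pconst (b (ray_class M i Fs k (mclosure M G))) * pvar (ray_class M i Fs k (mclosure M G)))"
  shows "mixed_volume (delta_fan M i Fs k) =
      antideriv (ray_class M i Fs k {i})
        (psubst (\<lambda>G. pvar (ray_class M i Fs k (mclosure M G))
             + pconst (b (ray_class M i Fs k (mclosure M G))) * pvar (ray_class M i Fs k {i}))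
           (matroid_volume (deletion M i)))
    + antideriv (ray_class M i Fs k (ground M - {i}))
        (psubst (\<lambda>G. pvar (ray_class M i Fs k (mclosure M G))
             - pconst (b (ray_class M i Fs k (mclosure M G))) * pvar (ray_class M i Fs k (ground M - {i})))
           (matroid_volume (deletion M i)))"
proof -
  interpret coloop_fan M i Fs k
    by unfold_locales (use assms in auto)
  have cls: "cls (mclosure M G) = pair G" if "G \<in> N.Ln" for G
    using that by (simp add: closure_Ln cls_Ln)
  have "(\<Sum>G\<in>N.Ln. pconst (b (cls (mclosure M G))) * pvar (cls (mclosure M G)))
      = (\<Sum>G\<in>N.Ln. pconst (b (pair G)) * pvar (pair G))"
    by (rule sum.cong) (simp_all add: cls)
  then interpret coloop_relation M i Fs k b
    using assms(8) by unfold_locales (simp add: cls_i cls_E0)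
  \<comment> \<open>Closures and classes simplify only for nontrivial flats of the deletion; this
    suffices, as its volume contains no other variables.\<close>
  have "psubst (\<lambda>G. pvar (cls (mclosure M G)) + pconst (b (cls (mclosure M G))) * pvar ri) vol = psubst A.s vol"
    by (rule psubst_cong) (use N.pvars_matroid_volume in \<open>auto simp: A.s_def cls subset_iff\<close>)
  moreover have "psubst (\<lambda>G. pvar (cls (mclosure M G)) - pconst (b (cls (mclosure M G))) * pvar re) vol = psubst A'.s vol"
    by (rule psubst_cong) (use N.pvars_matroid_volume in \<open>auto simp: A'.s_def cls subset_iff pconst_uminus\<close>)
  ultimately show ?thesis
    unfolding cls_i cls_E0 mixed_volume_D V_def A.I_def A'.I_def by simp
qed

end
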